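(* Let $n,m\ge 1$ be integers and let $P\in\mathbb{P}^n$ be a point of complex projective $n$-space. Every $m$-superfat point supported at $P$ is a locally complete intersection of $n$ hypersurfaces with multiplicity $m$ at $P$ whose tangent cones at $P$ have no common line. Thus any $m$-superfat point in $\mathbb{P}^n$ has length $m^n$.
   Context: $\mathbb{P}^n$ is projective $n$-space over $\mathbb{C}$, and $\ell(\cdot)$ denotes the length of a 0-dimensional scheme. An $m$-symmetric scheme is a 0-dimensional scheme $X$ supported at one point $P\in\mathbb{P}^n$ such that $\ell(X\cap L)=m$ for every line $L$ passing through $P$ (scheme-theoretic intersection). An $m$-superfat point is an $m$-symmetric scheme in $\mathbb{P}^n$ that is maximal, with respect to scheme-theoretic inclusion, among $m$-symmetric schemes. Saying that $X$ (supported at $P$) is a locally complete intersection of $n$ hypersurfaces with multiplicity $m$ at $P$ and tangent cones without common lines means: there are hypersurfaces $\{K_1=0\},\dots,\{K_n=0\}$, each of multiplicity exactly $m$ at $P$, such that no line through $P$ is contained in all of their tangent cones at $P$, and such that $X$ is the component supported at $P$ of the scheme defined by $(K_1,\dots,K_n)$ (i.e. $K_1,\dots,K_n$ generate the ideal of $X$ in the local ring at $P$). *)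

theory Defs
  imports
    "HOL-Analysis.Analysis"
    "HOL-Library.Poly_Mapping"
    "HOL-Library.Extended_Nat"
    "HOL-Computational_Algebra.Fraction_Field"
begin

text \<open>
  Projective n-space has homogeneous coordinates indexed by a finite type \<open>'v\<close> with n + 1 elements;
  its points are given by nonzero representatives in \<open>complex ^ 'v\<close>. The linear order on \<open>'v\<close> plays
  no mathematical role: it is what the library uses to show that the polynomial ring is a domain.
\<close>

type_synonym 'v cpoly = "('v \<Rightarrow>\<^sub>0 nat) \<Rightarrow>\<^sub>0 complex"

global_interpretation ideal: module "(*) :: 'a::comm_ring_1 \<Rightarrow> 'a \<Rightarrow> 'a"
  by standard (simp_all add: algebra_simps)

text \<open>Above, \<open>ideal.subspace\<close> is the predicate of being an ideal and \<open>ideal.span\<close> the generated ideal.\<close>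


subsection \<open>Polynomials\<close>

definition const :: "complex \<Rightarrow> ('v::finite) cpoly"
  where "const c = Poly_Mapping.single 0 c"

definition var :: "'v::finite \<Rightarrow> 'v cpoly"
  where "var i = Poly_Mapping.single (Poly_Mapping.single i 1) 1"

definition poly_subst :: "(complex \<Rightarrow> 'a::comm_ring_1) \<Rightarrow> ('v::finite \<Rightarrow> 'a) \<Rightarrow> 'v cpoly \<Rightarrow> 'a"
  where "poly_subst \<phi> a f =
    (\<Sum>u\<in>Poly_Mapping.keys f.
       \<phi> (Poly_Mapping.lookup f u) * (\<Prod>i\<in>UNIV. a i ^ Poly_Mapping.lookup u i))"

definition eval :: "complex ^ 'v::finite \<Rightarrow> 'v cpoly \<Rightarrow> complex"
  where "eval v = poly_subst (\<lambda>c. c) (\<lambda>i. v $ i)"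

definition mdeg :: "('v::finite \<Rightarrow>\<^sub>0 nat) \<Rightarrow> nat"
  where "mdeg u = (\<Sum>i\<in>UNIV. Poly_Mapping.lookup u i)"

definition homogeneous :: "nat \<Rightarrow> ('v::finite) cpoly \<Rightarrow> bool"
  where "homogeneous d f \<longleftrightarrow> (\<forall>u\<in>Poly_Mapping.keys f. mdeg u = d)"

definition hom_part :: "nat \<Rightarrow> ('v::finite) cpoly \<Rightarrow> 'v cpoly"
  where "hom_part d f =
    (\<Sum>u | u \<in> Poly_Mapping.keys f \<and> mdeg u = d.
       Poly_Mapping.single u (Poly_Mapping.lookup f u))"


subsection \<open>Closed subschemes of projective space\<close>

text \<open>
  A closed subscheme is represented by its saturated homogeneous ideal. This correspondence is
  bijective and reverses inclusions.
\<close>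

definition homogeneous_ideal :: "('v::finite) cpoly set \<Rightarrow> bool"
  where "homogeneous_ideal I \<longleftrightarrow> ideal.subspace I \<and> (\<forall>f\<in>I. \<forall>d. hom_part d f \<in> I)"

definition saturation :: "('v::finite) cpoly set \<Rightarrow> 'v cpoly set"
  where "saturation I = {f. \<exists>k. \<forall>g. homogeneous k g \<longrightarrow> g * f \<in> I}"

definition closed_subscheme :: "('v::finite) cpoly set \<Rightarrow> bool"
  where "closed_subscheme X \<longleftrightarrow> homogeneous_ideal X \<and> saturation X = X"

definition subscheme_le :: "('v::finite) cpoly set \<Rightarrow> 'v cpoly set \<Rightarrow> bool"
  where "subscheme_le X Y \<longleftrightarrow> Y \<subseteq> X"

text \<open>The closed subscheme cut out by a set of homogeneous polynomials.\<close>

definition scheme_of :: "('v::finite) cpoly set \<Rightarrow> 'v cpoly set"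
  where "scheme_of F = saturation (ideal.span F)"

definition scheme_inter :: "('v::finite) cpoly set \<Rightarrow> 'v cpoly set \<Rightarrow> 'v cpoly set"
  where "scheme_inter X Y = scheme_of (X \<union> Y)"

text \<open>
  The underlying set of the scheme is the one point \<open>[P]\<close>; in particular the scheme is nonempty and
  of dimension 0.
\<close>

definition supported_at :: "complex ^ 'v::finite \<Rightarrow> 'v cpoly set \<Rightarrow> bool"
  where "supported_at P X \<longleftrightarrow>
    {v. v \<noteq> 0 \<and> (\<forall>f\<in>X. eval v f = 0)} = {c *s P | c. c \<noteq> 0}"


subsection \<open>Local rings and length\<close>

text \<open>
  The stalk at \<open>[P]\<close> of the ideal sheaf of \<open>X\<close>, as an ideal of the local ring of projective space at
  \<open>[P]\<close>. The latter consists of the fractions of homogeneous polynomials of equal degree whose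
  denominator does not vanish at \<open>P\<close>; it is the stalk for \<open>X = UNIV\<close>.
\<close>

definition stalk :: "complex ^ 'v::{finite,linorder} \<Rightarrow> 'v cpoly set \<Rightarrow> 'v cpoly fract set"
  where "stalk P X =
    {Fract f g | f g. f \<in> X \<and> (\<exists>d. homogeneous d f \<and> homogeneous d g) \<and> eval P g \<noteq> 0}"

abbreviation local_ring :: "complex ^ 'v::{finite,linorder} \<Rightarrow> 'v cpoly fract set"
  where "local_ring P \<equiv> stalk P UNIV"

text \<open>
  The dimension of the complex vector space \<open>V / W\<close>, for subspaces \<open>W \<subseteq> V\<close> of the function field:
  the supremum of the sizes of finite subsets of \<open>V\<close> that are linearly independent modulo \<open>W\<close>.
\<close>

definition quotient_dim ::
    "('v::{finite,linorder}) cpoly fract set \<Rightarrow> 'v cpoly fract set \<Rightarrow> enat"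
  where "quotient_dim V W =
    Sup {enat (card B) | B. finite B \<and> B \<subseteq> V \<and>
      (\<forall>c. (\<Sum>b\<in>B. Fract (const (c b)) 1 * b) \<in> W \<longrightarrow> (\<forall>b\<in>B. c b = 0))}"

text \<open>
  The dimension of the local ring of \<open>X\<close> at \<open>[P]\<close> over the complex numbers. If \<open>X\<close> is supported at
  \<open>[P]\<close> this is the length of \<open>X\<close>.
\<close>

definition scheme_length :: "complex ^ 'v::{finite,linorder} \<Rightarrow> 'v cpoly set \<Rightarrow> enat"
  where "scheme_length P X = quotient_dim (local_ring P) (stalk P X)"


subsection \<open>Symmetric schemes and superfat points\<close>

text \<open>Lines through \<open>[P]\<close> are given by the two-dimensional linear subspaces containing \<open>P\<close>.\<close>

definition line_through :: "complex ^ 'v::finite \<Rightarrow> (complex ^ 'v) set \<Rightarrow> bool"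
  where "line_through P L \<longleftrightarrow> vec.subspace L \<and> vec.dim L = 2 \<and> P \<in> L"

definition vanishing_ideal :: "(complex ^ 'v::finite) set \<Rightarrow> 'v cpoly set"
  where "vanishing_ideal L = {f. \<forall>v\<in>L. eval v f = 0}"

definition m_symmetric :: "nat \<Rightarrow> complex ^ 'v::{finite,linorder} \<Rightarrow> 'v cpoly set \<Rightarrow> bool"
  where "m_symmetric m P X \<longleftrightarrow>
    P \<noteq> 0 \<and> closed_subscheme X \<and> supported_at P X \<and>
    (\<forall>L. line_through P L \<longrightarrow> scheme_length P (scheme_inter X (vanishing_ideal L)) = enat m)"

definition superfat_point :: "nat \<Rightarrow> complex ^ 'v::{finite,linorder} \<Rightarrow> 'v cpoly set \<Rightarrow> bool"
  where "superfat_point m P X \<longleftrightarrow>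
    m_symmetric m P X \<and> (\<forall>Q Y. m_symmetric m Q Y \<and> subscheme_le X Y \<longrightarrow> Y = X)"


subsection \<open>Hypersurfaces, multiplicities and tangent cones\<close>

definition hypersurface :: "('v::finite) cpoly \<Rightarrow> bool"
  where "hypersurface K \<longleftrightarrow> K \<noteq> 0 \<and> (\<exists>d>0. homogeneous d K)"

text \<open>
  The Taylor expansion \<open>K (P + x)\<close>. If \<open>P = (1, 0, \<dots>, 0)\<close> and \<open>K\<close> is the sum of the
  \<open>x0 ^ (d - j) * F j\<close> with \<open>F j\<close> a form of degree \<open>j\<close> in the affine coordinates \<open>x1, \<dots>, xn\<close>, it is the sum
  of the \<open>(1 + x0) ^ (d - j) * F j\<close>. So its lowest nonzero homogeneous part is the lowest nonzero
  \<open>F j\<close>, which defines the projective tangent cone at \<open>[P]\<close>, and its degree is the multiplicity.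
\<close>

definition taylor :: "complex ^ 'v::finite \<Rightarrow> 'v cpoly \<Rightarrow> 'v cpoly"
  where "taylor P K = poly_subst const (\<lambda>i. const (P $ i) + var i) K"

definition multiplicity_at :: "complex ^ 'v::finite \<Rightarrow> 'v cpoly \<Rightarrow> nat"
  where "multiplicity_at P K = (LEAST j. hom_part j (taylor P K) \<noteq> 0)"

definition tangent_cone :: "complex ^ 'v::finite \<Rightarrow> 'v cpoly \<Rightarrow> (complex ^ 'v) set"
  where "tangent_cone P K = {v. eval v (hom_part (multiplicity_at P K) (taylor P K)) = 0}"

end

theory Submission
  imports Defs "HOL-Computational_Algebra.Fundamental_Theorem_Algebra"
begin

text \<open>
  Let \<open>X\<close> be \<open>m\<close>-symmetric. Restricting to the lines through \<open>P\<close> shows that every element of the ideal of \<open>X\<close>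
  has order at least \<open>m\<close> at \<open>P\<close>, and that the leading forms of degree \<open>m\<close> have no common zero in the
  projectivized tangent space. Starting from the regular sequence of the coordinates, replace the coordinates
  one after the other by such leading forms: a leading form that avoids the finitely many zeros of the other
  members of the sequence is a nonzerodivisor modulo them. So \<open>n\<close> of the leading forms are a regular sequence.
  They are the leading forms of forms \<open>K\<^sub>1, \<dots>, K\<^sub>n\<close> of a common degree in the ideal of \<open>X\<close>. Regularity implies
  that they generate all leading forms of the local ideal \<open>(K\<^sub>1, \<dots>, K\<^sub>n)\<close>. Hence the component \<open>Y\<close> at \<open>P\<close> of
  the scheme defined by the \<open>K\<^sub>i\<close> is \<open>m\<close>-symmetric, and it has the length of the graded ring modulo a regular
  sequence of \<open>n\<close> forms of degree \<open>m\<close>, which is \<open>m\<^sup>n\<close> as for \<open>x\<^sub>1\<^sup>m, \<dots>, x\<^sub>n\<^sup>m\<close>. Since \<open>Y\<close> contains \<open>X\<close>, it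
  equals \<open>X\<close> if \<open>X\<close> is superfat.
\<close>

text \<open>Being superfat enters only through maximality; the work is to enclose an arbitrary
  \<open>m\<close>-symmetric scheme in a complete intersection that is again
  \<open>m\<close>-symmetric. The local ring at \<open>P\<close> is not graded, whereas all counting
  happens in a graded ring, and the Taylor expansion at \<open>P\<close> mediates between them. It
  lives in n + 1 variables although the local ring has dimension n. Hence a coordinate
  \<open>j\<close> with \<open>P $ j\<close> nonzero is fixed and \<open>var j\<close> is adjoined
  to the ideals of leading forms: modulo \<open>var j\<close> a leading form is a form in the n
  affine coordinates. Leading forms alone describe a local ideal only up to terms of higher and
  higher order. What makes successive approximation stop is \<open>local_powers\<close>: by
  Nakayama's lemma a power of the maximal ideal lies in the local ideal of the chosen hypersurfaces.
  The link with lines is \<open>coeff_line_poly\<close>: the coefficients of a restriction to the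
  line in direction \<open>v\<close> are the values at \<open>v\<close> of the parts of the Taylor
  expansion, and the length on the line is the least order of such a restriction.\<close>

abbreviation (input) "lookup \<equiv> Poly_Mapping.lookup"

abbreviation (input) "keys \<equiv> Poly_Mapping.keys"

abbreviation (input) "single \<equiv> Poly_Mapping.single"


text \<open>As a simplification rule this reassociates products to the left and loops with \<open>mult.assoc\<close>.\<close>

declare ideal.scale_scale [simp del]

subsection \<open>Polynomials\<close>

lemma poly_mapping_sum_singles:
  "f = (\<Sum>u\<in>keys f. single u (lookup f u))"
  by (rule poly_mapping_eqI)
     (simp add: lookup_sum lookup_single in_keys_iff when_def)

lemma const_0 [simp]: "const 0 = 0"
  and const_1 [simp]: "const 1 = 1"
  and const_add: "const (a + b) = const a + const b"
  and const_mult: "const (a * b) = const a * const b"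
  and const_uminus: "const (- a) = - const a"
  by (simp_all add: const_def single_add mult_single single_uminus)

lemma const_sum: "const (sum f A) = (\<Sum>x\<in>A. const (f x))"
  by (induction A rule: infinite_finite_induct) (simp_all add: const_add)

lemma lookup_const_mult: "lookup (const c * f) u = c * lookup f u"
proof -
  have "const c * f = (\<Sum>v\<in>keys f. single v (c * lookup f v))"
    by (subst (1) poly_mapping_sum_singles[of f])
       (simp add: const_def sum_distrib_left mult_single)
  then show ?thesis
    by (simp add: lookup_sum lookup_single in_keys_iff when_def)
qed

lemma lookup_prod_vars:
  "(\<Prod>i\<in>UNIV. var i ^ lookup u i) = single u 1"
proof -
  have pow: "var i ^ k = single (single i k) 1" for i :: 'a and k
    by (induction k) (simp_all add: var_def mult_single single_add[symmetric])
  have "(\<Prod>i\<in>A. var i ^ lookup u i)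
      = single (\<Sum>i\<in>A. single i (lookup u i)) 1" for A
    by (induction A rule: infinite_finite_induct) (simp_all add: pow mult_single)
  moreover have "(\<Sum>i\<in>UNIV. single i (lookup u i)) = u"
    by (rule poly_mapping_eqI) (simp add: lookup_sum lookup_single when_def)
  ultimately show ?thesis by simp
qed

lemma single_eq: "single u c = const c * (\<Prod>i\<in>UNIV. var i ^ lookup u i)"
  by (simp add: lookup_prod_vars const_def mult_single)

text \<open>Used to compare ring homomorphisms and to prove congruences modulo an ideal: both are
  compatible with sums and products, so that constants and variables suffice.\<close>

lemma cpoly_induct [case_names const var add mult]:
  assumes "\<And>c. Q (const c)" and "\<And>i. Q (var i)"
    and add: "\<And>f g. Q f \<Longrightarrow> Q g \<Longrightarrow> Q (f + g)" and mult: "\<And>f g. Q f \<Longrightarrow> Q g \<Longrightarrow> Q (f * g)"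
  shows "Q f"
proof -
  have Q0: "Q 0" using assms(1)[of 0] by simp
  have Q1: "Q 1" using assms(1)[of 1] by simp
  have pow: "Q (g ^ k)" if "Q g" for g k
    by (induction k) (simp_all add: Q1 mult that)
  have prod: "Q (prod g A)" if "\<And>i. Q (g i)" for g :: "'a \<Rightarrow> 'a cpoly" and A
    by (induction A rule: infinite_finite_induct) (simp_all add: Q1 mult that)
  have single: "Q (single u c)" for u c
    unfolding single_eq by (intro mult assms prod pow)
  have sum: "Q (sum g A)" if "\<And>u. Q (g u)" for g :: "('a \<Rightarrow>\<^sub>0 nat) \<Rightarrow> 'a cpoly" and A
    by (induction A rule: infinite_finite_induct) (simp_all add: Q0 add that)
  show ?thesis
    by (subst poly_mapping_sum_singles) (intro sum single)
qed

text \<open>The coefficient map is a parameter because substitution has three targets: complex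
  numbers for evaluation, the polynomial ring for coordinate changes and Taylor expansion,
  univariate polynomials for restriction to a line.\<close>

locale coeff_hom =
  fixes \<phi> :: "complex \<Rightarrow> 'a::comm_ring_1"
  assumes hom_0: "\<phi> 0 = 0" and hom_1: "\<phi> 1 = 1"
    and hom_add: "\<phi> (x + y) = \<phi> x + \<phi> y" and hom_mult: "\<phi> (x * y) = \<phi> x * \<phi> y"
begin

lemma subst_superset:
  assumes "finite U" "keys f \<subseteq> U"
  shows "poly_subst \<phi> a f =
    (\<Sum>u\<in>U. \<phi> (lookup f u) * (\<Prod>i\<in>UNIV. a i ^ lookup u i))"
  unfolding poly_subst_def
  by (rule sum.mono_neutral_left) (use assms in \<open>auto simp: in_keys_iff hom_0\<close>)

lemma subst_add: "poly_subst \<phi> a (f + g) = poly_subst \<phi> a f + poly_subst \<phi> a g"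
  by (subst (1 2 3) subst_superset[of "keys f \<union> keys g"])
     (use keys_add[of f g] in \<open>auto simp: lookup_add hom_add algebra_simps sum.distrib\<close>)

lemma subst_0 [simp]: "poly_subst \<phi> a 0 = 0"
  by (simp add: poly_subst_def)

lemma subst_single: "poly_subst \<phi> a (single u c) = \<phi> c * (\<Prod>i\<in>UNIV. a i ^ lookup u i)"
  by (subst subst_superset[of "{u}"]) auto

lemma subst_const [simp]: "poly_subst \<phi> a (const c) = \<phi> c"
  by (simp add: const_def subst_single)

lemma subst_1 [simp]: "poly_subst \<phi> a 1 = 1"
  using subst_const[of a 1] by (simp add: hom_1)

lemma subst_var [simp]: "poly_subst \<phi> a (var i) = a i"
proof -
  have "(\<Prod>k\<in>UNIV. a k ^ lookup (single i 1) k) =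
      (\<Prod>k\<in>UNIV. if k = i then a k else 1)"
    by (rule prod.cong) (auto simp: lookup_single when_def)
  then show ?thesis by (simp add: var_def subst_single hom_1)
qed

lemma subst_sum: "poly_subst \<phi> a (sum f A) = (\<Sum>x\<in>A. poly_subst \<phi> a (f x))"
  by (induction A rule: infinite_finite_induct) (simp_all add: subst_add)

lemma subst_mult: "poly_subst \<phi> a (f * g) = poly_subst \<phi> a f * poly_subst \<phi> a g"
proof -
  have m: "poly_subst \<phi> a (single u c * single v d) =
     poly_subst \<phi> a (single u c) * poly_subst \<phi> a (single v d)" for u v c d
    by (simp add: mult_single subst_single hom_mult lookup_add power_add prod.distrib)
  show ?thesis
    unfolding arg_cong2[OF poly_mapping_sum_singles[of f] poly_mapping_sum_singles[of g], of "(*)"]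
      arg_cong[OF poly_mapping_sum_singles[of f], of "poly_subst \<phi> a"]
      arg_cong[OF poly_mapping_sum_singles[of g], of "poly_subst \<phi> a"]
    by (simp add: sum_product subst_sum m)
qed

lemma subst_power: "poly_subst \<phi> a (f ^ k) = poly_subst \<phi> a f ^ k"
  by (induction k) (simp_all add: subst_mult)

lemma subst_prod: "poly_subst \<phi> a (prod f A) = (\<Prod>x\<in>A. poly_subst \<phi> a (f x))"
  by (induction A rule: infinite_finite_induct) (simp_all add: subst_mult)

lemma subst_uminus: "poly_subst \<phi> a (- f) = - poly_subst \<phi> a f"
  using subst_add[of a f "- f"] by (simp add: eq_neg_iff_add_eq_0 add.commute)

lemma subst_diff: "poly_subst \<phi> a (f - g) = poly_subst \<phi> a f - poly_subst \<phi> a g"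
  using subst_add[of a f "- g"] by (simp add: subst_uminus)

lemmas subst_simps = subst_add subst_mult subst_power subst_uminus subst_diff

lemma subst_subst: "poly_subst \<phi> a (poly_subst const b f) = poly_subst \<phi> (\<lambda>i. poly_subst \<phi> a (b i)) f"
proof -
  have "poly_subst \<phi> a (poly_subst const b f) =
    (\<Sum>u\<in>keys f. \<phi> (lookup f u) *
       (\<Prod>i\<in>UNIV. poly_subst \<phi> a (b i) ^ lookup u i))"
    by (simp add: poly_subst_def[of const b] subst_sum subst_mult subst_prod subst_power)
  then show ?thesis by (simp add: poly_subst_def)
qed

end

interpretation cs: coeff_hom "const :: complex \<Rightarrow> 'v::finite cpoly"
  by standard (simp_all add: const_add const_mult)

interpretation ev: coeff_hom "\<lambda>c. c :: complex"
  by standard simp_all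

interpretation up: coeff_hom "\<lambda>c. [:c:] :: complex poly"
  by standard (simp_all add: one_pCons)

lemma eval_const [simp]: "eval v (const c) = c"
  and eval_var [simp]: "eval v (var i) = v $ i"
  and eval_0 [simp]: "eval v 0 = 0"
  and eval_1 [simp]: "eval v 1 = 1"
  and eval_add [simp]: "eval v (f + g) = eval v f + eval v g"
  and eval_mult [simp]: "eval v (f * g) = eval v f * eval v g"
  and eval_power [simp]: "eval v (f ^ k) = eval v f ^ k"
  and eval_uminus [simp]: "eval v (- f) = - eval v f"
  and eval_diff [simp]: "eval v (f - g) = eval v f - eval v g"
  and eval_sum: "eval v (sum h A) = (\<Sum>x\<in>A. eval v (h x))"
  by (simp_all add: eval_def ev.subst_simps ev.subst_sum)

lemma eval_subst: "eval v (poly_subst const a f) = eval (\<chi> i. eval v (a i)) f"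
  by (simp add: eval_def ev.subst_subst)

section \<open>Homogeneous parts and forms\<close>

lemma lookup_hom_part:
  "lookup (hom_part d f) u = (if mdeg u = d then lookup f u else 0)"
  unfolding hom_part_def lookup_sum lookup_single when_def
  by (simp add: in_keys_iff)

lemma hom_part_add: "hom_part d (f + g) = hom_part d f + hom_part d g"
  by (rule poly_mapping_eqI) (simp add: lookup_hom_part lookup_add)

lemma hom_part_0 [simp]: "hom_part d 0 = 0"
  by (rule poly_mapping_eqI) (simp add: lookup_hom_part)

lemma hom_part_diff: "hom_part d (f - g) = hom_part d f - hom_part d g"
  by (rule poly_mapping_eqI) (simp add: lookup_hom_part lookup_minus)

lemma hom_part_sum: "hom_part d (sum f A) = (\<Sum>x\<in>A. hom_part d (f x))"
  by (induction A rule: infinite_finite_induct) (simp_all add: hom_part_add)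

lemma homogeneous_lookup: "homogeneous d f \<longleftrightarrow> (\<forall>u. lookup f u \<noteq> 0 \<longrightarrow> mdeg u = d)"
  by (auto simp: homogeneous_def in_keys_iff)

lemma homogeneous_hom_part [simp]: "homogeneous d (hom_part d f)"
  by (simp add: homogeneous_lookup lookup_hom_part)

lemma hom_part_homogeneous: "homogeneous d f \<Longrightarrow> hom_part e f = (if e = d then f else 0)"
  by (rule poly_mapping_eqI) (auto simp: lookup_hom_part homogeneous_lookup)

lemma homogeneous_0 [simp]: "homogeneous d 0"
  by (simp add: homogeneous_lookup)

lemma homogeneous_add: "homogeneous d f \<Longrightarrow> homogeneous d g \<Longrightarrow> homogeneous d (f + g)"
  by (simp add: homogeneous_lookup lookup_add) (metis add.right_neutral)

lemma homogeneous_diff: "homogeneous d f \<Longrightarrow> homogeneous d g \<Longrightarrow> homogeneous d (f - g)"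
  by (simp add: homogeneous_lookup lookup_minus) metis

lemma homogeneous_sum: "(\<And>x. x \<in> A \<Longrightarrow> homogeneous d (f x)) \<Longrightarrow> homogeneous d (sum f A)"
  by (induction A rule: infinite_finite_induct) (simp_all add: homogeneous_add)

lemma mdeg_0 [simp]: "mdeg 0 = 0"
  by (simp add: mdeg_def)

lemma mdeg_add: "mdeg (u + v) = mdeg u + mdeg v"
  by (simp add: mdeg_def lookup_add sum.distrib)

lemma mdeg_single [simp]: "mdeg (single i k) = k"
  by (simp add: mdeg_def lookup_single when_def)

lemma homogeneous_const [simp]: "homogeneous 0 (const c)"
  by (auto simp: homogeneous_def const_def)

lemma homogeneous_1 [simp]: "homogeneous 0 1"
  using homogeneous_const[of 1] by simp

lemma homogeneous_var [simp]: "homogeneous 1 (var i)"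
  by (auto simp: homogeneous_def var_def)

lemma homogeneous_single: "homogeneous (mdeg u) (single u c)"
  by (auto simp: homogeneous_def)

lemma homogeneous_mult: "homogeneous d f \<Longrightarrow> homogeneous e g \<Longrightarrow> homogeneous (d + e) (f * g)"
  unfolding homogeneous_def using keys_mult[of f g] by (fastforce simp: mdeg_add)

lemma homogeneous_power: "homogeneous d f \<Longrightarrow> homogeneous (k * d) (f ^ k)"
  by (induction k) (simp_all add: homogeneous_mult)

lemma homogeneous_const_mult: "homogeneous d f \<Longrightarrow> homogeneous d (const c * f)"
  using homogeneous_mult[of 0 "const c" d f] by simp

lemma homogeneous_prod:
  "(\<And>x. x \<in> A \<Longrightarrow> homogeneous (d x) (f x)) \<Longrightarrow> homogeneous (sum d A) (prod f A)"
  by (induction A rule: infinite_finite_induct) (simp_all add: homogeneous_mult)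

lemma homogeneous_subst:
  assumes "\<And>i. homogeneous 1 (a i)" "homogeneous d f"
  shows "homogeneous d (poly_subst const a f)"
  unfolding poly_subst_def
proof (rule homogeneous_sum)
  fix u assume u: "u \<in> keys f"
  have "homogeneous (\<Sum>i\<in>UNIV. lookup u i) (\<Prod>i\<in>UNIV. a i ^ lookup u i)"
    by (rule homogeneous_prod) (use homogeneous_power[OF assms(1)] in simp)
  then show "homogeneous d (const (lookup f u) * (\<Prod>i\<in>UNIV. a i ^ lookup u i))"
    using assms(2) u by (intro homogeneous_const_mult) (simp add: homogeneous_def mdeg_def)
qed

lemma sum_hom_parts:
  assumes "\<And>u. lookup f u \<noteq> 0 \<Longrightarrow> mdeg u \<in> A" "finite A"
  shows "(\<Sum>d\<in>A. hom_part d f) = f"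
  by (rule poly_mapping_eqI) (use assms in \<open>auto simp: lookup_sum lookup_hom_part\<close>)

text \<open>The bound may be enlarged at will, so that the range of the sum can be made to cover a
  prescribed degree as well.\<close>

lemma ex_sum_hom_parts: obtains N where "\<And>M. N \<le> M \<Longrightarrow> f = (\<Sum>d\<le>M. hom_part d f)"
  and "\<And>d. N < d \<Longrightarrow> hom_part d f = 0"
proof
  let ?N = "Max (insert 0 (mdeg ` keys f))"
  have N: "mdeg u \<le> ?N" if "lookup f u \<noteq> 0" for u
    using that by (auto simp: in_keys_iff intro!: Max_ge)
  show "f = (\<Sum>d\<le>M. hom_part d f)" if "?N \<le> M" for M
    by (rule sum_hom_parts[symmetric]) (use N[THEN order_trans, OF _ that] in simp_all)
  show "hom_part d f = 0" if "?N < d" for d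
  proof (rule poly_mapping_eqI)
    fix u show "lookup (hom_part d f) u = lookup 0 u"
      using N[of u] that by (cases "mdeg u = d") (auto simp: lookup_hom_part simp del: Max_insert)
  qed
qed

lemma hom_part_homogeneous_mult:
  assumes "homogeneous e g"
  shows "hom_part d (g * f) = (if e \<le> d then g * hom_part (d - e) f else 0)"
proof -
  obtain N where N: "\<And>M. N \<le> M \<Longrightarrow> f = (\<Sum>d\<le>M. hom_part d f)"
    by (rule ex_sum_hom_parts[of f]) blast
  have "hom_part d (g * f) = (\<Sum>k\<le>N + d. hom_part d (g * hom_part k f))"
    by (subst N[of "N + d"]) (simp_all add: sum_distrib_left hom_part_sum)
  also have "\<dots> = (\<Sum>k\<le>N + d. if k = d - e \<and> e \<le> d then g * hom_part k f else 0)"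
    by (intro sum.cong refl)
       (auto simp: hom_part_homogeneous[OF homogeneous_mult[OF assms homogeneous_hom_part]])
  also have "\<dots> = (if e \<le> d then g * hom_part (d - e) f else 0)"
    by (cases "e \<le> d") (simp_all)
  finally show ?thesis .
qed

lemma hom_part_const_mult: "hom_part d (const c * f) = const c * hom_part d f"
  by (simp add: hom_part_homogeneous_mult[of 0])

lemma hom_part_mult: "hom_part d (f * g) = (\<Sum>i\<le>d. hom_part i f * hom_part (d - i) g)"
proof -
  obtain N where N: "\<And>M. N \<le> M \<Longrightarrow> f = (\<Sum>d\<le>M. hom_part d f)"
    by (rule ex_sum_hom_parts[of f]) blast
  have "hom_part d (f * g) = (\<Sum>k\<le>N + d. hom_part d (hom_part k f * g))"
    by (subst N[of "N + d"]) (simp_all add: sum_distrib_right hom_part_sum)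
  also have "\<dots> = (\<Sum>k\<le>N + d. if k \<le> d then hom_part k f * hom_part (d - k) g else 0)"
    by (intro sum.cong refl) (simp add: hom_part_homogeneous_mult[OF homogeneous_hom_part])
  also have "\<dots> = (\<Sum>k\<le>d. hom_part k f * hom_part (d - k) g)"
    by (rule sum.mono_neutral_cong_right) auto
  finally show ?thesis .
qed

lemma hom_part_hom_part: "hom_part d (hom_part e f) = (if d = e then hom_part d f else 0)"
  by (simp add: hom_part_homogeneous[OF homogeneous_hom_part])

lemma eval_scale:
  assumes "homogeneous d f"
  shows "eval (c *s v) f = c ^ d * eval v f"
proof -
  have *: "c ^ d * (x * (\<Prod>i\<in>UNIV. (v $ i) ^ lookup u i)) =
     x * (\<Prod>i\<in>UNIV. (c * v $ i) ^ lookup u i)" if "u \<in> keys f" for u x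
  proof -
    have "d = mdeg u" using that assms by (simp add: homogeneous_def)
    then show ?thesis by (simp add: mdeg_def power_sum power_mult_distrib prod.distrib)
  qed
  show ?thesis
    unfolding eval_def poly_subst_def sum_distrib_left vector_smult_component
    by (intro sum.cong refl *[symmetric])
qed

lemma finite_mdeg: "finite {u :: 'v::finite \<Rightarrow>\<^sub>0 nat. mdeg u = d}"
proof (rule finite_imageD)
  show "inj_on lookup {u :: 'v \<Rightarrow>\<^sub>0 nat. mdeg u = d}"
    by (simp add: inj_on_def lookup_inject)
  have "lookup ` {u :: 'v \<Rightarrow>\<^sub>0 nat. mdeg u = d} \<subseteq> PiE UNIV (\<lambda>_. {..d})"
    by (auto simp: mdeg_def intro: member_le_sum)
  then show "finite (lookup ` {u :: 'v \<Rightarrow>\<^sub>0 nat. mdeg u = d})"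
    by (rule finite_subset) (simp add: finite_PiE)
qed

lemma homogeneous_ideal_span:
  assumes "\<And>g. g \<in> G \<Longrightarrow> \<exists>d. homogeneous d g"
  shows "homogeneous_ideal (ideal.span G)"
  unfolding homogeneous_ideal_def
proof (intro conjI ballI allI)
  fix f d assume "f \<in> ideal.span G"
  then show "hom_part d f \<in> ideal.span G"
  proof (induction rule: ideal.span_induct_alt)
    case base then show ?case by (simp add: ideal.span_zero)
  next
    case (step c x y)
    obtain e where "homogeneous e x" using assms step by blast
    then have "hom_part d (x * c) \<in> ideal.span G"
      using ideal.span_scale[OF ideal.span_base[OF step(1)]]
      unfolding hom_part_homogeneous_mult[OF \<open>homogeneous e x\<close>]
      by (simp add: mult.commute[of x] ideal.span_zero)
    then show ?case using step by (simp add: hom_part_add ideal.span_add mult.commute)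
  qed
qed simp

lemma homogeneous_idealD: "homogeneous_ideal I \<Longrightarrow> f \<in> I \<Longrightarrow> hom_part d f \<in> I"
  by (simp add: homogeneous_ideal_def)

lemma homogeneous_ideal_subspace: "homogeneous_ideal I \<Longrightarrow> ideal.subspace I"
  by (simp add: homogeneous_ideal_def)

lemma homogeneous_idealI:
  assumes "ideal.subspace I" "\<And>d. hom_part d f \<in> I"
  shows "f \<in> I"
proof -
  obtain N where N: "\<And>M. N \<le> M \<Longrightarrow> f = (\<Sum>d\<le>M. hom_part d f)"
    by (rule ex_sum_hom_parts[of f]) blast
  show ?thesis
    by (subst N[OF order_refl]) (simp add: ideal.subspace_sum assms)
qed

lemma eval_zero_imp_zero:
  assumes "\<And>v. eval v f = 0"
  shows "f = (0 :: 'v::finite cpoly)"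
proof -
  \<comment> \<open>Induction over the variables. Injectivity says that the exponents in
    \<open>U\<close> are told apart by the variables in \<open>A\<close>; this survives when the
    exponent of one further variable is fixed.\<close>
  have *: "\<forall>u\<in>U. c u = 0"
    if "finite A" "finite U" "inj_on (\<lambda>u. restrict (lookup u) A) U"
      "\<And>v :: 'v \<Rightarrow> complex. (\<Sum>u\<in>U. c u * (\<Prod>i\<in>A. v i ^ lookup u i)) = 0"
    for A and U :: "('v \<Rightarrow>\<^sub>0 nat) set" and c
    using that
  proof (induction A arbitrary: U c)
    case empty
    then have "u = w" if "u \<in> U" "w \<in> U" for u w
      using that by (auto simp: inj_on_def)
    then consider "U = {}" | u where "U = {u}" by blast
    then show ?case using empty by cases auto
  next
    case (insert a A)
    show ?case
    proof
      fix w assume w: "w \<in> U"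
      let ?k = "lookup w a"
      let ?U = "\<lambda>k. {u\<in>U. lookup u a = k}"
      have "\<forall>u\<in>?U ?k. c u = 0"
      proof (rule insert.IH)
        show "finite (?U ?k)" using insert by simp
        show "inj_on (\<lambda>u. restrict (lookup u) A) (?U ?k)"
        proof (rule inj_onI)
          fix u u' assume u: "u \<in> ?U ?k" "u' \<in> ?U ?k"
            "restrict (lookup u) A = restrict (lookup u') A"
          then have "restrict (lookup u) (insert a A) = restrict (lookup u') (insert a A)"
            by (auto simp: restrict_def fun_eq_iff) metis
          then show "u = u'"
            by (rule inj_onD[OF insert.prems(2)]) (use u in simp_all)
        qed
        fix v :: "'v \<Rightarrow> complex"
        define q where "q u = c u * (\<Prod>i\<in>A. v i ^ lookup u i)" for u
        \<comment> \<open>With the other variables fixed at \<open>v\<close>, the sum is a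
          polynomial in the variable \<open>a\<close> that vanishes everywhere; its coefficient at
          \<open>?k\<close> is the part of the sum with that exponent.\<close>
        define p where "p = (\<Sum>u\<in>U. monom (q u) (lookup u a))"
        have "poly p x = 0" for x
        proof -
          have e: "(\<Prod>i\<in>insert a A. (v(a := x)) i ^ lookup u i) =
             x ^ lookup u a * (\<Prod>i\<in>A. v i ^ lookup u i)" for u
          proof -
            have "(\<Prod>i\<in>A. (v(a := x)) i ^ lookup u i) = (\<Prod>i\<in>A. v i ^ lookup u i)"
              by (rule prod.cong) (use insert(2) in auto)
            then show ?thesis using insert(1,2) by (simp del: fun_upd_apply add: fun_upd_same)
          qed
          have "poly p x = (\<Sum>u\<in>U. c u * (\<Prod>i\<in>insert a A. (v(a := x)) i ^ lookup u i))"
            unfolding e p_def q_def poly_sum poly_monom by (rule sum.cong) (simp_all only: mult_ac)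
          also have "\<dots> = 0" by (rule insert.prems(3))
          finally show ?thesis .
        qed
        then have "p = 0" by (simp flip: poly_all_0_iff_0)
        then have "coeff p ?k = 0" by simp
        then show "(\<Sum>u\<in>?U ?k. c u * (\<Prod>i\<in>A. v i ^ lookup u i)) = 0"
          unfolding p_def using insert.prems(1)
          by (simp add: coeff_sum q_def sum.inter_filter)
      qed
      then show "c w = 0" using w by simp
    qed
  qed
  have "\<forall>u\<in>keys f. lookup f u = 0"
  proof (rule *[of UNIV])
    show "inj_on (\<lambda>u. restrict (lookup u) UNIV) (keys f)"
      by (rule inj_onI, rule poly_mapping_eqI) (metis UNIV_I restrict_apply')
    fix v :: "'v \<Rightarrow> complex"
    show "(\<Sum>u\<in>keys f. lookup f u * (\<Prod>i\<in>UNIV. v i ^ lookup u i)) = 0"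
      using assms[of "\<chi> i. v i"] by (simp add: eval_def poly_subst_def)
  qed simp_all
  then show ?thesis
    by (intro poly_mapping_eqI) (auto simp: in_keys_iff)
qed


subsection \<open>Independence modulo a subspace\<close>

text \<open>Gaussian elimination by induction on the equations: an equation with a nonzero
  coefficient at some unknown \<open>j\<close> expresses this unknown through the others.\<close>

lemma underdetermined_system:
  fixes a :: "'i \<Rightarrow> 'k \<Rightarrow> 'a::field"
  assumes "finite K" "finite I" "card K < card I"
  shows "\<exists>c. (\<exists>i\<in>I. c i \<noteq> 0) \<and> (\<forall>k\<in>K. (\<Sum>i\<in>I. c i * a i k) = 0)"
  using assms
proof (induction K arbitrary: I a)
  case empty
  then obtain i where "i \<in> I" by fastforce
  then show ?case by (intro exI[of _ "\<lambda>_. 1"]) auto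
next
  case (insert k K)
  show ?case
  proof (cases "\<forall>i\<in>I. a i k = 0")
    case True
    have "card K < card I" using insert by simp
    from insert.IH[OF insert.prems(1) this, of a] obtain c where
      "\<exists>i\<in>I. c i \<noteq> 0" "\<forall>l\<in>K. (\<Sum>i\<in>I. c i * a i l) = 0" by blast
    then show ?thesis using True by (intro exI[of _ c]) auto
  next
    case False
    then obtain j where j: "j \<in> I" "a j k \<noteq> 0" by blast
    let ?I = "I - {j}"
    have "card K < card ?I" "finite ?I" using insert j by auto
    from insert.IH[OF this(2,1), of "\<lambda>i l. a i l - a i k / a j k * a j l"] obtain c where
      c: "\<exists>i\<in>?I. c i \<noteq> 0" "\<forall>l\<in>K. (\<Sum>i\<in>?I. c i * (a i l - a i k / a j k * a j l)) = 0" by blast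
    \<comment> \<open>The value at \<open>j\<close> is forced by equation \<open>k\<close>; the
      remaining equations were reduced by this very substitution.\<close>
    define e where "e = c(j := - (\<Sum>i\<in>?I. c i * a i k) / a j k)"
    have split: "(\<Sum>i\<in>I. e i * a i l) = e j * a j l + (\<Sum>i\<in>?I. c i * a i l)" for l
      using j insert.prems(1) by (subst sum.remove[of I j]) (auto simp: e_def intro!: sum.cong)
    have "(\<Sum>i\<in>I. e i * a i l) = 0" if "l \<in> insert k K" for l
    proof (cases "l = k")
      case True
      then show ?thesis using j by (simp add: split) (simp add: e_def)
    next
      case False
      then have "(\<Sum>i\<in>?I. c i * (a i l - a i k / a j k * a j l)) = 0" using c(2) that by blast
      then have "(\<Sum>i\<in>?I. c i * a i l) = (\<Sum>i\<in>?I. c i * a i k) / a j k * a j l"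
        by (simp add: algebra_simps sum_subtractf sum_distrib_left sum_distrib_right sum_divide_distrib)
      then show ?thesis by (simp add: split) (simp add: e_def)
    qed
    moreover have "\<exists>i\<in>I. e i \<noteq> 0" using c(1) by (auto simp: e_def)
    ultimately show ?thesis by blast
  qed
qed

text \<open>The bound on independent families in the quotient by \<open>W\<close>, phrased with
  representatives. In this form it serves ideals, functions on a set of zeros and stalks
  alike.\<close>

lemma (in vector_space) card_le_of_independent_modulo:
  assumes W: "subspace W" and "finite K" "finite I"
    and indep: "\<And>c. (\<Sum>i\<in>I. scale (c i) (g i)) \<in> W \<Longrightarrow> \<forall>i\<in>I. c i = 0"
    and span: "\<And>i. i \<in> I \<Longrightarrow> \<exists>a. g i - (\<Sum>k\<in>K. scale (a k) (h k)) \<in> W"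
  shows "card I \<le> card K"
proof (rule ccontr)
  assume "\<not> card I \<le> card K"
  obtain a where a: "\<And>i. i \<in> I \<Longrightarrow> g i - (\<Sum>k\<in>K. scale (a i k) (h k)) \<in> W"
    using span by metis
  obtain c where c: "\<exists>i\<in>I. c i \<noteq> 0" "\<forall>k\<in>K. (\<Sum>i\<in>I. c i * a i k) = 0"
    using underdetermined_system[of K I a] assms \<open>\<not> card I \<le> card K\<close> by auto
  have "(\<Sum>i\<in>I. scale (c i) (g i - (\<Sum>k\<in>K. scale (a i k) (h k)))) \<in> W"
    by (intro subspace_sum subspace_scale W a)
  also have "(\<Sum>i\<in>I. scale (c i) (g i - (\<Sum>k\<in>K. scale (a i k) (h k)))) =
    (\<Sum>i\<in>I. scale (c i) (g i)) - (\<Sum>k\<in>K. scale (\<Sum>i\<in>I. c i * a i k) (h k))"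
    unfolding scale_right_diff_distrib scale_sum_right scale_sum_left sum_subtractf scale_scale
    by (subst (2) sum.swap) simp
  also have "\<dots> = (\<Sum>i\<in>I. scale (c i) (g i))" using c(2) by simp
  finally show False using indep c(1) by blast
qed

interpretation cv: vector_space "\<lambda>c f. const c * f"
  by standard (simp_all add: const_add const_mult algebra_simps)

lemma ideal_span_eq: "ideal.subspace I \<Longrightarrow> ideal.span I = I"
  by simp

lemma ideal_subspace_vector_subspace: "ideal.subspace I \<Longrightarrow> cv.subspace I"
  by (simp add: cv.subspace_def ideal.subspace_def)

lemma monomial_expansion:
  assumes "\<And>u. lookup f u \<noteq> 0 \<Longrightarrow> u \<in> U" "finite U"
  shows "f = (\<Sum>u\<in>U. const (lookup f u) * single u 1)"
proof (rule poly_mapping_eqI)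
  fix k
  show "lookup f k =
    lookup (\<Sum>u\<in>U. const (lookup f u) * single u 1) k"
    using assms by (cases "k \<in> U")
      (auto simp: lookup_sum lookup_const_mult lookup_single when_def if_distrib[of "\<lambda>x. _ * x"] cong: if_cong)
qed

subsection \<open>The Nullstellensatz\<close>

lemma ex_maximal_ideal:
  assumes "ideal.subspace I" "1 \<notin> I"
  obtains M where "ideal.subspace M" "I \<subseteq> M" "1 \<notin> M"
    "\<And>N. ideal.subspace N \<Longrightarrow> M \<subseteq> N \<Longrightarrow> 1 \<notin> N \<Longrightarrow> N = M"
proof -
  let ?A = "{M. ideal.subspace M \<and> I \<subseteq> M \<and> 1 \<notin> M}"
  have "\<exists>M\<in>?A. \<forall>X\<in>?A. M \<subseteq> X \<longrightarrow> X = M"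
  proof (rule subset_Zorn_nonempty)
    show "?A \<noteq> {}" using assms by blast
    fix C assume C: "C \<noteq> {}" "subset.chain ?A C"
    then have sub: "ideal.subspace M" "I \<subseteq> M" "1 \<notin> M" if "M \<in> C" for M
      using that by (auto simp: subset.chain_def)
    have lin: "M \<subseteq> N \<or> N \<subseteq> M" if "M \<in> C" "N \<in> C" for M N
      using C that by (auto simp: subset.chain_def)
    have "ideal.subspace (\<Union>C)"
    proof (rule ideal.subspaceI)
      show "0 \<in> \<Union>C" using C sub(1) ideal.subspace_0 by fastforce
      show "x + y \<in> \<Union>C" if xy: "x \<in> \<Union>C" "y \<in> \<Union>C" for x y
      proof -
        obtain M N where "M \<in> C" "N \<in> C" "x \<in> M" "y \<in> N" using xy by blast
        then show ?thesis using lin[of M N] sub(1) ideal.subspace_add by (metis UnionI subsetD)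
      qed
      show "c * x \<in> \<Union>C" if "x \<in> \<Union>C" for c x
        using that sub(1) ideal.subspace_scale by blast
    qed
    then show "\<Union>C \<in> ?A" using C sub by blast
  qed
  then obtain M where M: "M \<in> ?A" "\<forall>X\<in>?A. M \<subseteq> X \<longrightarrow> X = M" by blast
  show thesis
    by (rule that[of M]) (use M in \<open>auto dest: order_trans\<close>)
qed

definition poly_at :: "'v::finite cpoly \<Rightarrow> complex poly \<Rightarrow> 'v cpoly"
  where "poly_at x p = poly (map_poly const p) x"

lemma poly_at_simps [simp]: "poly_at x 0 = 0" "poly_at x (pCons c p) = const c + x * poly_at x p"
  by (simp_all add: poly_at_def map_poly_pCons)

lemma poly_at_add: "poly_at x (p + q) = poly_at x p + poly_at x q"
proof (induction p arbitrary: q)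
  case (pCons a p)
  then show ?case by (cases q) (simp add: const_add algebra_simps)
qed simp

lemma poly_at_smult: "poly_at x (smult c p) = const c * poly_at x p"
  by (induction p) (simp_all add: const_mult algebra_simps)

lemma poly_at_mult: "poly_at x (p * q) = poly_at x p * poly_at x q"
proof (induction p)
  case (pCons a p)
  then show ?case by (simp add: poly_at_add poly_at_smult) (simp add: algebra_simps)
qed simp

lemma poly_at_1 [simp]: "poly_at x 1 = 1"
  by (simp add: one_pCons)

lemma poly_at_sum: "poly_at x (sum f A) = (\<Sum>a\<in>A. poly_at x (f a))"
  by (induction A rule: infinite_finite_induct) (simp_all add: poly_at_add)

lemma poly_at_prod: "poly_at x (prod f A) = (\<Prod>a\<in>A. poly_at x (f a))"
  by (induction A rule: infinite_finite_induct) (simp_all add: poly_at_mult)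

text \<open>
  If \<open>x - a\<close> were invertible modulo the maximal ideal for every complex \<open>a\<close>, then the uncountably
  many inverses would be linearly independent, but the polynomials have countable dimension.
\<close>

lemma maximal_ideal_ex_root:
  fixes M :: "'v::finite cpoly set"
  assumes M: "ideal.subspace M" "1 \<notin> M"
    and max: "\<And>N. ideal.subspace N \<Longrightarrow> M \<subseteq> N \<Longrightarrow> 1 \<notin> N \<Longrightarrow> N = M"
  shows "\<exists>a. x - const a \<in> M"
proof (rule ccontr)
  assume none: "\<nexists>a. x - const a \<in> M"
  have inv: "\<exists>g. 1 - g * y \<in> M" if "y \<notin> M" for y
  proof -
    have "1 \<in> ideal.span (insert y M)"
      using max[of "ideal.span (insert y M)"] that ideal.span_superset[of "insert y M"] by auto
    then show ?thesis
      by (simp add: ideal.span_breakdown_eq ideal_span_eq[OF M(1)])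
  qed
  have prime: "b \<in> M" if ab: "a * b \<in> M" "a \<notin> M" for a b
  proof -
    obtain g where "1 - g * a \<in> M" using inv ab(2) by blast
    then have "b * (1 - g * a) + g * (a * b) \<in> M"
      using M(1) ab(1) by (metis ideal.subspace_add ideal.subspace_scale)
    then show ?thesis by (simp add: algebra_simps)
  qed
  \<comment> \<open>So \<open>x\<close> is transcendental modulo \<open>M\<close>: over the complex
    numbers \<open>p\<close> splits into linear factors, none of them has its value in
    \<open>M\<close>, and \<open>M\<close> is prime.\<close>
  have no_poly: "poly_at x p \<notin> M" if "p \<noteq> 0" for p
    using that
  proof (induction "degree p" arbitrary: p)
    case 0
    then obtain c where c: "p = [:c:]" "c \<noteq> 0" using degree_eq_zeroE by (metis pCons_0_0)
    have "const (1 / c) * const c = 1" using c(2) by (simp flip: const_mult)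
    then show ?case using c M ideal.subspace_scale[OF M(1), of "const c" "const (1 / c)"] by (metis mult_zero_right add_0_right poly_at_simps)
  next
    case (Suc n)
    then have "\<not> constant (poly p)" by (simp add: constant_degree)
    then obtain r where "poly p r = 0" using fundamental_theorem_of_algebra by blast
    then obtain q where q: "p = [:-r, 1:] * q" by (metis dvdE poly_eq_0_iff_dvd)
    then have "q \<noteq> 0" using Suc by auto
    then have "degree p = Suc (degree q)" using degree_mult_eq[of "[:-r, 1:]" q] q by simp
    then have "poly_at x q \<notin> M" using Suc \<open>q \<noteq> 0\<close> by simp
    moreover have "poly_at x p = (x - const r) * poly_at x q"
      unfolding q poly_at_mult by (simp add: const_uminus)
    ultimately show ?case using prime none by metis
  qed
  have "\<exists>g. 1 - g * (x - const a) \<in> M" for a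
    using inv none by blast
  then obtain g where g: "\<And>a. 1 - g a * (x - const a) \<in> M" by metis
  \<comment> \<open>The parameters are sorted by the degree of the inverse. Countably many classes
    cover an uncountable set, so one class is infinite, and its inverses lie in a space spanned by
    finitely many monomials.\<close>
  define D where "D d = {a. \<forall>u. lookup (g a) u \<noteq> 0 \<longrightarrow> mdeg u \<le> d}" for d
  have "\<exists>d. a \<in> D d" for a
  proof
    show "a \<in> D (Max (insert 0 (mdeg ` keys (g a))))"
      by (auto simp: D_def in_keys_iff intro!: Max_ge)
  qed
  then have "(\<Union>d. D d) = UNIV" by auto
  then have "uncountable (\<Union>d. D d)"
    using uncountable_UNIV_complex by simp
  then have "\<exists>d. infinite (D d)"
    by (auto dest: countable_finite)
  then obtain d where d: "infinite (D d)" ..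
  define U where "U = {u :: 'v \<Rightarrow>\<^sub>0 nat. mdeg u \<le> d}"
  have "U = (\<Union>e\<le>d. {u. mdeg u = e})" by (auto simp: U_def)
  then have U: "finite U" by (simp add: finite_mdeg)
  obtain A where A: "A \<subseteq> D d" "finite A" "card A = Suc (card U)"
    using infinite_arbitrarily_large[OF d] by blast
  have "\<not> (\<forall>c. (\<Sum>a\<in>A. const (c a) * g a) \<in> M \<longrightarrow> (\<forall>a\<in>A. c a = 0))"
  proof
    assume "\<forall>c. (\<Sum>a\<in>A. const (c a) * g a) \<in> M \<longrightarrow> (\<forall>a\<in>A. c a = 0)"
    then have "card A \<le> card U"
    proof (intro cv.card_le_of_independent_modulo[where W = M and g = g and
          h = "\<lambda>u. single u 1", OF ideal_subspace_vector_subspace[OF M(1)] U A(2)])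
      fix a assume "a \<in> A"
      then have "g a = (\<Sum>u\<in>U. const (lookup (g a) u) * single u 1)"
        using A(1) U by (intro monomial_expansion) (auto simp: D_def U_def)
      then have "g a - (\<Sum>u\<in>U. const (lookup (g a) u) * single u 1) = 0"
        by (simp only: right_minus_eq)
      then show "\<exists>b. g a - (\<Sum>u\<in>U. const (b u) * single u 1) \<in> M"
        using ideal.subspace_0[OF M(1)] by (intro exI[of _ "lookup (g a)"]) (simp only:)
    qed blast
    then show False using A by simp
  qed
  then obtain c a0 where c: "(\<Sum>a\<in>A. const (c a) * g a) \<in> M" "a0 \<in> A" "c a0 \<noteq> 0" by blast
  \<comment> \<open>Clearing denominators in the relation between the inverses of the
    \<open>x - const a\<close>, as for partial fractions. At \<open>a0\<close> a single summand
    survives, so \<open>q\<close> is nonzero.\<close>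
  define q where "q = (\<Sum>a\<in>A. smult (c a) (\<Prod>b\<in>A-{a}. [:-b, 1:]))"
  have "poly q a0 = (\<Sum>a\<in>A. if a = a0 then c a * (\<Prod>b\<in>A-{a}. a0 - b) else 0)"
    unfolding q_def poly_sum using A(2) c(2)
    by (intro sum.cong refl) (auto simp: poly_prod)
  also have "\<dots> \<noteq> 0" using A(2) c by simp
  finally have "q \<noteq> 0" by auto
  define Pi where "Pi B = (\<Prod>b\<in>B. x - const b)" for B
  have "Pi A * (\<Sum>a\<in>A. const (c a) * g a) + (\<Sum>a\<in>A. const (c a) * Pi (A - {a}) * (1 - g a * (x - const a))) \<in> M"
    by (intro ideal.subspace_add ideal.subspace_sum ideal.subspace_scale M c g)
  also have "Pi A * (\<Sum>a\<in>A. const (c a) * g a) + (\<Sum>a\<in>A. const (c a) * Pi (A - {a}) * (1 - g a * (x - const a)))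
    = (\<Sum>a\<in>A. const (c a) * Pi (A - {a}))"
  proof -
    have "Pi A * (const (c a) * g a) + const (c a) * Pi (A - {a}) * (1 - g a * (x - const a))
      = const (c a) * Pi (A - {a})" if "a \<in> A" for a
    proof -
      have *: "Pi A = (x - const a) * Pi (A - {a})"
        unfolding Pi_def using A(2) that by (rule prod.remove)
      show ?thesis unfolding * by (simp add: algebra_simps)
    qed
    then show ?thesis unfolding sum_distrib_left sum.distrib[symmetric] by (intro sum.cong refl) blast
  qed
  also have "\<dots> = poly_at x q"
    by (simp add: q_def poly_at_sum poly_at_smult poly_at_prod Pi_def const_uminus)
  finally show False using no_poly \<open>q \<noteq> 0\<close> by blast
qed

text \<open>Modulo a maximal ideal containing \<open>I\<close> every variable is congruent to a
  complex number, and these numbers are the coordinates of a common zero.\<close>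

theorem weak_nullstellensatz:
  fixes I :: "'v::finite cpoly set"
  assumes "ideal.subspace I" "1 \<notin> I"
  obtains v where "\<And>f. f \<in> I \<Longrightarrow> eval v f = 0"
proof -
  obtain M where M: "ideal.subspace M" "I \<subseteq> M" "1 \<notin> M"
    "\<And>N. ideal.subspace N \<Longrightarrow> M \<subseteq> N \<Longrightarrow> 1 \<notin> N \<Longrightarrow> N = M"
    using ex_maximal_ideal[OF assms] by metis
  have "\<exists>a. var i - const a \<in> M" for i
    using maximal_ideal_ex_root[OF M(1,3)] M(4) by blast
  then obtain a where a: "\<And>i. var i - const (a i) \<in> M" by metis
  define v where "v = (\<chi> i. a i)"
  have cong: "f - const (eval v f) \<in> M" for f
  proof (induction f rule: cpoly_induct)
    case (const c) then show ?case using M(1) by (simp add: ideal.subspace_0)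
  next
    case (var i) then show ?case using a by (simp add: v_def)
  next
    case (add f g)
    from ideal.subspace_add[OF M(1) this] show ?case by (simp add: const_add algebra_simps)
  next
    case (mult f g)
    have "g * (f - const (eval v f)) + const (eval v f) * (g - const (eval v g)) \<in> M"
      using mult M(1) by (intro ideal.subspace_add ideal.subspace_scale)
    then show ?case by (simp add: const_mult algebra_simps)
  qed
  have "eval v f = 0" if "f \<in> I" for f
  proof (rule ccontr)
    assume nz: "eval v f \<noteq> 0"
    have "const (1 / eval v f) * (f - (f - const (eval v f))) \<in> M"
      using that M(1,2) by (intro ideal.subspace_scale ideal.subspace_diff[OF M(1) _ cong]) auto
    moreover have "const (1 / eval v f) * const (eval v f) = 1"
      using nz by (simp flip: const_mult)
    ultimately show False using M(3) by (metis diff_diff_eq2 add_diff_cancel_left')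
  qed
  then show thesis by (rule that)
qed

text \<open>Dehomogenization at \<open>t = 1\<close>. Comparing degrees in
  \<open>1 - g * (t - 1)\<close> shows that modulo \<open>I\<close> the part of \<open>g\<close> of
  degree \<open>d\<close> is \<open>- (t ^ d)\<close>, and \<open>g\<close> has only finitely many
  nonzero parts.\<close>

lemma homogeneous_power_mem:
  fixes I :: "'v::finite cpoly set"
  assumes I: "homogeneous_ideal I" and t: "homogeneous 1 t"
    and one: "1 \<in> ideal.span (insert (t - 1) I)"
  shows "\<exists>r. t ^ r \<in> I"
proof -
  have sub: "ideal.subspace I" using I by (rule homogeneous_ideal_subspace)
  obtain g where g: "1 - g * (t - 1) \<in> I"
    using one by (auto simp: ideal.span_breakdown_eq ideal_span_eq[OF sub])
  have eq: "1 - g * (t - 1) = 1 + g - t * g" by (simp add: algebra_simps)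
  have h: "hom_part d (1 + g - t * g) \<in> I" for d
    using homogeneous_idealD[OF I g] unfolding eq .
  have "hom_part d g + t ^ d \<in> I" for d
  proof (induction d)
    case 0
    then show ?case
      using h[of 0] by (simp add: hom_part_add hom_part_diff hom_part_homogeneous_mult[OF t]
          hom_part_homogeneous[OF homogeneous_1] add.commute)
  next
    case (Suc d)
    have "hom_part (Suc d) g - t * hom_part d g \<in> I"
      using h[of "Suc d"] by (simp add: hom_part_add hom_part_diff hom_part_homogeneous_mult[OF t]
          hom_part_homogeneous[OF homogeneous_1])
    from ideal.subspace_add[OF sub this ideal.subspace_scale[OF sub Suc, of t]]
    show ?case by (simp add: algebra_simps)
  qed
  moreover obtain N where "\<And>d. N < d \<Longrightarrow> hom_part d g = 0"
    by (rule ex_sum_hom_parts[of g]) blast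
  ultimately show ?thesis by (metis add_0 lessI)
qed

lemma single_mem_ideal:
  assumes "ideal.subspace I" "var i ^ r \<in> I" "r \<le> lookup u i"
  shows "single u c \<in> I"
proof -
  have *: "(\<Prod>i\<in>UNIV. var i ^ lookup u i) =
    (\<Prod>k\<in>UNIV-{i}. var k ^ lookup u k) * var i ^ (lookup u i - r) * var i ^ r"
  proof -
    have "var i ^ lookup u i = var i ^ (lookup u i - r) * var i ^ r"
      using assms(3) by (simp flip: power_add)
    then show ?thesis by (subst prod.remove[of _ i]) (simp_all add: mult_ac)
  qed
  show ?thesis
    unfolding single_eq * by (intro ideal.subspace_scale assms)
qed

text \<open>Pigeonhole: a monomial of large degree has a large exponent at some variable, hence is
  divisible by one of the powers in \<open>I\<close>.\<close>

lemma homogeneous_mem_of_powers: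
  fixes I :: "'v::finite cpoly set"
  assumes sub: "ideal.subspace I" and "\<And>i. \<exists>r. var i ^ r \<in> I"
  shows "\<exists>D. \<forall>d\<ge>D. \<forall>f. homogeneous d f \<longrightarrow> f \<in> I"
proof -
  obtain r where r: "\<And>i. var i ^ r i \<in> I" using assms(2) by metis
  define R where "R = (\<Sum>i\<in>UNIV. r i)"
  have "f \<in> I" if "CARD('v) * R \<le> d" "homogeneous d f" for d f
  proof -
    have "single u c \<in> I" if u: "CARD('v) * R \<le> mdeg u" for u c
    proof -
      have "\<exists>i. R \<le> lookup u i"
      proof (rule ccontr)
        assume "\<nexists>i. R \<le> lookup u i"
        then have "mdeg u < (\<Sum>i\<in>(UNIV :: 'v set). R)"
          unfolding mdeg_def by (intro sum_strict_mono) (auto simp: not_le)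
        then show False using u by simp
      qed
      then obtain i where "R \<le> lookup u i" ..
      moreover have "r i \<le> R" unfolding R_def by (rule member_le_sum) auto
      ultimately show ?thesis using single_mem_ideal[OF sub r] order_trans by blast
    qed
    then show ?thesis using that
      by (subst poly_mapping_sum_singles) (auto intro!: ideal.subspace_sum[OF sub] simp: homogeneous_def)
  qed
  then show ?thesis by blast
qed

lemma ex_var_factor:
  fixes w :: "'v::finite \<Rightarrow>\<^sub>0 nat"
  assumes "mdeg w = Suc d"
  obtains i u where "mdeg u = d" "w = single i 1 + u"
proof -
  have "mdeg w \<noteq> 0" using assms by simp
  then obtain i where i: "lookup w i \<noteq> 0" by (auto simp: mdeg_def)
  have w: "w = single i 1 + (w - single i 1)"
    by (rule poly_mapping_eqI) (use i in \<open>auto simp: lookup_add lookup_minus lookup_single when_def\<close>)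
  moreover from this have "mdeg (w - single i 1) = d"
    using assms mdeg_add[of "single i 1" "w - single i 1"] by simp
  ultimately show thesis using that by blast
qed

lemma subspace_saturation:
  assumes I: "ideal.subspace I"
  shows "ideal.subspace (saturation (I :: 'v::finite cpoly set))"
proof (rule ideal.subspaceI)
  \<comment> \<open>\<open>saturation\<close> asks for one degree \<open>k\<close>, and two elements
    may come with different degrees. Every monomial of degree \<open>Suc s\<close> is a variable
    times one of degree \<open>s\<close>, which allows both degrees to be raised to their
    maximum.\<close>
  have step: "g * f \<in> I" if f: "\<And>g. homogeneous s g \<Longrightarrow> g * f \<in> I" and g: "homogeneous (Suc s) g" for s f g
  proof -
    have "single w c * f \<in> I" if w: "mdeg w = Suc s" for w c
    proof -
      obtain i u where u: "mdeg u = s" "w = single i 1 + u" using w by (rule ex_var_factor)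
      have "var i * (single u c * f) \<in> I"
        using homogeneous_single[of u c] u(1) by (intro ideal.subspace_scale I f) simp
      then show ?thesis by (simp add: u(2) var_def mult_single flip: mult.assoc)
    qed
    then show ?thesis
      using g by (subst poly_mapping_sum_singles)
        (auto simp: sum_distrib_right homogeneous_def intro!: ideal.subspace_sum[OF I])
  qed
  have later: "\<forall>g. homogeneous t g \<longrightarrow> g * f \<in> I" if "s \<le> t" "\<forall>g. homogeneous s g \<longrightarrow> g * f \<in> I" for s t f
    using that by (induction t rule: dec_induct) (use step in blast)+
  show "0 \<in> saturation I" by (simp add: saturation_def ideal.subspace_0[OF I])
  show "f + f' \<in> saturation I" if "f \<in> saturation I" "f' \<in> saturation I" for f f'
  proof -
    obtain s s' where s: "\<forall>g. homogeneous s g \<longrightarrow> g * f \<in> I" "\<forall>g. homogeneous s' g \<longrightarrow> g * f' \<in> I"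
      using \<open>f \<in> _\<close> \<open>f' \<in> _\<close> unfolding saturation_def by blast
    have "g * (f + f') \<in> I" if "homogeneous (max s s') g" for g
      unfolding distrib_left
      using later[OF max.cobounded1 s(1), of s'] later[OF max.cobounded2 s(2), of s] that
      by (intro ideal.subspace_add I) simp_all
    then show ?thesis unfolding saturation_def by blast
  qed
  show "c * f \<in> saturation I" if f: "f \<in> saturation I" for c f
  proof -
    obtain s where s: "\<forall>g. homogeneous s g \<longrightarrow> g * f \<in> I" using f unfolding saturation_def by blast
    have "g * (c * f) \<in> I" if "homogeneous s g" for g
      using ideal.subspace_scale[OF I, of "g * f" c] s that by (simp add: mult.left_commute)
    then show ?thesis unfolding saturation_def by blast
  qed
qed

text \<open>If the origin is the only zero, there is none where the variable \<open>i\<close> has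
  the value 1; so a power of each variable lies in \<open>I\<close>.\<close>

lemma homogeneous_nullstellensatz:
  fixes I :: "'v::finite cpoly set"
  assumes I: "homogeneous_ideal I"
    and zero: "\<And>v. (\<And>f. f \<in> I \<Longrightarrow> eval v f = 0) \<Longrightarrow> v = 0"
  shows "\<exists>D. \<forall>d\<ge>D. \<forall>f. homogeneous d f \<longrightarrow> f \<in> I"
proof (rule homogeneous_mem_of_powers)
  show "ideal.subspace I" using I by (rule homogeneous_ideal_subspace)
  fix i
  have "1 \<in> ideal.span (insert (var i - 1) I)"
  proof (rule ccontr)
    assume "1 \<notin> ideal.span (insert (var i - 1) I)"
    then obtain v where v: "\<And>f. f \<in> ideal.span (insert (var i - 1) I) \<Longrightarrow> eval v f = 0"
      using weak_nullstellensatz[OF ideal.subspace_span] by metis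
    then have "v = 0" by (intro zero) (simp add: ideal.span_base)
    moreover have "eval v (var i - 1) = 0" by (rule v) (simp add: ideal.span_base)
    ultimately show False by simp
  qed
  then show "\<exists>r. var i ^ r \<in> I"
    by (rule homogeneous_power_mem[OF I homogeneous_var])
qed


subsection \<open>Regular sequences of forms\<close>

definition nzd :: "'a::comm_ring_1 set \<Rightarrow> 'a \<Rightarrow> bool"
  where "nzd I x \<longleftrightarrow> (\<forall>u. x * u \<in> I \<longrightarrow> u \<in> I)"

text \<open>\<open>A\<close> collects the generators already divided out. Properness of the ideal is
  not demanded; for generators of positive degree it follows by looking at degree 0, as in
  \<open>lead_nonzero\<close>.\<close>

fun regular :: "'a::comm_ring_1 set \<Rightarrow> 'a list \<Rightarrow> bool"
  where "regular A [] \<longleftrightarrow> True"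
  | "regular A (x # xs) \<longleftrightarrow> nzd (ideal.span A) x \<and> regular (insert x A) xs"

definition positive_form :: "'v::finite cpoly \<Rightarrow> bool"
  where "positive_form f \<longleftrightarrow> (\<exists>d>0. homogeneous d f)"

lemma positive_form_homogeneous: "positive_form f \<Longrightarrow> \<exists>d. homogeneous d f"
  by (auto simp: positive_form_def)

lemma nzdD: "nzd I x \<Longrightarrow> x * u \<in> I \<Longrightarrow> u \<in> I"
  by (simp add: nzd_def)

lemma regular_append: "regular A (xs @ ys) \<longleftrightarrow> regular A xs \<and> regular (A \<union> set xs) ys"
  by (induction xs arbitrary: A) auto

text \<open>Permuting a regular sequence relies on the grading. If \<open>y * u\<close> lies in
  \<open>?I\<close>, then \<open>u\<close> is a multiple of \<open>x\<close> modulo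
  \<open>?I\<close> with a cofactor that \<open>y\<close> again multiplies into \<open>?I\<close>.
  Repeating this makes \<open>u\<close> divisible by every power of \<open>x\<close>, and since
  \<open>x\<close> has positive degree, each homogeneous part of \<open>u\<close> lies in
  \<open>?I\<close>.\<close>

lemma nzd_swap:
  assumes A: "\<And>g. g \<in> A \<Longrightarrow> \<exists>d. homogeneous d g"
    and x: "positive_form x" and nx: "nzd (ideal.span A) x" and ny: "nzd (ideal.span (insert x A)) y"
  shows "nzd (ideal.span A) y" "nzd (ideal.span (insert y A)) x"
proof -
  let ?I = "ideal.span A"
  have hI: "homogeneous_ideal ?I" by (rule homogeneous_ideal_span[OF A])
  have mono: "?I \<subseteq> ideal.span (insert x A)" by (rule ideal.span_mono) blast
  obtain e where e: "e > 0" "homogeneous e x" using x by (auto simp: positive_form_def)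
  show "nzd ?I y"
    unfolding nzd_def
  proof (intro allI impI)
    fix u assume u: "y * u \<in> ?I"
    have approx: "\<exists>w. u - x ^ k * w \<in> ?I \<and> y * w \<in> ?I" for k
    proof (induction k)
      case 0
      show ?case by (rule exI[of _ u]) (simp add: u ideal.span_zero)
    next
      case (Suc k)
      then obtain w where w: "u - x ^ k * w \<in> ?I" "y * w \<in> ?I" by blast
      then have "w \<in> ideal.span (insert x A)" using ny mono by (auto dest: nzdD)
      then obtain w' where w': "w - w' * x \<in> ?I" unfolding ideal.span_breakdown_eq by blast
      have "y * w - y * (w - w' * x) \<in> ?I"
        by (intro ideal.span_diff w ideal.span_scale w')
      then have "x * (y * w') \<in> ?I" by (simp add: algebra_simps)
      then have "y * w' \<in> ?I" using nx by (rule nzdD[rotated])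
      moreover have "(u - x ^ k * w) + x ^ k * (w - w' * x) \<in> ?I"
        by (intro ideal.span_add w ideal.span_scale w')
      then have "u - x ^ Suc k * w' \<in> ?I" by (simp add: algebra_simps)
      ultimately show ?case by blast
    qed
    have h: "hom_part d u \<in> ?I" for d
    proof -
      obtain w where w: "u - x ^ Suc d * w \<in> ?I" using approx by blast
      have "d < Suc d * e" using e(1) by (cases e) auto
      then have "hom_part d (x ^ Suc d * w) = 0"
        using hom_part_homogeneous_mult[OF homogeneous_power[OF e(2), of "Suc d"], of d w]
        by (simp del: power_Suc mult_Suc)
      then show ?thesis
        using homogeneous_idealD[OF hI w, of d] by (simp add: hom_part_diff)
    qed
    show "u \<in> ?I" by (rule homogeneous_idealI[OF ideal.subspace_span h])
  qed
  show "nzd (ideal.span (insert y A)) x"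
    unfolding nzd_def
  proof (intro allI impI)
    fix u assume "x * u \<in> ideal.span (insert y A)"
    then obtain k where k: "x * u - k * y \<in> ?I" unfolding ideal.span_breakdown_eq by blast
    have "u * x \<in> ideal.span (insert x A)" by (intro ideal.span_scale ideal.span_base) simp
    then have "u * x - (x * u - k * y) \<in> ideal.span (insert x A)"
      using k mono by (meson ideal.span_diff subsetD)
    then have "y * k \<in> ideal.span (insert x A)" by (simp add: algebra_simps)
    then have "k \<in> ideal.span (insert x A)" using ny by (rule nzdD[rotated])
    then obtain k' where k': "k - k' * x \<in> ?I" unfolding ideal.span_breakdown_eq by blast
    have "x * u - k * y + y * (k - k' * x) \<in> ?I"
      by (intro ideal.span_add k ideal.span_scale k')
    then have "x * (u - k' * y) \<in> ?I" by (simp add: algebra_simps)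
    then have "u - k' * y \<in> ?I" using nx by (rule nzdD[rotated])
    then show "u \<in> ideal.span (insert y A)" unfolding ideal.span_breakdown_eq by blast
  qed
qed

text \<open>Brings the coordinate that is to be exchanged to the end of the sequence, where it can
  be replaced without disturbing the others.\<close>

lemma regular_rotate:
  assumes "\<And>g. g \<in> A \<Longrightarrow> \<exists>d. homogeneous d g" "positive_form x" "\<And>y. y \<in> set ys \<Longrightarrow> positive_form y"
    and "regular A (x # ys)"
  shows "regular A (ys @ [x])"
  using assms
proof (induction ys arbitrary: A)
  case (Cons y ys)
  have n: "nzd (ideal.span A) x" "nzd (ideal.span (insert x A)) y" using Cons.prems(4) by auto
  have "regular (insert y A) (x # ys)"
    using nzd_swap[OF Cons.prems(1,2) n] Cons.prems(4) by (simp add: insert_commute)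
  then have "regular (insert y A) (ys @ [x])"
    using Cons.prems(1,2,3) by (intro Cons.IH) (auto dest: positive_form_homogeneous)
  then show ?case using nzd_swap[OF Cons.prems(1,2) n] by simp
qed simp

section \<open>Powers of the coordinates as a regular sequence\<close>

lemma lookup_single_mult:
  "lookup (single w 1 * f) (w + u) = lookup (f :: 'v::finite cpoly) u"
proof -
  have "single w 1 * f =
    (\<Sum>v\<in>keys f. single (w + v) (lookup f v))"
    by (subst (1) poly_mapping_sum_singles[of f]) (simp add: sum_distrib_left mult_single)
  then show ?thesis
    by (simp add: lookup_sum lookup_single in_keys_iff when_def)
qed

lemma var_power: "var i ^ k = single (single i k) 1"
  by (induction k) (simp_all add: var_def mult_single single_add[symmetric])

text \<open>The ideal generated by \<open>var j\<close> and the \<open>var i ^ e\<close> for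
  \<open>i\<close> in \<open>S\<close>, described through its monomials. Regularity of a further
  power and a basis of the quotient can be read off from this form.\<close>

definition monomial_ideal :: "'v \<Rightarrow> nat \<Rightarrow> 'v set \<Rightarrow> 'v::finite cpoly set"
  where "monomial_ideal j e S = {f. \<forall>u. lookup f u \<noteq> 0 \<longrightarrow>
    lookup u j \<ge> 1 \<or> (\<exists>i\<in>S. lookup u i \<ge> e)}"

lemma span_monomial_ideal:
  "ideal.span (insert (var j) ((\<lambda>i. var i ^ e) ` S)) = monomial_ideal j e S"
proof
  have "ideal.subspace (monomial_ideal j e S)"
  proof (rule ideal.subspaceI)
    show "0 \<in> monomial_ideal j e S" by (simp add: monomial_ideal_def)
    show "x + y \<in> monomial_ideal j e S" if "x \<in> monomial_ideal j e S" "y \<in> monomial_ideal j e S" for x y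
      using that unfolding monomial_ideal_def lookup_add mem_Collect_eq by (metis add.right_neutral)
    show "c * x \<in> monomial_ideal j e S" if x: "x \<in> monomial_ideal j e S" for c x
      unfolding monomial_ideal_def mem_Collect_eq
    proof (intro allI impI)
      fix u assume "lookup (c * x) u \<noteq> 0"
      then obtain a b where ab: "u = a + b" "lookup x b \<noteq> 0"
        using keys_mult[of c x] by (auto simp: in_keys_iff)
      then have "lookup b j \<ge> 1 \<or> (\<exists>i\<in>S. lookup b i \<ge> e)"
        using x by (auto simp: monomial_ideal_def)
      then show "lookup u j \<ge> 1 \<or> (\<exists>i\<in>S. lookup u i \<ge> e)"
        unfolding ab(1) lookup_add by (meson trans_le_add2)
    qed
  qed
  moreover have "insert (var j) ((\<lambda>i. var i ^ e) ` S) \<subseteq> monomial_ideal j e S"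
    by (auto simp: monomial_ideal_def var_power lookup_single when_def split: if_splits)
      (auto simp: var_def lookup_single when_def split: if_splits)
  ultimately show "ideal.span (insert (var j) ((\<lambda>i. var i ^ e) ` S)) \<subseteq> monomial_ideal j e S"
    by (intro ideal.span_minimal)
  show "monomial_ideal j e S \<subseteq> ideal.span (insert (var j) ((\<lambda>i. var i ^ e) ` S))" (is "_ \<subseteq> ?J")
  proof
    fix f assume f: "f \<in> monomial_ideal j e S"
    have "single u c \<in> ?J"
      if "lookup u j \<ge> 1 \<or> (\<exists>i\<in>S. lookup u i \<ge> e)" for u c
      using that
    proof
      assume u: "lookup u j \<ge> 1"
      have "var j ^ 1 \<in> ?J" by (simp add: ideal.span_base)
      then show ?thesis using u by (rule single_mem_ideal[rotated]) simp
    next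
      assume "\<exists>i\<in>S. lookup u i \<ge> e"
      then obtain i where i: "i \<in> S" "lookup u i \<ge> e" by blast
      have "var i ^ e \<in> ?J" using i(1) by (simp add: ideal.span_base)
      then show ?thesis using i(2) by (rule single_mem_ideal[rotated]) simp
    qed
    then show "f \<in> ?J"
      using f by (subst poly_mapping_sum_singles)
        (auto intro!: ideal.span_sum simp: monomial_ideal_def in_keys_iff)
  qed
qed

lemma nzd_monomial_ideal:
  assumes "k \<notin> S" "k \<noteq> j"
  shows "nzd (monomial_ideal j e S) (var k ^ e)"
  unfolding nzd_def monomial_ideal_def mem_Collect_eq
proof (intro allI impI)
  fix f :: "'a cpoly" and u
  assume f: "\<forall>u. lookup (var k ^ e * f) u \<noteq> 0 \<longrightarrow>
    1 \<le> lookup u j \<or> (\<exists>i\<in>S. e \<le> lookup u i)"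
    and "lookup f u \<noteq> 0"
  then have "lookup (var k ^ e * f) (single k e + u) \<noteq> 0"
    by (simp only: var_power lookup_single_mult) simp
  then have "1 \<le> lookup (single k e + u) j \<or>
    (\<exists>i\<in>S. e \<le> lookup (single k e + u) i)"
    using f by blast
  then show "1 \<le> lookup u j \<or> (\<exists>i\<in>S. e \<le> lookup u i)"
    using assms by (auto simp: lookup_add lookup_single when_def split: if_splits)
qed

text \<open>Exponent 1 starts the exchange of coordinates for leading forms; exponent
  \<open>m\<close> gives the sequence whose Hilbert function is counted explicitly.\<close>

lemma regular_var_powers:
  assumes "distinct vs" "j \<notin> set vs"
  shows "regular {var j} (map (\<lambda>i. var i ^ e) vs)"
proof -
  have "regular (insert (var j) ((\<lambda>i. var i ^ e) ` S)) (map (\<lambda>i. var i ^ e) vs)"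
    if "S \<inter> set vs = {}" for S
    using assms that
  proof (induction vs arbitrary: S)
    case (Cons k vs)
    have "regular (insert (var j) ((\<lambda>i. var i ^ e) ` insert k S)) (map (\<lambda>i. var i ^ e) vs)"
      by (rule Cons.IH) (use Cons.prems in auto)
    then show ?case
      using Cons.prems by (auto simp: span_monomial_ideal insert_commute intro!: nzd_monomial_ideal)
  qed simp
  from this[of "{}"] show ?thesis by simp
qed

section \<open>Exchanging coordinates for forms of a given space\<close>

lemma avoid_zeros:
  assumes V: "cv.subspace V" and "finite Z" and "\<And>z. z \<in> Z \<Longrightarrow> \<exists>F\<in>V. eval z F \<noteq> 0"
  shows "\<exists>F\<in>V. \<forall>z\<in>Z. eval z F \<noteq> 0"
  using assms(2,3)
proof (induction Z rule: finite_induct)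
  case empty
  then show ?case using cv.subspace_0[OF V] by blast
next
  case (insert z Z)
  obtain F where F: "F \<in> V" "\<forall>z\<in>Z. eval z F \<noteq> 0" using insert by blast
  obtain G where G: "G \<in> V" "eval z G \<noteq> 0" using insert by blast
  \<comment> \<open>If \<open>F + const c * G\<close> vanishes at \<open>y\<close> and
    \<open>G\<close> does not, then \<open>c\<close> is one of these ratios. Where \<open>G\<close>
    vanishes the ratio is 0 by convention; there \<open>y\<close> is not \<open>z\<close>, and
    \<open>F\<close> alone is nonzero.\<close>
  have "finite ((\<lambda>y. - eval y F / eval y G) ` insert z Z)" using insert by simp
  then obtain c where c: "c \<notin> (\<lambda>y. - eval y F / eval y G) ` insert z Z"
    using ex_new_if_finite[OF infinite_UNIV_char_0] by blast
  have "eval y (F + const c * G) \<noteq> 0" if "y \<in> insert z Z" for y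
  proof
    assume "eval y (F + const c * G) = 0"
    then have *: "c * eval y G = - eval y F" by (simp add: eq_neg_iff_add_eq_0 add.commute)
    have "eval y G = 0"
    proof (rule ccontr)
      assume "eval y G \<noteq> 0"
      then have "c = - eval y F / eval y G" using * by (metis nonzero_eq_divide_eq)
      then show False using c that by blast
    qed
    then show False using * that F G by auto
  qed
  moreover have "F + const c * G \<in> V"
    using F G by (intro cv.subspace_add cv.subspace_scale V)
  ultimately show ?case by blast
qed

lemma eval_zero_span:
  assumes "\<And>f. f \<in> A \<Longrightarrow> eval z f = 0" "f \<in> ideal.span A"
  shows "eval z f = 0"
  using assms(2)
  by (induction rule: ideal.span_induct_alt) (simp_all add: assms(1))

text \<open>Taking the part of degree \<open>d\<close> of any relation makes the cofactor of
  \<open>t\<close> homogeneous.\<close>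

lemma homogeneous_span_insert:
  assumes A: "\<And>g. g \<in> A \<Longrightarrow> \<exists>d. homogeneous d g" and t: "homogeneous e t"
    and f: "homogeneous d f" "f \<in> ideal.span (insert t A)"
  shows "if e \<le> d then \<exists>g. homogeneous (d - e) g \<and> f - t * g \<in> ideal.span A else f \<in> ideal.span A"
proof -
  obtain g where "f - g * t \<in> ideal.span A" using f(2) unfolding ideal.span_breakdown_eq by blast
  then have "hom_part d (f - t * g) \<in> ideal.span A"
    by (intro homogeneous_idealD homogeneous_ideal_span A) (simp_all add: mult.commute)
  then show ?thesis
    using f(1) by (auto simp: hom_part_diff hom_part_homogeneous_mult[OF t] hom_part_homogeneous
        intro!: exI[of _ "hom_part (d - e) g"])
qed

text \<open>A form of degree above \<open>D\<close> is a multiple of \<open>var k\<close> up to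
  elements vanishing on \<open>?Z\<close>, where \<open>var k\<close> has the value 1, so its degree
  can be lowered. Hence the polynomial functions on \<open>?Z\<close> form a finite-dimensional
  space, and each coordinate takes finitely many values.\<close>

lemma finite_affine_zeros:
  fixes A :: "'v::finite cpoly set"
  assumes A: "\<And>g. g \<in> A \<Longrightarrow> \<exists>d. homogeneous d g"
    and top: "\<And>d f. D \<le> d \<Longrightarrow> homogeneous d f \<Longrightarrow> f \<in> ideal.span (insert (var k) A)"
  shows "finite {z. z $ k = 1 \<and> (\<forall>f\<in>A. eval z f = 0)}" (is "finite ?Z")
proof -
  define W where "W = {f :: 'v cpoly. \<forall>z\<in>?Z. eval z f = 0}"
  have W: "cv.subspace W" by (simp add: cv.subspace_def W_def)
  define B where "B = (\<lambda>u :: 'v \<Rightarrow>\<^sub>0 nat. single u (1::complex)) ` (\<Union>d\<le>D. {u. mdeg u = d})"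
  have B: "finite B" by (simp add: B_def finite_mdeg)
  have hom: "f \<in> cv.span (B \<union> W)" if "homogeneous d f" for d f
    using that
  proof (induction d arbitrary: f)
    case 0
    have "f = (\<Sum>u\<in>{u. mdeg u = 0}. const (lookup f u) * single u 1)"
      using 0 by (intro monomial_expansion finite_mdeg) (auto simp: homogeneous_lookup)
    also have "\<dots> \<in> cv.span (B \<union> W)"
      by (intro cv.span_sum cv.span_scale cv.span_base) (auto simp: B_def)
    finally show ?case .
  next
    case (Suc d)
    show ?case
    proof (cases "Suc d \<le> D")
      case True
      have "f = (\<Sum>u\<in>{u. mdeg u = Suc d}. const (lookup f u) * single u 1)"
        using Suc.prems by (intro monomial_expansion finite_mdeg) (auto simp: homogeneous_lookup)
      also have "\<dots> \<in> cv.span (B \<union> W)"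
        using True by (intro cv.span_sum cv.span_scale cv.span_base) (auto simp: B_def)
      finally show ?thesis .
    next
      case False
      then have "f \<in> ideal.span (insert (var k) A)" using Suc.prems top[of "Suc d"] by simp
      from homogeneous_span_insert[OF A homogeneous_var Suc.prems this]
      obtain g where g: "homogeneous d g" "f - var k * g \<in> ideal.span A" by auto
      have "f - g \<in> W"
        unfolding W_def
      proof (intro CollectI ballI)
        fix z assume "z \<in> ?Z"
        then show "eval z (f - g) = 0"
          using eval_zero_span[OF _ g(2), of z] by simp
      qed
      then have "g + (f - g) \<in> cv.span (B \<union> W)"
        by (intro cv.span_add[OF Suc.IH[OF g(1)] cv.span_base]) simp
      then show ?thesis by simp
    qed
  qed
  have span: "\<exists>a. f - (\<Sum>b\<in>B. const (a b) * b) \<in> W" for f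
  proof -
    obtain N where N: "\<And>M. N \<le> M \<Longrightarrow> f = (\<Sum>d\<le>M. hom_part d f)"
      by (rule ex_sum_hom_parts[of f]) blast
    have "f \<in> cv.span (B \<union> W)"
      by (subst N[OF order_refl]) (intro cv.span_sum hom[OF homogeneous_hom_part])
    then obtain x y where "f = x + y" "x \<in> cv.span B" "y \<in> W"
      unfolding cv.span_Un cv.span_eq_iff[THEN iffD2, OF W] by blast
    moreover from this(2) obtain a where "x = (\<Sum>b\<in>B. const (a b) * b)"
      unfolding cv.span_finite[OF B] by blast
    ultimately show ?thesis by (intro exI[of _ a]) simp
  qed
  have fin: "finite ((\<lambda>z. z $ i) ` ?Z)" for i
  proof -
    \<comment> \<open>\<open>card B + 1\<close> powers of one coordinate are dependent as functions
      on \<open>?Z\<close>; the relation is a nonzero polynomial with all values of this coordinate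
      among its roots.\<close>
    have "\<not> (\<forall>c. (\<Sum>e\<le>card B. const (c e) * var i ^ e) \<in> W \<longrightarrow> (\<forall>e\<le>card B. c e = 0))"
    proof
      assume "\<forall>c. (\<Sum>e\<le>card B. const (c e) * var i ^ e) \<in> W \<longrightarrow> (\<forall>e\<le>card B. c e = 0)"
      then have "card {..card B} \<le> card B"
        by (intro cv.card_le_of_independent_modulo[OF W B, where g = "\<lambda>e. var i ^ e" and h = "\<lambda>b. b"] span) auto
      then show False by simp
    qed
    then obtain c e where c: "(\<Sum>e\<le>card B. const (c e) * var i ^ e) \<in> W" "e \<le> card B" "c e \<noteq> 0" by blast
    define p where "p = (\<Sum>e\<le>card B. monom (c e) e)"
    have "coeff p e = c e" using c(2) by (simp add: p_def coeff_sum)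
    then have "p \<noteq> 0" using c(3) by auto
    moreover have "(\<lambda>z. z $ i) ` ?Z \<subseteq> {x. poly p x = 0}"
      using c(1) by (auto simp: W_def p_def poly_sum poly_monom eval_sum)
    ultimately show ?thesis using poly_roots_finite finite_subset by blast
  qed
  have "vec_nth ` ?Z \<subseteq> PiE UNIV (\<lambda>i. (\<lambda>z. z $ i) ` ?Z)" by auto
  then have "finite (vec_nth ` ?Z)"
    by (rule finite_subset) (intro finite_PiE fin finite)
  then show ?thesis by (rule finite_imageD) (simp add: inj_on_def vec_nth_inject)
qed

text \<open>For a homogeneous ideal this means that the quotient is a finite-dimensional vector
  space.\<close>

definition contains_large_degrees :: "'v::finite cpoly set \<Rightarrow> bool"
  where "contains_large_degrees I \<longleftrightarrow> (\<exists>D. \<forall>d\<ge>D. \<forall>f. homogeneous d f \<longrightarrow> f \<in> I)"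

text \<open>
  The choice of \<open>F\<close> is only constrained at the finitely many common zeros of \<open>A\<close> off the hyperplane \<open>x\<^sub>k = 0\<close>.
  By the Nullstellensatz a power of \<open>x\<^sub>k\<close> then lies in \<open>(A, F)\<close>, which makes \<open>F\<close> a nonzerodivisor because
  \<open>x\<^sub>k\<close> is one.
\<close>

lemma exchange:
  fixes A V :: "'v::finite cpoly set"
  assumes A: "\<And>g. g \<in> A \<Longrightarrow> \<exists>d. homogeneous d g"
    and V: "cv.subspace V" "\<And>F. F \<in> V \<Longrightarrow> homogeneous m F"
    and bpf: "\<And>v. v \<noteq> 0 \<Longrightarrow> (\<And>f. f \<in> A \<Longrightarrow> eval v f = 0) \<Longrightarrow> \<exists>F\<in>V. eval v F \<noteq> 0"
    and nzd: "nzd (ideal.span A) (var k)"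
    and top: "contains_large_degrees (ideal.span (insert (var k) A))"
  shows "\<exists>F\<in>V. nzd (ideal.span A) F \<and> contains_large_degrees (ideal.span (insert F A))"
proof -
  let ?Z = "{z. z $ k = 1 \<and> (\<forall>f\<in>A. eval z f = 0)}"
  obtain D where D: "\<And>d f. D \<le> d \<Longrightarrow> homogeneous d f \<Longrightarrow> f \<in> ideal.span (insert (var k) A)"
    using top by (auto simp: contains_large_degrees_def)
  have fin: "finite ?Z" by (rule finite_affine_zeros[where D = D]) (use A D in blast)+
  have "\<exists>F\<in>V. eval z F \<noteq> 0" if "z \<in> ?Z" for z
  proof (rule bpf)
    show "z \<noteq> 0" using that by auto
  qed (use that in auto)
  then obtain F where F: "F \<in> V" "\<And>z. z \<in> ?Z \<Longrightarrow> eval z F \<noteq> 0"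
    using avoid_zeros[OF V(1) fin] by blast
  let ?I = "ideal.span (insert F A)"
  have hI: "homogeneous_ideal ?I"
    using A V(2) F(1) by (intro homogeneous_ideal_span) blast
  have "1 \<in> ideal.span (insert (var k - 1) ?I)"
  proof (rule ccontr)
    assume "1 \<notin> ideal.span (insert (var k - 1) ?I)"
    then obtain z where z: "\<And>f. f \<in> ideal.span (insert (var k - 1) ?I) \<Longrightarrow> eval z f = 0"
      using weak_nullstellensatz[OF ideal.subspace_span] by metis
    have "eval z f = 0" if "f \<in> insert F A" for f
      by (rule z, rule ideal.span_base, rule insertI2, rule ideal.span_base, rule that)
    moreover have "eval z (var k - 1) = 0" by (rule z) (simp add: ideal.span_base)
    ultimately show False using F(2)[of z] by auto
  qed
  then obtain r where "var k ^ r \<in> ?I"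
    using homogeneous_power_mem[OF hI homogeneous_var] by blast
  then obtain g where g: "var k ^ r - g * F \<in> ideal.span A" unfolding ideal.span_breakdown_eq by blast
  have pow: "u \<in> ideal.span A" if "var k ^ s * u \<in> ideal.span A" for s u
    using that
  proof (induction s)
    case (Suc s)
    then show ?case using nzdD[OF nzd, of "var k ^ s * u"] by (simp add: mult_ac)
  qed simp
  have "nzd (ideal.span A) F"
    unfolding nzd_def
  proof (intro allI impI)
    fix u assume "F * u \<in> ideal.span A"
    then have "u * (var k ^ r - g * F) + g * (F * u) \<in> ideal.span A"
      by (intro ideal.span_add ideal.span_scale[OF g] ideal.span_scale[of "F * u"])
    moreover have "u * (var k ^ r - g * F) + g * (F * u) = var k ^ r * u"
      by (simp add: algebra_simps)
    ultimately show "u \<in> ideal.span A" using pow by metis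
  qed
  moreover have "contains_large_degrees ?I"
    unfolding contains_large_degrees_def
  proof (rule homogeneous_nullstellensatz[OF hI])
    fix v assume v: "\<And>f. f \<in> ?I \<Longrightarrow> eval v f = 0"
    have vA: "eval v f = 0" if "f \<in> insert F A" for f using that by (intro v ideal.span_base)
    show "v = 0"
    \<comment> \<open>On the hyperplane, \<open>v\<close> is a zero of \<open>A\<close> and of
      \<open>var k\<close>, and their ideal contains a power of every variable. Off it, rescaling
      moves \<open>v\<close> into \<open>?Z\<close>, where \<open>F\<close> has no zero.\<close>
    proof (cases "v $ k = 0")
      case True
      have "v $ i = 0" for i
      proof -
        have "eval v (var i ^ D) = 0"
          by (rule eval_zero_span[OF _ D[OF order_refl]])
            (use True vA homogeneous_power[OF homogeneous_var, of D i] in auto)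
        then show ?thesis by simp
      qed
      then show ?thesis by (simp add: vec_eq_iff)
    next
      case False
      let ?z = "(1 / v $ k) *s v"
      have z: "eval ?z f = 0" if f: "f \<in> insert F A" for f
      proof -
        obtain d where "homogeneous d f" using f A V(2) F(1) by blast
        then show ?thesis using vA[OF f] by (simp add: eval_scale)
      qed
      then have "?z \<in> ?Z" using False by auto
      then show ?thesis using F(2) z by blast
    qed
  qed
  ultimately show ?thesis using F(1) by blast
qed

text \<open>The list \<open>vs\<close> holds the coordinates still to be exchanged and
  \<open>Fs\<close> the forms already chosen. Each round rotates the first coordinate to the end and
  applies \<open>exchange\<close> there.\<close>

lemma ex_regular_in_subspace:
  fixes A V :: "'v::finite cpoly set"
  assumes A: "\<And>g. g \<in> A \<Longrightarrow> \<exists>d. homogeneous d g"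
    and V: "cv.subspace V" "\<And>F. F \<in> V \<Longrightarrow> homogeneous m F" "m > 0"
    and bpf: "\<And>v. v \<noteq> 0 \<Longrightarrow> (\<And>f. f \<in> A \<Longrightarrow> eval v f = 0) \<Longrightarrow> \<exists>F\<in>V. eval v F \<noteq> 0"
    and "set Fs \<subseteq> V" "regular A (map var vs @ Fs)"
    and "contains_large_degrees (ideal.span (A \<union> var ` set vs \<union> set Fs))"
  shows "\<exists>Gs. length Gs = length vs + length Fs \<and> set Gs \<subseteq> V \<and> regular A Gs \<and>
    contains_large_degrees (ideal.span (A \<union> set Gs))"
  using assms(6,7,8)
proof (induction vs arbitrary: Fs)
  case Nil
  then show ?case by (intro exI[of _ Fs]) simp
next
  case (Cons k vs)
  let ?ys = "map var vs @ Fs"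
  have pos: "positive_form y" if "y \<in> insert (var k) (set ?ys)" for y
    using that V(2,3) Cons.prems(1) homogeneous_var unfolding positive_form_def by fastforce
  have "regular A (?ys @ [var k])"
    using Cons.prems(2) by (intro regular_rotate A pos) auto
  then have r: "regular A ?ys" "nzd (ideal.span (A \<union> set ?ys)) (var k)"
    unfolding regular_append by auto
  have "\<exists>F\<in>V. nzd (ideal.span (A \<union> set ?ys)) F \<and>
    contains_large_degrees (ideal.span (insert F (A \<union> set ?ys)))"
  proof (rule exchange[OF _ V(1,2) _ r(2)])
    show "\<exists>d. homogeneous d g" if "g \<in> A \<union> set ?ys" for g
      using that A pos positive_form_homogeneous by blast
    show "\<exists>F\<in>V. eval v F \<noteq> 0" if "v \<noteq> 0" "\<And>f. f \<in> A \<union> set ?ys \<Longrightarrow> eval v f = 0" for v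
      using bpf that by blast
    show "contains_large_degrees (ideal.span (insert (var k) (A \<union> set ?ys)))"
      using Cons.prems(3) by (simp add: Un_assoc)
  qed
  then obtain F where F: "F \<in> V" "nzd (ideal.span (A \<union> set ?ys)) F"
    "contains_large_degrees (ideal.span (insert F (A \<union> set ?ys)))" by blast
  have "\<exists>Gs. length Gs = length vs + length (Fs @ [F]) \<and> set Gs \<subseteq> V \<and> regular A Gs \<and>
    contains_large_degrees (ideal.span (A \<union> set Gs))"
  proof (rule Cons.IH)
    show "regular A (map var vs @ Fs @ [F])"
      using r(1) F(2) regular_append[of A ?ys "[F]"] by simp
    show "contains_large_degrees (ideal.span (A \<union> var ` set vs \<union> set (Fs @ [F])))"
      using F(3) by (simp add: Un_assoc)
  qed (use F Cons.prems in auto)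
  then show ?case by simp
qed

text \<open>With \<open>var j\<close> as the first member, the sequence lives on the hyperplane of
  tangent directions, so only directions \<open>v\<close> with \<open>v $ j = 0\<close> need a form
  of \<open>V\<close> that is nonzero there.\<close>

theorem ex_regular_forms:
  fixes V :: "'v::finite cpoly set"
  assumes V: "cv.subspace V" "\<And>F. F \<in> V \<Longrightarrow> homogeneous m F" "m > 0"
    and bpf: "\<And>v. v \<noteq> 0 \<Longrightarrow> v $ j = 0 \<Longrightarrow> \<exists>F\<in>V. eval v F \<noteq> 0"
    and n: "CARD('v) = n + 1"
  shows "\<exists>Gs. length Gs = n \<and> set Gs \<subseteq> V \<and> regular {var j} Gs \<and>
    contains_large_degrees (ideal.span (insert (var j) (set Gs)))"
proof -
  obtain vs where vs: "set vs = UNIV - {j}" "distinct vs"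
    using finite_distinct_list[of "UNIV - {j}"] by auto
  have "length vs = n" using distinct_card[OF vs(2)] vs(1) n by simp
  moreover have "\<exists>Gs. length Gs = length vs + length ([] :: 'v cpoly list) \<and> set Gs \<subseteq> V \<and> regular {var j} Gs \<and>
    contains_large_degrees (ideal.span ({var j} \<union> set Gs))"
  proof (rule ex_regular_in_subspace)
    show "regular {var j} (map var vs @ [])"
      using regular_var_powers[of vs j 1] vs by simp
    have "var i ^ 1 \<in> ideal.span ({var j} \<union> var ` set vs \<union> set [])" for i
      using vs(1) by (cases "i = j") (auto intro!: ideal.span_base)
    then show "contains_large_degrees (ideal.span ({var j} \<union> var ` set vs \<union> set []))"
      unfolding contains_large_degrees_def by (intro homogeneous_mem_of_powers) blast+
    show "\<exists>d. homogeneous d g" if "g \<in> {var j}" for g using that homogeneous_var by blast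
    show "\<exists>F\<in>V. eval v F \<noteq> 0" if "v \<noteq> 0" "\<And>f. f \<in> {var j} \<Longrightarrow> eval v f = 0" for v
      using bpf that by simp
  qed (use V in auto)
  ultimately show ?thesis by simp
qed


subsection \<open>Hilbert functions\<close>

text \<open>Representatives of a basis of the degree \<open>d\<close> part of the polynomial ring
  modulo \<open>Q\<close>.\<close>

definition graded_basis :: "'v::finite cpoly set \<Rightarrow> nat \<Rightarrow> 'v cpoly set \<Rightarrow> bool"
  where "graded_basis Q d B \<longleftrightarrow> finite B \<and> (\<forall>b\<in>B. homogeneous d b) \<and>
    (\<forall>c. (\<Sum>b\<in>B. const (c b) * b) \<in> Q \<longrightarrow> (\<forall>b\<in>B. c b = 0)) \<and>
    (\<forall>f. homogeneous d f \<longrightarrow> (\<exists>a. f - (\<Sum>b\<in>B. const (a b) * b) \<in> Q))"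

text \<open>An independent set has at most as many elements as there are monomials of degree
  \<open>d\<close>, so a largest one exists, and it spans.\<close>

lemma ex_graded_basis:
  assumes Q: "cv.subspace Q"
  shows "\<exists>B. graded_basis Q d B"
proof -
  define indep where "indep B \<longleftrightarrow> finite B \<and> (\<forall>b\<in>B. homogeneous d b) \<and>
    (\<forall>c. (\<Sum>b\<in>B. const (c b) * b) \<in> Q \<longrightarrow> (\<forall>b\<in>B. c b = 0))" for B :: "'a cpoly set"
  let ?U = "{u :: 'a \<Rightarrow>\<^sub>0 nat. mdeg u = d}"
  have bound: "card B \<le> card ?U" if "indep B" for B
  proof (rule cv.card_le_of_independent_modulo[OF Q finite_mdeg, where g = "\<lambda>b. b"])
    fix b assume "b \<in> B"
    then have "homogeneous d b" using that by (simp add: indep_def)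
    then have "b - (\<Sum>u\<in>?U. const (lookup b u) * single u 1) = 0"
      unfolding right_minus_eq by (intro monomial_expansion finite_mdeg) (auto simp: homogeneous_lookup)
    then show "\<exists>a. b - (\<Sum>u\<in>?U. const (a u) * single u 1) \<in> Q"
      using cv.subspace_0[OF Q] by (intro exI[of _ "lookup b"]) (simp only:)
  qed (use that in \<open>auto simp: indep_def\<close>)
  have "indep {}" by (simp add: indep_def)
  then obtain B where B: "indep B" and max: "\<And>C. indep C \<Longrightarrow> card C \<le> card B"
    using ex_has_greatest_nat[of indep "{}" card "Suc (card ?U)"] bound by (metis less_Suc_eq_le)
  have fin: "finite B" using B by (simp add: indep_def)
  have "\<exists>a. f - (\<Sum>b\<in>B. const (a b) * b) \<in> Q" if f: "homogeneous d f" for f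
  proof (rule ccontr)
    assume none: "\<nexists>a. f - (\<Sum>b\<in>B. const (a b) * b) \<in> Q"
    have "f \<notin> B"
    proof
      assume "f \<in> B"
      then have "(\<Sum>b\<in>B. const (if b = f then 1 else 0) * b) = f"
        using fin by (simp add: if_distrib[of const] if_distrib[of "\<lambda>x. x * _"] cong: if_cong)
      then have "f - (\<Sum>b\<in>B. const (if b = f then 1 else 0) * b) \<in> Q"
        using cv.subspace_0[OF Q] by simp
      then have "\<exists>a. f - (\<Sum>b\<in>B. const (a b) * b) \<in> Q"
        by (rule exI[of _ "\<lambda>b. if b = f then 1 else 0"])
      then show False using none by blast
    qed
    have "indep (insert f B)"
      unfolding indep_def
    proof (intro conjI allI impI)
      fix c assume c: "(\<Sum>b\<in>insert f B. const (c b) * b) \<in> Q"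
      then have s: "const (c f) * f + (\<Sum>b\<in>B. const (c b) * b) \<in> Q" using \<open>f \<notin> B\<close> fin by simp
      have "c f = 0"
      proof (rule ccontr)
        assume nz: "c f \<noteq> 0"
        have "const (1 / c f) * (const (c f) * f + (\<Sum>b\<in>B. const (c b) * b)) \<in> Q"
          using Q s by (rule cv.subspace_scale)
        also have "const (1 / c f) * (const (c f) * f + (\<Sum>b\<in>B. const (c b) * b)) =
          f - (\<Sum>b\<in>B. const (- c b / c f) * b)"
        proof -
          have "const (1 / c f) * (const (c b) * b) = - (const (- c b / c f) * b)" for b
            by (simp flip: mult.assoc const_mult const_uminus minus_mult_left)
          then show ?thesis using nz
            by (simp add: distrib_left sum_distrib_left sum_negf flip: mult.assoc const_mult)
        qed
        finally have "\<exists>a. f - (\<Sum>b\<in>B. const (a b) * b) \<in> Q"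
          by (rule exI[of _ "\<lambda>b. - c b / c f"])
        then show False using none by blast
      qed
      moreover from this have "(\<Sum>b\<in>B. const (c b) * b) \<in> Q" using s by simp
      then have "\<forall>b\<in>B. c b = 0" using B by (simp add: indep_def)
      ultimately show "\<forall>b\<in>insert f B. c b = 0" by simp
    qed (use B f in \<open>auto simp: indep_def\<close>)
    then have "card (insert f B) \<le> card B" by (rule max)
    then show False using \<open>f \<notin> B\<close> fin by simp
  qed
  then show ?thesis using B unfolding graded_basis_def indep_def by blast
qed

definition hilbert :: "'v::finite cpoly set \<Rightarrow> nat \<Rightarrow> nat"
  where "hilbert Q d = card (SOME B. graded_basis Q d B)"

lemma hilbertI:
  assumes Q: "cv.subspace Q" and B: "graded_basis Q d B"
  shows "hilbert Q d = card B"
proof -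
  have le: "card C \<le> card B" if "graded_basis Q d B" "graded_basis Q d C" for B C
    by (rule cv.card_le_of_independent_modulo[OF Q, where g = "\<lambda>b. b" and h = "\<lambda>b. b"])
       (use that in \<open>auto simp: graded_basis_def\<close>)
  have "graded_basis Q d (SOME B. graded_basis Q d B)"
    using B by (rule someI)
  then show ?thesis
    unfolding hilbert_def using le B by (intro antisym) blast+
qed

text \<open>Multiplication by \<open>F\<close> embeds the quotient by \<open>A\<close>, shifted by
  \<open>e\<close> degrees, into itself, with cokernel the quotient by \<open>insert F A\<close>. A
  basis in the middle is assembled from one of the cokernel and \<open>F\<close> times one of the
  source.\<close>

lemma hilbert_regular_step:
  assumes A: "\<And>g. g \<in> A \<Longrightarrow> \<exists>d. homogeneous d g" and F: "homogeneous e F"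
    and nzd: "nzd (ideal.span A) F"
  shows "hilbert (ideal.span A) d =
    hilbert (ideal.span (insert F A)) d + (if e \<le> d then hilbert (ideal.span A) (d - e) else 0)"
proof -
  let ?Q = "ideal.span A" and ?R = "ideal.span (insert F A)"
  have Q: "cv.subspace ?Q" and R: "cv.subspace ?R"
    by (auto intro: ideal_subspace_vector_subspace)
  have mono: "?Q \<subseteq> ?R" by (rule ideal.span_mono) blast
  obtain B where B: "graded_basis ?R d B" using ex_graded_basis[OF R] by blast
  show ?thesis
  proof (cases "e \<le> d")
    case False
    have eq: "f \<in> ?Q" if "f \<in> ?R" "homogeneous d f" for f
      using homogeneous_span_insert[OF A F that(2,1)] False by simp
    have "graded_basis ?Q d B"
      unfolding graded_basis_def
    proof (intro conjI allI impI)
      show "finite B" "\<forall>b\<in>B. homogeneous d b" using B by (auto simp: graded_basis_def)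
      show "\<forall>b\<in>B. c b = 0" if "(\<Sum>b\<in>B. const (c b) * b) \<in> ?Q" for c
      proof -
        have "(\<Sum>b\<in>B. const (c b) * b) \<in> ?R" using that mono by blast
        then show ?thesis using B unfolding graded_basis_def by blast
      qed
      fix f :: "'a cpoly" assume f: "homogeneous d f"
      then obtain a where a: "f - (\<Sum>b\<in>B. const (a b) * b) \<in> ?R"
        using B unfolding graded_basis_def by blast
      have "homogeneous d (f - (\<Sum>b\<in>B. const (a b) * b))"
        using B f by (intro homogeneous_diff homogeneous_sum homogeneous_const_mult) (auto simp: graded_basis_def)
      then show "\<exists>a. f - (\<Sum>b\<in>B. const (a b) * b) \<in> ?Q" using a eq by blast
    qed
    then show ?thesis using hilbertI[OF Q] hilbertI[OF R B] False by simp
  next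
    case True
    obtain C where C: "graded_basis ?Q (d - e) C" using ex_graded_basis[OF Q] by blast
    obtain E where E: "graded_basis ?Q d E" using ex_graded_basis[OF Q] by blast
    note finite = B[unfolded graded_basis_def, THEN conjunct1] C[unfolded graded_basis_def, THEN conjunct1]
      E[unfolded graded_basis_def, THEN conjunct1]
    \<comment> \<open>The index set is a disjoint sum, so that members of \<open>B\<close> and
      multiples of \<open>F\<close> are counted separately before they are known to differ.\<close>
    define g where "g = case_sum (\<lambda>b. b) (\<lambda>c. F * c)"
    have sum: "(\<Sum>x\<in>B <+> C. const (c x) * g x) =
      (\<Sum>b\<in>B. const (c (Inl b)) * b) + F * (\<Sum>b\<in>C. const (c (Inr b)) * b)" for c
      using finite by (simp add: sum.Plus g_def sum_distrib_left mult.left_commute)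
    have "card (B <+> C) \<le> card E"
    proof (rule cv.card_le_of_independent_modulo[OF Q, where g = g and h = "\<lambda>b. b"])
      show "\<forall>i\<in>B <+> C. c i = 0" if "(\<Sum>x\<in>B <+> C. const (c x) * g x) \<in> ?Q" for c
      proof -
        have "(\<Sum>b\<in>B. const (c (Inl b)) * b) + F * (\<Sum>b\<in>C. const (c (Inr b)) * b) \<in> ?R"
          using that mono unfolding sum by blast
        moreover have "(\<Sum>b\<in>C. const (c (Inr b)) * b) * F \<in> ?R"
          by (intro ideal.span_scale ideal.span_base) simp
        ultimately have "(\<Sum>b\<in>B. const (c (Inl b)) * b) \<in> ?R"
          by (simp add: ideal.span_add_eq2 mult.commute)
        then have 1: "c (Inl b) = 0" if "b \<in> B" for b
          using B that unfolding graded_basis_def by (auto dest!: spec[of _ "\<lambda>b. c (Inl b)"])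
        then have "F * (\<Sum>b\<in>C. const (c (Inr b)) * b) \<in> ?Q" using that unfolding sum by simp
        then have "(\<Sum>b\<in>C. const (c (Inr b)) * b) \<in> ?Q" using nzd by (rule nzdD[rotated])
        then have "c (Inr b) = 0" if "b \<in> C" for b
          using C that unfolding graded_basis_def by (auto dest!: spec[of _ "\<lambda>b. c (Inr b)"])
        then show ?thesis using 1 by auto
      qed
      fix i assume "i \<in> B <+> C"
      then have "homogeneous d (g i)"
        using B C True homogeneous_mult[OF F, of "d - e"] by (auto simp: g_def graded_basis_def)
      then show "\<exists>a. g i - (\<Sum>k\<in>E. const (a k) * k) \<in> ?Q"
        using E by (simp add: graded_basis_def)
    qed (use finite in auto)
    moreover have "card E \<le> card (B <+> C)"
    proof (rule cv.card_le_of_independent_modulo[OF Q, where g = "\<lambda>b. b" and h = g])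
      show "\<And>c. (\<Sum>i\<in>E. const (c i) * i) \<in> ?Q \<Longrightarrow> \<forall>i\<in>E. c i = 0"
        using E by (simp add: graded_basis_def)
      fix f assume "f \<in> E"
      then have f: "homogeneous d f" using E by (simp add: graded_basis_def)
      then obtain a where a: "f - (\<Sum>b\<in>B. const (a b) * b) \<in> ?R"
        using B unfolding graded_basis_def by blast
      have "homogeneous d (f - (\<Sum>b\<in>B. const (a b) * b))"
        using B f by (intro homogeneous_diff homogeneous_sum homogeneous_const_mult) (auto simp: graded_basis_def)
      from homogeneous_span_insert[OF A F this a] True
      obtain u where u: "homogeneous (d - e) u" "f - (\<Sum>b\<in>B. const (a b) * b) - F * u \<in> ?Q" by auto
      then obtain c where c: "u - (\<Sum>b\<in>C. const (c b) * b) \<in> ?Q"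
        using C unfolding graded_basis_def by blast
      have "f - (\<Sum>b\<in>B. const (a b) * b) - F * u + F * (u - (\<Sum>b\<in>C. const (c b) * b)) \<in> ?Q"
        by (rule ideal.span_add[OF u(2) ideal.span_scale[OF c]])
      then have "f - (\<Sum>x\<in>B <+> C. const (case_sum a c x) * g x) \<in> ?Q"
        unfolding sum by (simp add: algebra_simps)
      then show "\<exists>a. f - (\<Sum>k\<in>B <+> C. const (a k) * g k) \<in> ?Q" by blast
    qed (use finite in auto)
    ultimately have "card E = card B + card C" using finite by (simp add: card_Plus)
    then show ?thesis using hilbertI[OF Q E] hilbertI[OF R B] hilbertI[OF Q C] True by simp
  qed
qed

text \<open>By \<open>hilbert_regular_step\<close> each member changes the Hilbert function in a way
  that depends only on its degree.\<close>

lemma hilbert_regular_eq: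
  assumes "regular A xs" "regular B ys" "length xs = length ys"
    and "\<And>g. g \<in> A \<Longrightarrow> \<exists>d. homogeneous d g" "\<And>g. g \<in> B \<Longrightarrow> \<exists>d. homogeneous d g"
    and "\<And>g. g \<in> set xs \<Longrightarrow> homogeneous e g" "\<And>g. g \<in> set ys \<Longrightarrow> homogeneous e g"
    and "hilbert (ideal.span A) = hilbert (ideal.span B)"
  shows "hilbert (ideal.span (A \<union> set xs)) = hilbert (ideal.span (B \<union> set ys))"
  using assms(3,1,2,4-)
proof (induction xs ys arbitrary: A B rule: list_induct2)
  case (Cons x xs y ys)
  have x: "homogeneous e x" and y: "homogeneous e y" using Cons.prems by auto
  have "hilbert (ideal.span (insert x A)) d = hilbert (ideal.span (insert y B)) d" for d
    using hilbert_regular_step[where A = A, OF Cons.prems(3) x, where d = d]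
      hilbert_regular_step[where A = B, OF Cons.prems(4) y, where d = d]
      fun_cong[OF Cons.prems(7), of d] fun_cong[OF Cons.prems(7), of "d - e"] Cons.prems(1,2)
    by (simp split: if_splits)
  then have "hilbert (ideal.span (insert x A \<union> set xs)) = hilbert (ideal.span (insert y B \<union> set ys))"
    using Cons.prems exI[of "\<lambda>d. homogeneous d x", OF x] exI[of "\<lambda>d. homogeneous d y", OF y]
    by (intro Cons.IH) (auto intro!: ext)
  then show ?case by simp
qed simp

lemma graded_basis_empty:
  assumes "\<And>f. homogeneous d f \<Longrightarrow> f \<in> Q" "graded_basis Q d B"
  shows "B = {}"
proof (rule ccontr)
  assume "B \<noteq> {}"
  then obtain b where b: "b \<in> B" by blast
  have "(\<Sum>x\<in>B. const 1 * x) \<in> Q"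
    using assms by (intro assms(1) homogeneous_sum homogeneous_const_mult) (auto simp: graded_basis_def)
  then have "\<forall>x\<in>B. (1::complex) = 0"
    using assms(2) unfolding graded_basis_def by (elim conjE allE[of _ "\<lambda>_. 1"]) blast
  then show False using b by simp
qed

lemma single_1_inject: "single u (1::complex) = single w 1 \<longleftrightarrow> u = w"
  by (metis lookup_single_eq lookup_single_not_eq zero_neq_one)

section \<open>Counting monomials outside the ideal of powers\<close>

lemma hilbert_monomial_ideal:
  "hilbert (monomial_ideal j e S) d =
    card {u. mdeg u = d \<and> lookup u j = 0 \<and> (\<forall>i\<in>S. lookup u i < e)}"
    (is "_ = card ?U")
proof -
  have Q: "cv.subspace (monomial_ideal j e S)"
    by (simp add: ideal_subspace_vector_subspace flip: span_monomial_ideal)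
  have fin: "finite ?U" by (rule finite_subset[OF _ finite_mdeg[of d]]) auto
  have inj: "inj_on (\<lambda>u. single u (1::complex)) ?U"
    by (simp add: inj_on_def single_1_inject)
  have sum: "(\<Sum>b\<in>(\<lambda>u. single u 1) ` ?U. const (c b) * b) =
    (\<Sum>u\<in>?U. const (c (single u 1)) * single u 1)" for c
    by (simp add: sum.reindex[OF inj])
  have lk: "lookup (\<Sum>u\<in>?U. const (a u) * single u 1) w =
    (if w \<in> ?U then a w else 0)" for a w
    using fin by (simp add: lookup_sum lookup_const_mult lookup_single when_def
      if_distrib[of "\<lambda>x. _ * x"] cong: if_cong)
  have "graded_basis (monomial_ideal j e S) d ((\<lambda>u. single u 1) ` ?U)"
    unfolding graded_basis_def
  proof (intro conjI allI impI ballI)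
    show "finite ((\<lambda>u. single u (1::complex)) ` ?U)" using fin by simp
    show "homogeneous d b" if "b \<in> (\<lambda>u. single u 1) ` ?U" for b
      using that homogeneous_single by auto
    show "c b = 0" if c: "(\<Sum>b\<in>(\<lambda>u. single u 1) ` ?U. const (c b) * b) \<in> monomial_ideal j e S"
      and b: "b \<in> (\<lambda>u. single u 1) ` ?U" for c b
    proof (rule ccontr)
      assume nz: "c b \<noteq> 0"
      obtain u where u: "u \<in> ?U" "b = single u 1" using b by blast
      have "lookup u j \<ge> 1 \<or> (\<exists>i\<in>S. lookup u i \<ge> e)"
        using c u nz unfolding sum monomial_ideal_def mem_Collect_eq lk by (elim allE[of _ u]) simp
      then show False using u(1) by auto
    qed
    fix f :: "'a cpoly" assume f: "homogeneous d f"
    \<comment> \<open>\<open>graded_basis\<close> indexes coefficients by polynomials instead of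
      exponents. The sum has one relevant term, that of the exponent \<open>u\<close> with
      \<open>b = single u 1\<close>.\<close>
    define a where "a b = (\<Sum>u\<in>?U. if b = single u (1::complex) then lookup f u else 0)" for b
    have a: "a (single u 1) = lookup f u" if "u \<in> ?U" for u
    proof -
      have "a (single u 1) = (\<Sum>w\<in>?U. if w = u then lookup f w else 0)"
        unfolding a_def single_1_inject by (intro sum.cong refl) auto
      then show ?thesis using fin that by simp
    qed
    have "(\<Sum>b\<in>(\<lambda>u. single u 1) ` ?U. const (a b) * b) =
      (\<Sum>u\<in>?U. const (lookup f u) * single u 1)"
      unfolding sum by (rule sum.cong) (simp_all add: a)
    moreover have "f - (\<Sum>u\<in>?U. const (lookup f u) * single u 1) \<in> monomial_ideal j e S"
      unfolding monomial_ideal_def mem_Collect_eq lookup_minus lk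
      using f by (auto simp: homogeneous_lookup not_less)
    ultimately show "\<exists>a. f - (\<Sum>b\<in>(\<lambda>u. single u 1) ` ?U. const (a b) * b) \<in> monomial_ideal j e S"
      by (intro exI[of _ a]) (simp only:)
  qed
  from hilbertI[OF Q this] show ?thesis by (simp add: card_image[OF inj])
qed

lemma card_bounded_exponents:
  assumes "CARD('v::finite) = n + 1"
  shows "card {u :: 'v \<Rightarrow>\<^sub>0 nat. lookup u j = 0 \<and> (\<forall>i\<in>UNIV - {j}. lookup u i < m)} = m ^ n"
    (is "card ?U = _")
proof -
  have "bij_betw lookup ?U (PiE UNIV (\<lambda>i. if i = j then {0} else {..<m}))"
  proof (rule bij_betwI[where g = Abs_poly_mapping])
    show "lookup \<in> ?U \<rightarrow> PiE UNIV (\<lambda>i. if i = j then {0} else {..<m})" by auto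
    show "Abs_poly_mapping \<in> PiE UNIV (\<lambda>i. if i = j then {0} else {..<m}) \<rightarrow> ?U"
      by (auto simp: PiE_iff split: if_splits)
  qed (simp_all add: lookup_inverse)
  then have "card ?U = card (PiE UNIV (\<lambda>i. if i = j then {0} else {..<m}))"
    by (rule bij_betw_same_card)
  also have "\<dots> = (\<Prod>i\<in>UNIV. if i = j then 1 else m)"
    by (subst card_PiE) (auto intro!: prod.cong)
  also have "\<dots> = (\<Prod>i\<in>UNIV - {j}. m)"
    by (subst prod.remove[of _ j]) (auto intro!: prod.cong)
  also have "\<dots> = m ^ n" using assms by (simp add: card_Diff_singleton)
  finally show ?thesis .
qed

text \<open>The quotient has the Hilbert function of the quotient by the powers
  \<open>var i ^ m\<close>, for which the monomials with exponents below \<open>m\<close> are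
  counted. Bases of the finitely many nonzero degrees are united into one.\<close>

theorem ex_basis_of_regular:
  fixes Gs :: "'v::finite cpoly list"
  assumes n: "CARD('v) = n + 1" "length Gs = n"
    and Gs: "\<And>G. G \<in> set Gs \<Longrightarrow> homogeneous m G" "regular {var j} Gs"
    and top: "contains_large_degrees (ideal.span (insert (var j) (set Gs)))"
  obtains B where "finite B" "card B = m ^ n" "\<And>b. b \<in> B \<Longrightarrow> \<exists>d. homogeneous d b"
    "\<And>c. (\<Sum>b\<in>B. const (c b) * b) \<in> ideal.span (insert (var j) (set Gs)) \<Longrightarrow> \<forall>b\<in>B. c b = 0"
    "\<And>d f. homogeneous d f \<Longrightarrow> \<exists>a. f - (\<Sum>b\<in>{b\<in>B. homogeneous d b}. const (a b) * b)
      \<in> ideal.span (insert (var j) (set Gs))"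
proof -
  let ?Q = "ideal.span (insert (var j) (set Gs))"
  have Q: "cv.subspace ?Q" by (intro ideal_subspace_vector_subspace) simp
  have hQ: "homogeneous_ideal ?Q"
    using Gs(1) homogeneous_var by (intro homogeneous_ideal_span) auto
  obtain vs where vs: "set vs = UNIV - {j}" "distinct vs"
    using finite_distinct_list[of "UNIV - {j}"] by auto
  have lvs: "length vs = n" using distinct_card[OF vs(2)] vs(1) n(1) by simp
  have "hilbert (ideal.span ({var j} \<union> set Gs)) = hilbert (ideal.span ({var j} \<union> set (map (\<lambda>i. var i ^ m) vs)))"
  proof (rule hilbert_regular_eq[OF Gs(2) regular_var_powers[OF vs(2)]])
    show "homogeneous m g" if "g \<in> set (map (\<lambda>i. var i ^ m) vs)" for g :: "'v cpoly"
      using that homogeneous_power[OF homogeneous_var, of m] by auto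
  qed (use vs lvs n(2) Gs(1) homogeneous_var in \<open>auto\<close>)
  then have hilb: "hilbert ?Q d = card {u :: 'v \<Rightarrow>\<^sub>0 nat. mdeg u = d \<and> lookup u j = 0 \<and>
      (\<forall>i\<in>UNIV - {j}. lookup u i < m)}" for d
    by (simp add: vs(1) span_monomial_ideal hilbert_monomial_ideal)
  obtain D where D: "\<And>d f. D \<le> d \<Longrightarrow> homogeneous d f \<Longrightarrow> f \<in> ?Q"
    using top by (auto simp: contains_large_degrees_def)
  obtain B where B: "\<And>d. graded_basis ?Q d (B d)" using ex_graded_basis[OF Q] by metis
  have empty: "B d = {}" if "D \<le> d" for d
    by (rule graded_basis_empty[OF _ B]) (rule D[OF that])
  \<comment> \<open>A nonzero form has only one degree; this is what keeps the bases of different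
    degrees disjoint.\<close>
  have nz: "b \<noteq> 0" if "b \<in> B d" for b d
  proof
    assume "b = 0"
    have "(\<Sum>x\<in>B d. const (if x = b then 1 else 0) * x) \<in> ?Q"
      using that B[of d] \<open>b = 0\<close> by (simp add: graded_basis_def if_distrib[of const] if_distrib[of "\<lambda>x. x * _"]
          ideal.span_zero cong: if_cong)
    then have "\<forall>x\<in>B d. (if x = b then 1 else 0 :: complex) = 0"
      using B[of d] unfolding graded_basis_def by (elim conjE allE[of _ "\<lambda>x. if x = b then 1 else 0"]) blast
    then show False using that by auto
  qed
  have hom: "homogeneous d b" if "b \<in> B d" for b d using that B by (simp add: graded_basis_def)
  have uniq: "d = e" if "homogeneous d b" "b \<in> B e" for b d e
    using hom_part_homogeneous[OF that(1), of e] hom_part_homogeneous[OF hom[OF that(2)], of e] nz[OF that(2)]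
    by (auto split: if_splits)
  define BB where "BB = (\<Union>d<D. B d)"
  have fin: "finite (B d)" for d using B by (simp add: graded_basis_def)
  have disj: "B d \<inter> B e = {}" if "d \<noteq> e" for d e
    using uniq hom that by blast
  have part: "{b\<in>BB. homogeneous d b} = B d" for d
  proof
    show "{b\<in>BB. homogeneous d b} \<subseteq> B d" using uniq unfolding BB_def by blast
    show "B d \<subseteq> {b\<in>BB. homogeneous d b}"
      using hom empty[of d] unfolding BB_def by (cases "d < D") auto
  qed
  show thesis
  proof (rule that)
    show "finite BB" by (simp add: BB_def fin)
    have "card BB = (\<Sum>d<D. card (B d))"
      unfolding BB_def using fin disj by (intro card_UN_disjoint) auto
    also have "\<dots> = (\<Sum>d<D. hilbert ?Q d)" using hilbertI[OF Q B] by simp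
    also have "\<dots> = card (\<Union>d<D. {u :: 'v \<Rightarrow>\<^sub>0 nat. mdeg u = d \<and> lookup u j = 0 \<and>
      (\<forall>i\<in>UNIV - {j}. lookup u i < m)})"
      unfolding hilb by (subst card_UN_disjoint) (auto intro: finite_subset[OF _ finite_mdeg])
    also have "(\<Union>d<D. {u :: 'v \<Rightarrow>\<^sub>0 nat. mdeg u = d \<and> lookup u j = 0 \<and>
      (\<forall>i\<in>UNIV - {j}. lookup u i < m)}) =
      {u. lookup u j = 0 \<and> (\<forall>i\<in>UNIV - {j}. lookup u i < m)}" (is "?L = ?R")
    proof
      show "?R \<subseteq> ?L"
      proof
        fix u assume u: "u \<in> ?R"
        \<comment> \<open>The Hilbert function vanishes from degree \<open>D\<close> on, so no
          admissible exponent has such a degree and the union over \<open>d < D\<close> misses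
          none.\<close>
        have "mdeg u < D"
        proof (rule ccontr)
          assume "\<not> mdeg u < D"
          then have "hilbert ?Q (mdeg u) = 0"
            using hilbertI[OF Q B, of "mdeg u"] empty[of "mdeg u"] by simp
          moreover have "finite {w :: 'v \<Rightarrow>\<^sub>0 nat. mdeg w = mdeg u \<and> lookup w j = 0 \<and>
      (\<forall>i\<in>UNIV - {j}. lookup w i < m)}"
            by (rule finite_subset[OF _ finite_mdeg[of "mdeg u"]]) auto
          ultimately show False using u unfolding hilb by auto
        qed
        then show "u \<in> ?L" using u by auto
      qed
    qed auto
    also have "card \<dots> = m ^ n" by (rule card_bounded_exponents[OF n(1)])
    finally show "card BB = m ^ n" .
    show "\<exists>d. homogeneous d b" if "b \<in> BB" for b using that hom by (auto simp: BB_def)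
    show "\<forall>b\<in>BB. c b = 0" if c: "(\<Sum>b\<in>BB. const (c b) * b) \<in> ?Q" for c
    proof
      fix b assume "b \<in> BB"
      then obtain d where d: "b \<in> B d" by (auto simp: BB_def)
      have "hom_part d (\<Sum>b\<in>BB. const (c b) * b) = (\<Sum>b\<in>BB. if homogeneous d b then const (c b) * b else 0)"
        unfolding hom_part_sum hom_part_const_mult
      proof (rule sum.cong)
        fix x assume "x \<in> BB"
        then obtain e where e: "x \<in> B e" by (auto simp: BB_def)
        show "const (c x) * hom_part d x = (if homogeneous d x then const (c x) * x else 0)"
        proof (cases "d = e")
          case True
          then show ?thesis using hom[OF e] by (simp add: hom_part_homogeneous)
        next
          case False
          then have "\<not> homogeneous d x" using uniq[OF _ e] by blast
          then show ?thesis using False by (simp add: hom_part_homogeneous[OF hom[OF e]])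
        qed
      qed simp
      also have "\<dots> = (\<Sum>b\<in>B d. const (c b) * b)"
        unfolding part[symmetric] using fin by (intro sum.inter_filter[symmetric]) (simp add: BB_def)
      finally have "(\<Sum>b\<in>B d. const (c b) * b) \<in> ?Q" using homogeneous_idealD[OF hQ c, of d] by simp
      then show "c b = 0" using B[of d] d unfolding graded_basis_def by blast
    qed
    show "\<exists>a. f - (\<Sum>b\<in>{b\<in>BB. homogeneous d b}. const (a b) * b) \<in> ?Q" if "homogeneous d f" for d f
      using B[of d] that unfolding part graded_basis_def by blast
  qed
qed


subsection \<open>Leading forms\<close>

text \<open>Applied to \<open>taylor P f\<close> for a form \<open>f\<close>, this says that
  \<open>f\<close> lies in the \<open>d\<close>-th power of the ideal of the point; see
  \<open>ypow_vanishes\<close> and \<open>ypow_of_vanishes\<close>.\<close>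

definition vanishes_to :: "nat \<Rightarrow> 'v::finite cpoly \<Rightarrow> bool"
  where "vanishes_to d f \<longleftrightarrow> (\<forall>e<d. hom_part e f = 0)"

lemma vanishes_toD: "vanishes_to d f \<Longrightarrow> e < d \<Longrightarrow> hom_part e f = 0"
  by (simp add: vanishes_to_def)

lemma vanishes_to_0 [simp]: "vanishes_to d 0" "vanishes_to 0 f"
  by (simp_all add: vanishes_to_def)

lemma vanishes_to_add: "vanishes_to d f \<Longrightarrow> vanishes_to d g \<Longrightarrow> vanishes_to d (f + g)"
  by (simp add: vanishes_to_def hom_part_add)

lemma vanishes_to_diff: "vanishes_to d f \<Longrightarrow> vanishes_to d g \<Longrightarrow> vanishes_to d (f - g)"
  by (simp add: vanishes_to_def hom_part_diff)

lemma vanishes_to_sum: "(\<And>x. x \<in> A \<Longrightarrow> vanishes_to d (f x)) \<Longrightarrow> vanishes_to d (sum f A)"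
  by (simp add: vanishes_to_def hom_part_sum)

lemma vanishes_to_homogeneous: "homogeneous d f \<Longrightarrow> vanishes_to d f"
  by (simp add: vanishes_to_def hom_part_homogeneous)

lemma vanishes_to_mono: "vanishes_to d f \<Longrightarrow> e \<le> d \<Longrightarrow> vanishes_to e f"
  by (simp add: vanishes_to_def)

lemma vanishes_to_Suc: "vanishes_to (Suc d) f \<longleftrightarrow> vanishes_to d f \<and> hom_part d f = 0"
  by (auto simp: vanishes_to_def less_Suc_eq)

lemma vanishes_to_mult:
  assumes f: "vanishes_to d f" and g: "vanishes_to e g"
  shows "vanishes_to (d + e) (f * g)" "hom_part (d + e) (f * g) = hom_part d f * hom_part e g"
proof -
  have "hom_part i f * hom_part (k - i) g = 0" if "k < d + e" "i \<le> k" for i k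
    using vanishes_toD[OF f, of i] vanishes_toD[OF g, of "k - i"] that by (cases "i < d") auto
  then show "vanishes_to (d + e) (f * g)"
    by (simp add: vanishes_to_def hom_part_mult)
  have "hom_part i f * hom_part (d + e - i) g = 0" if "i \<noteq> d" "i \<le> d + e" for i
    using vanishes_toD[OF f, of i] vanishes_toD[OF g, of "d + e - i"] that by (cases "i < d") auto
  then have "(\<Sum>i\<le>d + e. hom_part i f * hom_part (d + e - i) g) =
    (\<Sum>i\<le>d + e. if i = d then hom_part i f * hom_part (d + e - i) g else 0)"
    by (intro sum.cong) auto
  then show "hom_part (d + e) (f * g) = hom_part d f * hom_part e g"
    by (simp add: hom_part_mult)
qed

text \<open>
  If the leading forms are a regular sequence, a cancellation of leading terms in \<open>\<Sum>a\<^sub>i K\<^sub>i\<close> comes from a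
  relation between earlier generators, so it can be removed by raising the order of the last coefficient.
\<close>

lemma leading_form_of_regular:
  fixes Ps :: "('v::finite cpoly \<times> 'v cpoly) list"
  assumes A: "\<And>g. g \<in> A \<Longrightarrow> \<exists>d. homogeneous d g"
    and "\<And>K F. (K, F) \<in> set Ps \<Longrightarrow> vanishes_to m K \<and> hom_part m K = F"
    and "regular A (map snd Ps)"
    and "f \<in> ideal.span (A \<union> set (map fst Ps))" "vanishes_to d f"
  shows "hom_part d f \<in> ideal.span (A \<union> set (map snd Ps))"
  using assms(2-)
proof (induction Ps arbitrary: f d rule: rev_induct)
  case Nil
  then show ?case
    using homogeneous_idealD[OF homogeneous_ideal_span[of A, OF A]] by simp
next
  case (snoc p Ps)
  obtain K F where p: "p = (K, F)" by force
  let ?Q = "ideal.span (A \<union> set (map fst Ps))" and ?R = "ideal.span (A \<union> set (map snd Ps))"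
  have K: "vanishes_to m K" "hom_part m K = F" using snoc.prems(1)[of K F] p by auto
  have PF: "vanishes_to m K \<and> hom_part m K = F" if "(K, F) \<in> set Ps" for K F
    using snoc.prems(1)[of K F] that by simp
  have reg: "regular A (map snd Ps)" "nzd ?R F"
    using snoc.prems(2) by (auto simp: regular_append p)
  have IH: "hom_part d f \<in> ?R" if "f \<in> ?Q" "vanishes_to d f" for d f
    using PF reg(1) that by (rule snoc.IH)
  \<comment> \<open>Each homogeneous part of an element of the ideal of leading forms is the leading
    part of an element generated by the earlier \<open>K\<close>. It may be zero, in which case
    \<open>b\<close> has higher order.\<close>
  have lift: "\<forall>k. \<exists>b\<in>?Q. vanishes_to k b \<and> hom_part k b = hom_part k r" if "r \<in> ?R" for r
    using that
  proof (induction rule: ideal.span_induct_alt)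
    case base
    show ?case by (intro allI bexI[of _ 0]) (auto simp: ideal.span_zero)
  next
    case (step c x y)
    show ?case
    proof
      fix k
      obtain b where b: "b \<in> ?Q" "vanishes_to k b" "hom_part k b = hom_part k y"
        using step(2) by blast
      have "\<exists>b'\<in>?Q. vanishes_to k b' \<and> hom_part k b' = hom_part k (x * c)"
        using step(1)
      proof
        assume x: "x \<in> A"
        then obtain e where e: "homogeneous e x" using A by blast
        have "hom_part k (x * c) \<in> ?Q"
        proof (cases "e \<le> k")
          case True
          then show ?thesis using x ideal.span_scale[of x "A \<union> set (map fst Ps)" "hom_part (k - e) c"]
            by (simp add: hom_part_homogeneous_mult[OF e] mult.commute[of _ x] ideal.span_base)
        qed (simp add: hom_part_homogeneous_mult[OF e] ideal.span_zero)
        then show ?thesis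
          by (intro bexI[of _ "hom_part k (x * c)"]) (simp_all add: vanishes_to_homogeneous hom_part_hom_part)
      next
        assume "x \<in> set (map snd Ps)"
        then obtain K where x: "(K, x) \<in> set Ps" by auto
        have hx: "homogeneous m x" using PF[OF x] by auto
        show ?thesis
        proof (cases "m \<le> k")
          case True
          let ?c = "hom_part (k - m) c"
          have "vanishes_to (k - m + m) (?c * K)" "hom_part (k - m + m) (?c * K) = hom_part (k - m) ?c * x"
            using vanishes_to_mult[OF vanishes_to_homogeneous[OF homogeneous_hom_part[of "k - m" c]], of m K] PF[OF x]
            by auto
          moreover have "?c * K \<in> ?Q" using x by (intro ideal.span_scale ideal.span_base) force
          ultimately show ?thesis using True
            by (intro bexI[of _ "?c * K"])
              (auto simp: hom_part_homogeneous_mult[OF hx] hom_part_hom_part mult.commute[of _ x])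
        next
          case False
          then show ?thesis
            by (intro bexI[of _ 0]) (auto simp: hom_part_homogeneous_mult[OF hx] ideal.span_zero)
        qed
      qed
      then obtain b' where "b' \<in> ?Q" "vanishes_to k b'" "hom_part k b' = hom_part k (x * c)" by blast
      then show "\<exists>b\<in>?Q. vanishes_to k b \<and> hom_part k b = hom_part k (c * x + y)"
        using b by (intro bexI[of _ "b' + b"])
          (auto simp: hom_part_add mult.commute[of c] intro: vanishes_to_add ideal.span_add)
    qed
  qed
  have f: "f \<in> ideal.span (insert K (A \<union> set (map fst Ps)))"
    using snoc.prems(3) by (simp add: p)
  \<comment> \<open>The order of the last coefficient \<open>a\<close> is raised by one as long as
    \<open>a * K\<close> may still have terms of order below \<open>d\<close>: these have to cancel,
    so by regularity the leading form of \<open>a\<close> belongs to \<open>?R\<close> and can be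
    removed by a lift \<open>b\<close>.\<close>
  have ex: "\<exists>a. f - a * K \<in> ?Q \<and> vanishes_to k a" if "k = 0 \<or> k + m \<le> d" for k
    using that
  proof (induction k)
    case 0
    then show ?case using f unfolding ideal.span_breakdown_eq by simp
  next
    case (Suc k)
    then obtain a where a: "f - a * K \<in> ?Q" "vanishes_to k a" by auto
    note aK = vanishes_to_mult[OF a(2) K(1)]
    have "vanishes_to (k + m) (f - a * K)"
      using snoc.prems(4) Suc.prems aK(1) by (intro vanishes_to_diff) (auto intro: vanishes_to_mono)
    from IH[OF a(1) this] have "hom_part (k + m) (f - a * K) \<in> ?R" .
    then have "- (F * hom_part k a) \<in> ?R"
      using vanishes_toD[OF snoc.prems(4), of "k + m"] Suc.prems aK(2) K(2)
      by (simp add: hom_part_diff mult.commute)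
    then have "F * hom_part k a \<in> ?R" using ideal.span_neg by fastforce
    then have "hom_part k a \<in> ?R" using reg(2) by (rule nzdD[rotated])
    then obtain b where b: "b \<in> ?Q" "vanishes_to k b" "hom_part k b = hom_part k a"
      using lift by (metis hom_part_hom_part)
    have "f - a * K + K * b \<in> ?Q" by (intro ideal.span_add a ideal.span_scale b)
    then have "f - (a - b) * K \<in> ?Q" by (simp add: algebra_simps)
    moreover have "vanishes_to (Suc k) (a - b)"
      using a b by (auto simp: vanishes_to_Suc hom_part_diff intro: vanishes_to_diff)
    ultimately show ?case by blast
  qed
  \<comment> \<open>For \<open>d < m\<close> the difference is 0 and any cofactor will do, since
    \<open>a * K\<close> has no terms of degree \<open>d\<close> at all.\<close>
  obtain a where a: "f - a * K \<in> ?Q" "vanishes_to (d - m) a"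
    using ex[of "d - m"] by (cases "m \<le> d") auto
  note aK = vanishes_to_mult[OF a(2) K(1)]
  have "vanishes_to d (f - a * K)"
    using snoc.prems(4) aK(1) by (intro vanishes_to_diff) (auto intro: vanishes_to_mono)
  from IH[OF a(1) this] have R: "hom_part d f - hom_part d (a * K) \<in> ?R" by (simp add: hom_part_diff)
  have "\<exists>c. hom_part d (a * K) = c * F"
  proof (cases "m \<le> d")
    case True
    then show ?thesis using aK(2) K(2) by auto
  next
    case False
    then have "hom_part d (a * K) = 0" using vanishes_toD[OF aK(1), of d] by simp
    then show ?thesis by (intro exI[of _ 0]) simp
  qed
  then obtain c where "hom_part d f - c * F \<in> ?R" using R by auto
  then have "hom_part d f \<in> ideal.span (insert F (A \<union> set (map snd Ps)))"
    unfolding ideal.span_breakdown_eq by blast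
  then show ?case by (simp add: p)
qed

subsection \<open>Nakayama's lemma\<close>

text \<open>
  This is the statement for the localization at \<open>U\<close>, with the denominators cleared. The generators are
  eliminated one at a time.
\<close>

lemma nakayama:
  fixes b :: "'i \<Rightarrow> 'a::comm_ring_1"
  assumes I: "ideal.subspace I" and N: "ideal.subspace N"
    and U: "1 \<in> U" "\<And>u w. u \<in> U \<Longrightarrow> w \<in> U \<Longrightarrow> u * w \<in> U" "\<And>u n. u \<in> U \<Longrightarrow> n \<in> N \<Longrightarrow> u - n \<in> U"
    and "finite S"
    and "\<And>s. s \<in> S \<Longrightarrow> \<exists>u\<in>U. \<exists>n. (\<forall>t. n t \<in> N) \<and> u * b s - (\<Sum>t\<in>S. n t * b t) \<in> I"
  shows "\<exists>u\<in>U. \<forall>s\<in>S. u * b s \<in> I"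
  using assms(6,7)
proof (induction S rule: finite_induct)
  case empty
  then show ?case using U(1) by blast
next
  case (insert r S)
  obtain u0 n0 where 0: "u0 \<in> U" "\<And>t. n0 t \<in> N" "u0 * b r - (\<Sum>t\<in>insert r S. n0 t * b t) \<in> I"
    using insert.prems[of r] by blast
  \<comment> \<open>Collecting the terms with \<open>b r\<close> gives it a coefficient
    \<open>w\<close> that is still in \<open>U\<close>; its relation then eliminates
    \<open>b r\<close> from all others.\<close>
  define w where "w = u0 - n0 r"
  have w: "w \<in> U" using 0 U(3) by (simp add: w_def)
  have wr: "w * b r - (\<Sum>t\<in>S. n0 t * b t) \<in> I"
    using 0(3) insert(1,2) by (simp add: w_def algebra_simps)
  have "\<exists>u\<in>U. \<exists>n. (\<forall>t. n t \<in> N) \<and> u * b s - (\<Sum>t\<in>S. n t * b t) \<in> I" if "s \<in> S" for s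
  proof -
    have "s \<in> insert r S" using that by simp
    from insert.prems[OF this] obtain u n where
      u: "u \<in> U" "\<And>t. n t \<in> N" "u * b s - (\<Sum>t\<in>insert r S. n t * b t) \<in> I" by blast
    have "w * (u * b s - (\<Sum>t\<in>insert r S. n t * b t)) + n r * (w * b r - (\<Sum>t\<in>S. n0 t * b t)) \<in> I"
      by (rule ideal.subspace_add[OF I ideal.subspace_scale[OF I u(3)] ideal.subspace_scale[OF I wr]])
    also have "w * (u * b s - (\<Sum>t\<in>insert r S. n t * b t)) + n r * (w * b r - (\<Sum>t\<in>S. n0 t * b t)) =
      (w * u) * b s - (\<Sum>t\<in>S. (w * n t + n r * n0 t) * b t)"
      using insert(1,2) by (simp add: algebra_simps sum.distrib sum_distrib_left)
    finally have "(w * u) * b s - (\<Sum>t\<in>S. (w * n t + n r * n0 t) * b t) \<in> I" .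
    moreover have "w * n t + n r * n0 t \<in> N" for t
      by (rule ideal.subspace_add[OF N ideal.subspace_scale[OF N u(2)] ideal.subspace_scale[OF N 0(2)]])
    ultimately show ?thesis using U(2)[OF w u(1)] by (intro bexI[of _ "w * u"] exI conjI) auto
  qed
  then obtain u where u: "u \<in> U" "\<And>s. s \<in> S \<Longrightarrow> u * b s \<in> I" using insert.IH by blast
  have "u * (w * b r - (\<Sum>t\<in>S. n0 t * b t)) + (\<Sum>t\<in>S. n0 t * (u * b t)) \<in> I"
    by (intro ideal.subspace_add[OF I] ideal.subspace_scale[OF I wr] ideal.subspace_sum[OF I]
        ideal.subspace_scale[OF I u(2)])
  then have "u * w * b r \<in> I" by (simp add: algebra_simps sum_distrib_left)
  moreover have "u * w * b s \<in> I" if "s \<in> S" for s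
    using ideal.subspace_scale[OF I u(2)[OF that], of w] by (simp add: mult_ac)
  ultimately show ?case using U(2)[OF u(1) w] by blast
qed

lemma span_image_explicit:
  assumes "finite S" "f \<in> ideal.span (h ` S)"
  shows "\<exists>g. f = (\<Sum>s\<in>S. g s * h s)"
  using assms(2)
proof (induction rule: ideal.span_induct_alt)
  case base
  show ?case by (rule exI[of _ "\<lambda>_. 0"]) simp
next
  case (step c x y)
  obtain s g where s: "s \<in> S" "x = h s" and g: "y = (\<Sum>s\<in>S. g s * h s)" using step by blast
  have "(\<Sum>t\<in>S. (if t = s then c else 0) * h t) = c * x"
    using s assms(1) by (simp add: if_distrib[of "\<lambda>x. x * _"] cong: if_cong)
  then have "c * x + y = (\<Sum>t\<in>S. ((if t = s then c else 0) + g t) * h t)"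
    by (simp add: g distrib_right sum.distrib)
  then show ?case by (rule exI[of _ "\<lambda>t. (if t = s then c else 0) + g t"])
qed

subsection \<open>Taylor expansion at a point\<close>

lemma taylor_const [simp]: "taylor P (const c) = const c"
  and taylor_var [simp]: "taylor P (var i) = const (P $ i) + var i"
  and taylor_add: "taylor P (f + g) = taylor P f + taylor P g"
  and taylor_diff: "taylor P (f - g) = taylor P f - taylor P g"
  and taylor_mult: "taylor P (f * g) = taylor P f * taylor P g"
  and taylor_sum: "taylor P (sum h A) = (\<Sum>x\<in>A. taylor P (h x))"
  and taylor_0 [simp]: "taylor P 0 = 0"
  and taylor_1 [simp]: "taylor P 1 = 1"
  by (simp_all add: taylor_def cs.subst_simps cs.subst_sum)

lemma mdeg_eq_0: "mdeg u = 0 \<longleftrightarrow> u = 0"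
  by (auto simp: mdeg_def intro: poly_mapping_eqI)

lemma hom_part_0_eq: "hom_part 0 f = const (eval 0 f)"
proof -
  have h: "hom_part 0 f = const (lookup f 0)"
    by (rule poly_mapping_eqI)
      (simp add: lookup_hom_part mdeg_eq_0 const_def lookup_single when_def)
  obtain N where N: "\<And>M. N \<le> M \<Longrightarrow> f = (\<Sum>d\<le>M. hom_part d f)"
    by (rule ex_sum_hom_parts[of f]) blast
  have "eval 0 f = (\<Sum>d\<le>N. eval 0 (hom_part d f))"
    by (subst N[OF order_refl]) (simp add: eval_sum)
  also have "\<dots> = (\<Sum>d\<le>N. if d = 0 then eval 0 (hom_part 0 f) else 0)"
  proof (rule sum.cong)
    fix d
    show "eval 0 (hom_part d f) = (if d = 0 then eval 0 (hom_part 0 f) else 0)"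
      using eval_scale[OF homogeneous_hom_part, of 0 0 d f] by (cases "d = 0") (auto simp: power_0_left)
  qed simp
  also have "\<dots> = lookup f 0" by (simp add: h)
  finally show ?thesis by (simp add: h)
qed

lemma hom_part_0_taylor: "hom_part 0 (taylor P f) = const (eval P f)"
  by (simp add: hom_part_0_eq taylor_def eval_subst)

lemmas homogeneous_var_Suc_0 [simp] = homogeneous_var[unfolded One_nat_def]

locale affine_chart =
  fixes P :: "complex ^ 'v::finite" and j :: 'v
  assumes Pj: "P $ j \<noteq> 0"
begin

text \<open>
  The affine coordinates at \<open>[P]\<close> are the \<open>y i / lam\<close> for \<open>i \<noteq> j\<close>. The map \<open>sig\<close> is the projection from \<open>P\<close>
  to the hyperplane \<open>x\<^sub>j = 0\<close>; its image consists of the polynomials in the \<open>y i\<close>.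
\<close>

definition lam :: "'v cpoly" where "lam = const (1 / P $ j) * var j"

definition y :: "'v \<Rightarrow> 'v cpoly" where "y i = var i - const (P $ i) * lam"

definition sig :: "'v cpoly \<Rightarrow> 'v cpoly" where "sig = poly_subst const y"

lemma eval_lam: "eval v lam = v $ j / P $ j"
  by (simp add: lam_def)

lemma eval_y: "eval v (y i) = v $ i - P $ i * (v $ j / P $ j)"
  by (simp add: y_def eval_lam)

lemma eval_P [simp]: "eval P lam = 1" "eval P (y i) = 0"
  using Pj by (simp_all add: eval_lam eval_y)

lemma homogeneous_lam [simp]: "homogeneous (Suc 0) lam"
  by (simp add: lam_def homogeneous_const_mult)

lemma homogeneous_lam_power [simp]: "homogeneous k (lam ^ k)"
  using homogeneous_power[OF homogeneous_lam, of k] by simp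

lemma homogeneous_y [simp]: "homogeneous (Suc 0) (y i)"
  unfolding y_def by (intro homogeneous_diff homogeneous_const_mult) simp_all

lemma homogeneous_sig: "homogeneous d f \<Longrightarrow> homogeneous d (sig f)"
  unfolding sig_def by (rule homogeneous_subst) simp_all

lemma sig_simps [simp]: "sig (const c) = const c" "sig 0 = 0" "sig 1 = 1" "sig (var i) = y i"
  by (simp_all add: sig_def)

lemma sig_add: "sig (f + g) = sig f + sig g"
  and sig_diff: "sig (f - g) = sig f - sig g"
  and sig_mult: "sig (f * g) = sig f * sig g"
  and sig_sum: "sig (sum h A) = (\<Sum>x\<in>A. sig (h x))"
  by (simp_all add: sig_def cs.subst_simps cs.subst_sum)

lemma y_j [simp]: "y j = 0"
proof -
  have "const (P $ j) * (const (1 / P $ j) * var j) = var j"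
    using Pj by (simp flip: mult.assoc const_mult)
  then show ?thesis by (simp add: y_def lam_def)
qed

lemma sig_lam [simp]: "sig lam = 0"
  by (simp add: lam_def sig_mult)

lemma sig_y [simp]: "sig (y i) = y i"
  by (simp add: y_def sig_diff sig_mult)

lemma sig_sig [simp]: "sig (sig f) = sig f"
  by (induction f rule: cpoly_induct) (simp_all add: sig_add sig_mult)

lemma taylor_lam [simp]: "taylor P lam = 1 + lam"
proof -
  have "const (1 / P $ j) * const (P $ j) = 1" using Pj by (simp flip: const_mult)
  then show ?thesis by (simp add: lam_def taylor_mult distrib_left)
qed

lemma taylor_y [simp]: "taylor P (y i) = y i"
  by (simp add: y_def taylor_diff taylor_mult distrib_left)

lemma taylor_sig [simp]: "taylor P (sig f) = sig f"
  by (induction f rule: cpoly_induct) (simp_all add: sig_add sig_mult taylor_add taylor_mult)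

lemma taylor_lam_power: "hom_part 0 (taylor P (lam ^ k)) = 1"
  by (simp add: hom_part_0_taylor)

lemma diff_sig_mem: "f - sig f \<in> ideal.span {var j}"
proof (induction f rule: cpoly_induct)
  case (var i)
  have "const (P $ i) * const (1 / P $ j) * var j \<in> ideal.span {var j}"
    by (intro ideal.span_scale ideal.span_base) simp
  then show ?case by (simp add: y_def lam_def mult.assoc)
next
  case (add f g)
  from ideal.span_add[OF this] show ?case by (simp add: sig_add algebra_simps)
next
  case (mult f g)
  have "g * (f - sig f) + sig f * (g - sig g) \<in> ideal.span {var j}"
    by (rule ideal.span_add[OF ideal.span_scale[OF mult(1)] ideal.span_scale[OF mult(2)]])
  then show ?case by (simp add: sig_mult algebra_simps)
qed (simp add: ideal.span_zero)

text \<open>Modulo the \<open>y i\<close> each \<open>var i\<close> becomes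
  \<open>const (P $ i) * lam\<close>, so that only the value at \<open>P\<close> and the degree of a
  form remain.\<close>

lemma diff_lam_power_mem:
  assumes "homogeneous k f"
  shows "f - const (eval P f) * lam ^ k \<in> ideal.span (range y)"
proof -
  let ?s = "poly_subst const (\<lambda>i. const (P $ i) * lam)"
  have "f - ?s f \<in> ideal.span (range y)"
  proof (induction f rule: cpoly_induct)
    case (var i)
    have "y i \<in> ideal.span (range y)" by (simp add: ideal.span_base)
    then show ?case by (simp add: y_def)
  next
    case (add f g)
    from ideal.span_add[OF this] show ?case by (simp add: cs.subst_add algebra_simps)
  next
    case (mult f g)
    have "g * (f - ?s f) + ?s f * (g - ?s g) \<in> ideal.span (range y)"
      by (rule ideal.span_add[OF ideal.span_scale[OF mult(1)] ideal.span_scale[OF mult(2)]])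
    then show ?case by (simp add: cs.subst_mult algebra_simps)
  qed (simp add: ideal.span_zero)
  moreover have "?s f = const (eval P f) * lam ^ k"
  proof -
    have *: "const a * (\<Prod>i\<in>UNIV. (const (P $ i) * lam) ^ lookup u i) =
      const (a * (\<Prod>i\<in>UNIV. (P $ i) ^ lookup u i)) * lam ^ k"
      if "u \<in> keys f" for a u
    proof -
      have "k = mdeg u" using that assms by (simp add: homogeneous_def)
      moreover have "const (\<Prod>i\<in>UNIV. (P $ i) ^ lookup u i) =
        ((\<Prod>i\<in>UNIV. const (P $ i) ^ lookup u i) :: 'v cpoly)"
      proof -
        have pw: "const (c ^ n) = (const c :: 'v cpoly) ^ n" for c n
          by (induction n) (simp_all add: const_mult)
        have "const (\<Prod>i\<in>A. (P $ i) ^ lookup u i) =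
          ((\<Prod>i\<in>A. const (P $ i) ^ lookup u i) :: 'v cpoly)" for A
          by (induction A rule: infinite_finite_induct) (simp_all add: const_mult pw)
        then show ?thesis .
      qed
      ultimately show ?thesis
        by (simp add: const_mult mdeg_def power_sum power_mult_distrib prod.distrib mult.assoc)
    qed
    show ?thesis
      unfolding eval_def poly_subst_def const_sum sum_distrib_right by (intro sum.cong refl *)
  qed
  ultimately show ?thesis by simp
qed

section \<open>Powers of the ideal of the point and their leading forms\<close>

definition ymon :: "('v \<Rightarrow>\<^sub>0 nat) \<Rightarrow> 'v cpoly" where "ymon u = sig (single u 1)"

text \<open>The \<open>e\<close>-th power of the homogeneous ideal of the point
  \<open>[P]\<close>.\<close>

definition ypow :: "nat \<Rightarrow> 'v cpoly set" where "ypow e = ideal.span (ymon ` {u. mdeg u = e})"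

lemma ymon_single: "ymon (single i 1 + u) = y i * ymon u"
proof -
  have "single (single i 1 + u) 1 = var i * single u 1"
    by (simp add: var_def mult_single)
  then show ?thesis by (simp add: ymon_def sig_mult)
qed

lemma homogeneous_ymon: "mdeg u = e \<Longrightarrow> homogeneous e (ymon u)"
  unfolding ymon_def using homogeneous_single by (intro homogeneous_sig) blast

lemma taylor_ymon [simp]: "taylor P (ymon u) = ymon u"
  by (simp add: ymon_def)

lemma mult_ymon_mem:
  assumes "h \<in> ideal.span (range y)" "mdeg u = e"
  shows "h * ymon u \<in> ypow (Suc e)"
  using assms(1)
proof (induction rule: ideal.span_induct_alt)
  case base
  show ?case by (simp add: ypow_def ideal.span_zero)
next
  case (step c x z)
  then obtain i where i: "x = y i" by blast
  have "ymon (single i 1 + u) \<in> ypow (Suc e)"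
    unfolding ypow_def by (rule ideal.span_base) (use assms(2) in \<open>auto simp: mdeg_add\<close>)
  then have "c * (x * ymon u) + z * ymon u \<in> ypow (Suc e)"
    using step(2) unfolding i ymon_single ypow_def by (metis ideal.span_add ideal.span_scale)
  then show ?case by (simp add: algebra_simps)
qed

lemma ypow_vanishes:
  assumes "f \<in> ypow e"
  shows "vanishes_to e (taylor P f)"
  using assms unfolding ypow_def
proof (induction rule: ideal.span_induct_alt)
  case (step c x z)
  then obtain u where u: "mdeg u = e" "x = ymon u" by blast
  have "vanishes_to (0 + e) (taylor P c * taylor P x)"
    using u by (intro vanishes_to_mult) (auto simp: homogeneous_ymon intro: vanishes_to_homogeneous)
  then show ?case using step by (simp add: taylor_add taylor_mult vanishes_to_add)
qed simp

text \<open>The Taylor expansion of \<open>lam\<close> has constant term 1. Powers of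
  \<open>lam\<close> thus adjust degrees without changing orders or leading forms.\<close>

lemma hom_part_taylor_lam_mult:
  assumes "homogeneous e a"
  shows "vanishes_to e (taylor P (lam ^ k * sig a))" "hom_part e (taylor P (lam ^ k * sig a)) = sig a"
  using vanishes_to_mult[of 0 "taylor P (lam ^ k)" e "sig a"] homogeneous_sig[OF assms]
  by (simp_all add: taylor_mult vanishes_to_homogeneous taylor_lam_power hom_part_homogeneous)

text \<open>In an expression of \<open>f\<close> through monomials in the \<open>y i\<close> the
  coefficients are forms of degree \<open>k - e\<close>. Replacing each by its value at
  \<open>P\<close> times \<open>lam ^ (k - e)\<close> changes \<open>f\<close> by an element of the
  next power.\<close>

lemma ypow_leading_form:
  assumes f: "homogeneous k f" "f \<in> ypow e" "e \<le> k"
  shows "\<exists>a. homogeneous e a \<and> hom_part e (taylor P f) = sig a \<and> f - lam ^ (k - e) * sig a \<in> ypow (Suc e)"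
proof -
  let ?U = "{u :: 'v \<Rightarrow>\<^sub>0 nat. mdeg u = e}"
  obtain g' where g': "f = (\<Sum>u\<in>?U. g' u * ymon u)"
    using f(2) span_image_explicit[OF finite_mdeg] unfolding ypow_def by blast
  define g where "g u = hom_part (k - e) (g' u)" for u
  have "hom_part k f = (\<Sum>u\<in>?U. g u * ymon u)"
    unfolding g' hom_part_sum
  proof (rule sum.cong)
    fix u assume "u \<in> ?U"
    then have "homogeneous e (ymon u)" by (simp add: homogeneous_ymon)
    from hom_part_homogeneous_mult[OF this, of k "g' u"] f(3)
    show "hom_part k (g' u * ymon u) = g u * ymon u" by (simp add: g_def mult.commute)
  qed simp
  then have g: "f = (\<Sum>u\<in>?U. g u * ymon u)" using f(1) by (simp add: hom_part_homogeneous)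
  define a where "a = (\<Sum>u\<in>?U. const (eval P (g u)) * single u 1)"
  have a: "homogeneous e a"
    unfolding a_def using homogeneous_single by (intro homogeneous_sum homogeneous_const_mult) auto
  have "f - lam ^ (k - e) * sig a = (\<Sum>u\<in>?U. (g u - const (eval P (g u)) * lam ^ (k - e)) * ymon u)"
    by (subst g) (simp add: a_def sig_sum sig_mult ymon_def algebra_simps sum_subtractf sum_distrib_left)
  also have "\<dots> \<in> ypow (Suc e)"
    unfolding ypow_def
    by (intro ideal.span_sum mult_ymon_mem[unfolded ypow_def] diff_lam_power_mem) (auto simp: g_def)
  finally have r: "f - lam ^ (k - e) * sig a \<in> ypow (Suc e)" .
  have "hom_part e (taylor P (f - lam ^ (k - e) * sig a)) = 0"
    using ypow_vanishes[OF r] by (simp add: vanishes_to_def)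
  then have "hom_part e (taylor P f) = sig a"
    using hom_part_taylor_lam_mult[OF a] by (simp add: taylor_diff hom_part_diff)
  then show ?thesis using a r by blast
qed

lemma hom_part_ypow:
  assumes "f \<in> ypow e" "k < e"
  shows "hom_part k f = 0"
proof -
  obtain g where "f = (\<Sum>u\<in>{u. mdeg u = e}. g u * ymon u)"
    using assms(1) span_image_explicit[OF finite_mdeg] unfolding ypow_def by blast
  moreover have "hom_part k (g u * ymon u) = 0" if "mdeg u = e" for u
    using hom_part_homogeneous_mult[OF homogeneous_ymon[OF that], of k "g u"] assms(2) by (simp add: mult.commute)
  ultimately show ?thesis by (simp add: hom_part_sum)
qed

text \<open>As long as the leading form vanishes, \<open>ypow_leading_form\<close> moves
  \<open>f\<close> into the next power. Once the order exceeds the degree \<open>k\<close>, only 0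
  is left.\<close>

lemma ypow_of_vanishes:
  assumes "homogeneous k f" "vanishes_to e (taylor P f)"
  shows "f \<in> ypow e"
  using assms(2)
proof (induction e)
  case 0
  have "ymon 0 = 1" by (simp add: ymon_def)
  then have "1 \<in> ypow 0" unfolding ypow_def by (intro ideal.span_base) force
  then show ?case using ideal.span_scale[of 1 _ f] by (simp add: ypow_def)
next
  case (Suc e)
  then have fe: "f \<in> ypow e" "hom_part e (taylor P f) = 0" by (auto simp: vanishes_to_Suc)
  show ?case
  proof (cases "e \<le> k")
    case True
    from ypow_leading_form[OF assms(1) fe(1) True] fe(2) show ?thesis by auto
  next
    case False
    then have "hom_part k f = 0" by (intro hom_part_ypow[OF fe(1)]) simp
    then show ?thesis using assms(1) by (simp add: hom_part_homogeneous ypow_def ideal.span_zero)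
  qed
qed

text \<open>A leading form depends on the affine coordinates only, so it is constant along the
  direction of \<open>P\<close> and is known from its values where the coordinate \<open>j\<close>
  is 0.\<close>

lemma vanishes_leading_form:
  assumes "homogeneous k f" "vanishes_to e (taylor P f)"
  obtains a where "homogeneous e a" "hom_part e (taylor P f) = sig a"
proof (cases "e \<le> k")
  case True
  then show ?thesis
    using ypow_leading_form[OF assms(1) ypow_of_vanishes[OF assms] True] that by blast
next
  case False
  then have "hom_part k f = 0" by (intro hom_part_ypow[OF ypow_of_vanishes[OF assms]]) simp
  then have "f = 0" using assms(1) by (simp add: hom_part_homogeneous)
  then show ?thesis by (intro that[of 0]) auto
qed

lemma sig_leading_form:
  assumes "homogeneous k f" "vanishes_to e (taylor P f)"
  shows "sig (hom_part e (taylor P f)) = hom_part e (taylor P f)"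
  by (rule vanishes_leading_form[OF assms]) simp

end


subsection \<open>Lengths\<close>

lemma const_eq_0_iff [simp]: "const c = 0 \<longleftrightarrow> c = 0"
  by (metis const_0 eval_0 eval_const)

interpretation fv: vector_space "\<lambda>c (x :: 'v::{finite,linorder} cpoly fract). Fract (const c) 1 * x"
proof unfold_locales
  fix a b :: complex and x y :: "'v cpoly fract"
  have h: "Fract (const (a + b) :: 'v cpoly) 1 = Fract (const a) 1 + Fract (const b) 1"
    by (simp add: const_add)
  show "Fract (const (a + b)) 1 * x = Fract (const a) 1 * x + Fract (const b) 1 * x"
    unfolding h by (rule distrib_right)
  have "Fract (const (a * b) :: 'v cpoly) 1 = Fract (const a) 1 * Fract (const b) 1"
    by (simp add: const_mult)
  then show "Fract (const a) 1 * (Fract (const b) 1 * x) = Fract (const (a * b)) 1 * x"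
    by (simp only: mult.assoc)
qed (simp_all add: distrib_left flip: One_fract_def)

lemma quotient_dim_ge:
  assumes "finite I" "\<And>i. i \<in> I \<Longrightarrow> g i \<in> V" "0 \<in> W"
    and indep: "\<And>c. (\<Sum>i\<in>I. Fract (const (c i)) 1 * g i) \<in> W \<Longrightarrow> \<forall>i\<in>I. c i = 0"
  shows "enat (card I) \<le> quotient_dim V W"
proof -
  have inj: "inj_on g I"
  proof (rule inj_onI, rule ccontr)
    fix i k assume ik: "i \<in> I" "k \<in> I" "g i = g k" "i \<noteq> k"
    \<comment> \<open>If two indices had the same value of \<open>g\<close>, the difference of their
      indicator functions would be a nontrivial relation.\<close>
    define c :: "'a \<Rightarrow> complex" where "c l = (if l = i then 1 else 0) - (if l = k then 1 else 0)" for l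
    have "(\<Sum>l\<in>I. Fract (const (c l)) 1 * g l) = (\<Sum>l\<in>I. (if l = i then g l else 0) - (if l = k then g l else 0))"
      by (intro sum.cong refl) (auto simp: c_def const_uminus One_fract_def[symmetric] minus_fract[symmetric] fract_collapse simp del: minus_fract)
    also have "\<dots> = 0" using assms(1) ik by (simp add: sum_subtractf)
    finally have "\<forall>l\<in>I. c l = 0" using assms(3) by (intro indep) simp
    then show False using ik by (auto simp: c_def)
  qed
  have "card I = card (g ` I)" using inj by (simp add: card_image)
  moreover have "enat (card (g ` I)) \<le> quotient_dim V W"
    unfolding quotient_dim_def
  proof (rule Sup_upper, intro CollectI exI conjI allI impI ballI)
    fix c b assume c: "(\<Sum>b\<in>g ` I. Fract (const (c b)) 1 * b) \<in> W" and b: "b \<in> g ` I"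
    have "\<forall>i\<in>I. (c \<circ> g) i = 0"
      using c by (intro indep) (simp add: sum.reindex[OF inj])
    then show "c b = 0" using b by auto
  qed (use assms in auto)
  ultimately show ?thesis by simp
qed

lemma quotient_dim_le:
  assumes W: "fv.subspace W" and "finite K"
    and span: "\<And>x. x \<in> V \<Longrightarrow> \<exists>a. x - (\<Sum>k\<in>K. Fract (const (a k)) 1 * h k) \<in> W"
  shows "quotient_dim V W \<le> enat (card K)"
  unfolding quotient_dim_def
proof (rule Sup_least, clarify)
  fix B assume B: "finite B" "B \<subseteq> V"
    "\<forall>c. (\<Sum>b\<in>B. Fract (const (c b)) 1 * b) \<in> W \<longrightarrow> (\<forall>b\<in>B. c b = 0)"
  have "card B \<le> card K"
    by (rule fv.card_le_of_independent_modulo[OF W assms(2) B(1), where g = "\<lambda>b. b" and h = h])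
      (use B span in auto)
  then show "enat (card B) \<le> enat (card K)" by simp
qed

lemma eval_nonzero: "eval P g \<noteq> 0 \<Longrightarrow> g \<noteq> 0"
  by auto

lemma stalkI:
  "f \<in> X \<Longrightarrow> homogeneous d f \<Longrightarrow> homogeneous d g \<Longrightarrow> eval P g \<noteq> 0 \<Longrightarrow> Fract f g \<in> stalk P X"
  unfolding stalk_def by blast

lemma sum_fract: "g \<noteq> 0 \<Longrightarrow> (\<Sum>i\<in>I. Fract (f i) g) = Fract (\<Sum>i\<in>I. f i) g"
proof (induction I rule: infinite_finite_induct)
  case (insert i I)
  then show ?case by (simp add: eq_fract algebra_simps)
qed (simp_all add: fract_collapse)

lemma subspace_stalk:
  assumes X: "ideal.subspace X" and P: "P \<noteq> 0"
  shows "fv.subspace (stalk P X)"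
proof (rule fv.subspaceI)
  have "Fract 0 1 \<in> stalk P X"
    by (rule stalkI[of _ _ 0]) (simp_all add: ideal.subspace_0[OF X])
  then show "0 \<in> stalk P X" by (simp add: fract_collapse)
next
  fix x y assume "x \<in> stalk P X" "y \<in> stalk P X"
  then obtain f g d f' g' d' where
    x: "x = Fract f g" "f \<in> X" "homogeneous d f" "homogeneous d g" "eval P g \<noteq> 0" and
    y: "y = Fract f' g'" "f' \<in> X" "homogeneous d' f'" "homogeneous d' g'" "eval P g' \<noteq> 0"
    unfolding stalk_def by blast
  have "x + y = Fract (f * g' + f' * g) (g * g')"
    using x(1) y(1) eval_nonzero[OF x(5)] eval_nonzero[OF y(5)] by simp
  also have "\<dots> \<in> stalk P X"
  proof (rule stalkI)
    have "g' * f + g * f' \<in> X" using X x y by (intro ideal.subspace_add ideal.subspace_scale)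
    then show "f * g' + f' * g \<in> X" by (simp add: mult.commute)
    show "homogeneous (d + d') (f * g' + f' * g)"
      using homogeneous_mult[OF x(3) y(4)] homogeneous_mult[OF y(3) x(4)] by (intro homogeneous_add) (simp_all add: add.commute)
  qed (use x y homogeneous_mult in auto)
  finally show "x + y \<in> stalk P X" .
next
  fix c x assume "x \<in> stalk P X"
  then obtain f g d where
    x: "x = Fract f g" "f \<in> X" "homogeneous d f" "homogeneous d g" "eval P g \<noteq> 0"
    unfolding stalk_def by blast
  have "Fract (const c * f) g \<in> stalk P X"
    by (rule stalkI[of _ _ d]) (use x X ideal.subspace_scale homogeneous_const_mult in auto)
  then show "Fract (const c) 1 * x \<in> stalk P X" by (simp add: x)
qed

subsection \<open>Restriction to lines\<close>

text \<open>A polynomial with nonzero constant term is a unit among power series and does not affect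
  the order.\<close>

lemma coeff_mult_low:
  fixes p q :: "complex poly"
  assumes "\<And>e. e < ord \<Longrightarrow> coeff (p * q) e = 0" "coeff q 0 \<noteq> 0"
  shows "e < ord \<Longrightarrow> coeff p e = 0"
proof (induction e rule: less_induct)
  case (less e)
  have "coeff (p * q) e = (\<Sum>i\<le>e. if i = e then coeff p i * coeff q (e - i) else 0)"
    unfolding coeff_mult by (rule sum.cong) (use less in auto)
  then have "coeff p e * coeff q 0 = 0" using assms(1)[OF less.prems] by simp
  then show ?case using assms(2) by simp
qed

lemma coeff_mult_low_zero:
  fixes p q :: "complex poly"
  assumes "\<And>e. e < ord \<Longrightarrow> coeff p e = 0" "e < ord"
  shows "coeff (q * p) e = 0"
  unfolding coeff_mult by (rule sum.neutral) (use assms in auto)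

text \<open>The \<open>c i\<close> are the first coefficients of the power series
  \<open>f / g\<close>, determined one after the other.\<close>

lemma ex_division_low:
  fixes f g :: "complex poly"
  assumes "coeff g 0 \<noteq> 0"
  shows "\<exists>c. \<forall>e<ord. coeff (f - g * (\<Sum>i<ord. monom (c i) i)) e = 0"
proof (induction ord)
  case (Suc ord)
  then obtain c where c: "\<And>e. e < ord \<Longrightarrow> coeff (f - g * (\<Sum>i<ord. monom (c i) i)) e = 0" by blast
  let ?r = "f - g * (\<Sum>i<ord. monom (c i) i)"
  define b where "b = coeff ?r ord / coeff g 0"
  have "(\<Sum>i<Suc ord. monom ((c(ord := b)) i) i) = (\<Sum>i<ord. monom (c i) i) + monom b ord" by simp
  then have eq: "f - g * (\<Sum>i<Suc ord. monom ((c(ord := b)) i) i) = ?r - g * monom b ord"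
    by (simp only: distrib_left diff_diff_eq)
  have "coeff (?r - g * monom b ord) e = 0" if "e < Suc ord" for e
  proof (cases "e = ord")
    case True
    have "coeff (monom b ord * g) ord = b * coeff g 0"
      by (simp add: coeff_monom_mult)
    then show ?thesis using True assms by (simp add: b_def mult.commute)
  next
    case False
    have "coeff (monom b ord * g) e = 0" using False that by (simp add: coeff_monom_mult)
    then show ?thesis using c[of e] False that by (simp add: mult.commute)
  qed
  then show ?case unfolding eq[symmetric] by blast
qed simp

lemma low_coeffs_zero_factor:
  fixes p :: "complex poly"
  assumes "\<And>e. e < ord \<Longrightarrow> coeff p e = 0"
  obtains q where "p = monom 1 ord * q"
  using assms monom_1_dvd_iff' by (metis dvdE)

lemma span_pair: "vec.span {v, P} = {a *s P + b *s v | a b. True}"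
proof
  show "vec.span {v, P} \<subseteq> {a *s P + b *s v | a b. True}"
  proof
    fix z assume "z \<in> vec.span {v, P}"
    then obtain b where "z - b *s v \<in> vec.span {P}" unfolding vec.span_breakdown_eq by blast
    then obtain a where "z - b *s v = a *s P" unfolding vec.span_singleton by blast
    then have "z = a *s P + b *s v" by (simp add: algebra_simps)
    then show "z \<in> {a *s P + b *s v | a b. True}" by blast
  qed
  show "{a *s P + b *s v | a b. True} \<subseteq> vec.span {v, P}"
    using vec.span_add[OF vec.span_scale[OF vec.span_base] vec.span_scale[OF vec.span_base], of P "{v, P}" v]
    by auto
qed

context affine_chart
begin

definition line_poly :: "complex ^ 'v \<Rightarrow> 'v cpoly \<Rightarrow> complex poly"
  where "line_poly v = poly_subst (\<lambda>c. [:c:]) (\<lambda>i. [:P $ i, v $ i:])"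

lemma line_poly_simps [simp]:
  "line_poly v (const c) = [:c:]" "line_poly v 0 = 0" "line_poly v 1 = 1"
  "line_poly v (var i) = [:P $ i, v $ i:]"
  by (simp_all add: line_poly_def)

lemma line_poly_add: "line_poly v (f + g) = line_poly v f + line_poly v g"
  and line_poly_diff: "line_poly v (f - g) = line_poly v f - line_poly v g"
  and line_poly_mult: "line_poly v (f * g) = line_poly v f * line_poly v g"
  and line_poly_power: "line_poly v (f ^ k) = line_poly v f ^ k"
  and line_poly_sum: "line_poly v (sum h A) = (\<Sum>x\<in>A. line_poly v (h x))"
  by (simp_all add: line_poly_def up.subst_simps up.subst_sum)

lemma poly_line_poly: "poly (line_poly v f) t = eval (P + t *s v) f"
  by (induction f rule: cpoly_induct) (simp_all add: line_poly_add line_poly_mult)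

lemma line_poly_0: "coeff (line_poly v f) 0 = eval P f"
  using poly_line_poly[of v f 0] by (simp add: poly_0_coeff_0)

text \<open>Substituting \<open>t * v\<close> into the Taylor expansion multiplies the value at
  \<open>v\<close> of its part of degree \<open>e\<close> by \<open>t ^ e\<close>. This turns orders
  on lines into statements about leading forms.\<close>

lemma coeff_line_poly: "coeff (line_poly v f) e = eval v (hom_part e (taylor P f))"
proof -
  let ?s = "poly_subst (\<lambda>c. [:c:]) (\<lambda>i. [:0, v $ i:])"
  have s: "?s g = monom (eval v g) d" if "homogeneous d g" for g d
  proof -
    have *: "[:a:] * (\<Prod>i\<in>UNIV. [:0, v $ i:] ^ lookup u i) =
      monom (a * (\<Prod>i\<in>UNIV. (v $ i) ^ lookup u i)) d" if "u \<in> keys g" for u a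
    proof -
      have pw: "[:0, c:] ^ k = monom (c ^ k) k" for c :: complex and k
        by (induction k) (simp_all add: monom_0 one_pCons smult_monom monom_Suc)
      have "(\<Prod>i\<in>A. monom (z i) (k i)) = monom (prod z A) (sum k A)" for A and z :: "'v \<Rightarrow> complex" and k
        by (induction A rule: infinite_finite_induct) (simp_all add: mult_monom)
      moreover have "(\<Sum>i\<in>UNIV. lookup u i) = d"
        using that \<open>homogeneous d g\<close> by (simp add: homogeneous_def mdeg_def)
      ultimately show ?thesis by (simp add: pw smult_monom)
    qed
    have mon: "(\<Sum>x\<in>A. monom (z x) d) = monom (sum z A) d" for A and z :: "('v \<Rightarrow>\<^sub>0 nat) \<Rightarrow> complex"
      by (induction A rule: infinite_finite_induct) (simp_all add: add_monom)
    show ?thesis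
      unfolding eval_def poly_subst_def mon[symmetric] by (intro sum.cong refl *)
  qed
  have "line_poly v f = ?s (taylor P f)"
    by (simp add: line_poly_def taylor_def up.subst_subst up.subst_add)
  moreover obtain N where N: "\<And>M. N \<le> M \<Longrightarrow> taylor P f = (\<Sum>d\<le>M. hom_part d (taylor P f))"
    by (rule ex_sum_hom_parts[of "taylor P f"]) blast
  have "?s (taylor P f) = (\<Sum>d\<le>N + e. monom (eval v (hom_part d (taylor P f))) d)"
    by (subst N[of "N + e"]) (simp_all add: up.subst_sum s[OF homogeneous_hom_part])
  ultimately show ?thesis by (simp add: coeff_sum)
qed

lemma ex_line_direction:
  assumes "line_through P L"
  obtains v where "v \<noteq> 0" "v $ j = 0" "L = {a *s P + b *s v | a b. True}"
proof -
  have L: "vec.subspace L" "vec.dim L = 2" "P \<in> L" using assms by (auto simp: line_through_def)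
  have P0: "P \<noteq> 0" using Pj by auto
  have "\<not> L \<subseteq> vec.span {P}"
  proof
    assume "L \<subseteq> vec.span {P}"
    then have "vec.dim L \<le> card {P}" by (intro vec.dim_le_card) auto
    then show False using L(2) by simp
  qed
  then obtain w where w: "w \<in> L" "w \<notin> vec.span {P}" by blast
  \<comment> \<open>Subtracting a multiple of \<open>P\<close> normalizes the direction to the
    hyperplane where the coordinate \<open>j\<close> is 0.\<close>
  define v where "v = w - (w $ j / P $ j) *s P"
  have "v \<notin> vec.span {P}"
  proof
    assume "v \<in> vec.span {P}"
    then have "v + (w $ j / P $ j) *s P \<in> vec.span {P}"
      by (rule vec.span_add[OF _ vec.span_scale[OF vec.span_base]]) simp
    then show False using w(2) by (simp add: v_def)
  qed
  then have "v \<noteq> 0" "v \<noteq> P" using vec.span_zero vec.span_base[of P "{P}"] by auto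
  have indep: "vec.independent {v, P}"
    using vec.independent_insertI[OF \<open>v \<notin> vec.span {P}\<close>] P0 by simp
  have "v \<in> L" unfolding v_def using L w by (intro vec.subspace_diff vec.subspace_scale)
  then have "L \<subseteq> vec.span {v, P}"
    using L indep \<open>v \<noteq> P\<close> by (intro vec.card_ge_dim_independent) auto
  moreover have "vec.span {v, P} \<subseteq> L" using \<open>v \<in> L\<close> L by (intro vec.span_minimal) auto
  ultimately have "L = {a *s P + b *s v | a b. True}" by (simp add: span_pair)
  moreover have "v $ j = 0" using Pj by (simp add: v_def)
  ultimately show thesis using that \<open>v \<noteq> 0\<close> by blast
qed

lemma ex_line_through:
  assumes "v \<noteq> 0" "v $ j = 0"
  shows "line_through P {a *s P + b *s v | a b. True}" (is "line_through P ?L")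
proof -
  have P0: "P \<noteq> 0" using Pj by auto
  have "v \<notin> vec.span {P}"
  proof
    assume "v \<in> vec.span {P}"
    then obtain a where a: "v = a *s P" unfolding vec.span_singleton by blast
    then have "a = 0" using assms(2) Pj by simp
    then show False using a assms(1) by simp
  qed
  then have indep: "vec.independent {v, P}" "v \<noteq> P"
    using vec.independent_insertI[OF \<open>v \<notin> vec.span {P}\<close>] P0 vec.span_base[of P "{P}"] by auto
  have "?L = vec.span {v, P}" by (simp add: span_pair)
  then show ?thesis
    using indep vec.dim_span_eq_card_independent[OF indep(1)] vec.span_base[of P "{v, P}"]
    by (simp add: line_through_def)
qed

lemma vanishing_on_line:
  assumes q: "homogeneous d q" "line_poly v q = 0"
  shows "q \<in> vanishing_ideal {a *s P + b *s v | a b. True}"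
proof -
  have nz: "eval (a *s P + b *s v) q = 0" if "a \<noteq> 0" for a b
  proof -
    have e: "a *s P + b *s v = a *s (P + (b / a) *s v)"
      using that by (simp add: vec_eq_iff distrib_left)
    have "eval (P + (b / a) *s v) q = 0" using poly_line_poly[of v q "b / a"] q(2) by simp
    then show ?thesis unfolding e eval_scale[OF q(1)] by simp
  qed
  have "eval (0 *s P + b *s v) q = 0" for b
  proof -
    \<comment> \<open>The points \<open>b *s v\<close> are missed by the parametrization
      \<open>P + t *s v\<close>. Along \<open>a *s P + b *s v\<close> the polynomial vanishes for
      all nonzero \<open>a\<close>, hence also at \<open>a = 0\<close>.\<close>
    define r where "r = poly_subst (\<lambda>c. [:c:]) (\<lambda>i. [:b * v $ i, P $ i:]) q"
    have r: "poly r a = eval (a *s P + b *s v) q" for a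
      unfolding r_def
      by (induction q rule: cpoly_induct) (simp_all add: up.subst_add up.subst_mult add.commute)
    have "r = 0"
    proof (rule ccontr)
      assume "r \<noteq> 0"
      then have "finite {a. poly r a = 0}" by (rule poly_roots_finite)
      moreover have "UNIV - {0} \<subseteq> {a. poly r a = 0}" using r nz by auto
      ultimately have "finite (UNIV - {0 :: complex})" by (rule finite_subset[rotated])
      then show False using infinite_UNIV_char_0[where 'a = complex] by (simp add: finite_Diff_insert)
    qed
    then show ?thesis using r[of 0] by simp
  qed
  then have "eval (a *s P + b *s v) q = 0" for a b
    using nz by (cases "a = 0") simp_all
  then show ?thesis by (auto simp: vanishing_ideal_def)
qed

text \<open>On the line through \<open>P\<close> and \<open>v\<close>, \<open>lam\<close> and \<open>ell\<close> are dual to \<open>P\<close> and \<open>v\<close>, where \<open>v\<^sub>k \<noteq> 0\<close>.\<close>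

definition ell :: "complex ^ 'v \<Rightarrow> 'v \<Rightarrow> 'v cpoly" where "ell v k = const (1 / v $ k) * y k"

text \<open>Homogenization of \<open>p\<close> in the two linear forms; it restricts to
  \<open>p\<close> on the line and is a form of degree \<open>E\<close> once \<open>E\<close> is at
  least the degree of \<open>p\<close>.\<close>

definition lift_poly :: "complex ^ 'v \<Rightarrow> 'v \<Rightarrow> complex poly \<Rightarrow> nat \<Rightarrow> 'v cpoly"
  where "lift_poly v k p E = (\<Sum>i\<le>degree p. const (coeff p i) * ell v k ^ i * lam ^ (E - i))"

lemma line_poly_lam: "v $ j = 0 \<Longrightarrow> line_poly v lam = 1"
  using Pj by (simp add: lam_def line_poly_mult one_pCons)

lemma line_poly_ell: "v $ j = 0 \<Longrightarrow> v $ k \<noteq> 0 \<Longrightarrow> line_poly v (ell v k) = [:0, 1:]"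
  by (simp add: ell_def y_def line_poly_mult line_poly_diff line_poly_lam)

lemma homogeneous_ell_lam: "homogeneous (i + l) (ell v k ^ i * lam ^ l)"
proof -
  have "homogeneous (Suc 0) (ell v k)" by (simp add: ell_def homogeneous_const_mult)
  from homogeneous_mult[OF homogeneous_power[OF this, of i] homogeneous_lam_power[of l]]
  show ?thesis by simp
qed

lemma line_poly_ell_power: "v $ j = 0 \<Longrightarrow> v $ k \<noteq> 0 \<Longrightarrow> line_poly v (const c * ell v k ^ i * lam ^ l) = monom c i"
  by (simp add: line_poly_mult line_poly_power line_poly_ell line_poly_lam monom_altdef)

lemma line_poly_lift: "v $ j = 0 \<Longrightarrow> v $ k \<noteq> 0 \<Longrightarrow> line_poly v (lift_poly v k p E) = p"
  by (simp add: lift_poly_def line_poly_sum line_poly_ell_power poly_as_sum_of_monoms)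

lemma homogeneous_lift: "degree p \<le> E \<Longrightarrow> homogeneous E (lift_poly v k p E)"
  unfolding lift_poly_def mult.assoc
proof (intro homogeneous_sum homogeneous_const_mult)
  fix i assume "degree p \<le> E" "i \<in> {..degree p}"
  then show "homogeneous E (ell v k ^ i * lam ^ (E - i))"
    using homogeneous_ell_lam[of i "E - i" v k] by simp
qed

end

locale projective_chart = affine_chart P j for P :: "complex ^ 'v::{finite,linorder}" and j :: 'v
begin

lemma P_nonzero: "P \<noteq> 0"
  using Pj by auto

lemma lam_nonzero [simp]: "lam \<noteq> 0"
  by (rule eval_nonzero[of P]) simp

context
  fixes v :: "(complex, 'v) vec" and k :: 'v and X :: "'v cpoly set"
  assumes v: "v $ j = 0" "v $ k \<noteq> 0" and X: "homogeneous_ideal X"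
begin

abbreviation "line \<equiv> {a *s P + b *s v | a b. True}"

text \<open>Polynomials vanishing on the line restrict to 0 and \<open>lam\<close> restricts to 1,
  so neither the sum of the ideals nor the saturation lowers the order.\<close>

lemma line_poly_inter:
  assumes low: "\<And>f e. f \<in> X \<Longrightarrow> e < ord \<Longrightarrow> coeff (line_poly v f) e = 0"
    and f: "f \<in> scheme_inter X (vanishing_ideal line)" and e: "e < ord"
  shows "coeff (line_poly v f) e = 0"
proof -
  obtain s where "\<And>g. homogeneous s g \<Longrightarrow> g * f \<in> ideal.span (X \<union> vanishing_ideal line)"
    using f by (auto simp: scheme_inter_def scheme_of_def saturation_def)
  then have "lam ^ s * f \<in> ideal.span (X \<union> vanishing_ideal line)" by simp
  moreover have "\<forall>e<ord. coeff (line_poly v g) e = 0" if "g \<in> ideal.span (X \<union> vanishing_ideal line)" for g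
    using that
  proof (induction rule: ideal.span_induct_alt)
    case (step c x z)
    have "\<forall>e<ord. coeff (line_poly v x) e = 0"
    proof (cases "x \<in> X")
      case False
      then have "poly (line_poly v x) t = 0" for t
      proof -
        have "1 *s P + t *s v \<in> line" by blast
        then show ?thesis using False step(1) by (auto simp: vanishing_ideal_def poly_line_poly)
      qed
      then have "line_poly v x = 0" by (simp flip: poly_all_0_iff_0)
      then show ?thesis by simp
    qed (use low in simp)
    then show ?case using step(2) coeff_mult_low_zero[of ord "line_poly v x"]
      by (simp add: line_poly_add line_poly_mult)
  qed simp
  ultimately have "\<forall>e<ord. coeff (line_poly v (lam ^ s * f)) e = 0" by blast
  then show ?thesis using e by (simp add: line_poly_mult line_poly_power line_poly_lam v)
qed

lemma sum_ell_fract: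
  "(\<Sum>i<ord. Fract (const (c i)) 1 * Fract (ell v k ^ i) (lam ^ i)) =
    Fract (\<Sum>i<ord. const (c i) * ell v k ^ i * lam ^ (ord - i)) (lam ^ ord)"
proof -
  have "Fract (const (c i)) 1 * Fract (ell v k ^ i) (lam ^ i) =
    Fract (const (c i) * ell v k ^ i * lam ^ (ord - i)) (lam ^ ord)" if "i < ord" for i
  proof -
    have "lam ^ ord = lam ^ (ord - i) * lam ^ i" using that by (simp flip: power_add)
    then show ?thesis by (simp add: eq_fract mult_ac)
  qed
  then have "(\<Sum>i<ord. Fract (const (c i)) 1 * Fract (ell v k ^ i) (lam ^ i)) =
    (\<Sum>i<ord. Fract (const (c i) * ell v k ^ i * lam ^ (ord - i)) (lam ^ ord))"
    by (intro sum.cong) auto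
  then show ?thesis by (simp add: sum_fract)
qed

lemma homogeneous_sum_ell: "homogeneous ord (\<Sum>i<ord. const (c i) * ell v k ^ i * lam ^ (ord - i))"
  unfolding mult.assoc
proof (intro homogeneous_sum homogeneous_const_mult)
  fix i assume "i \<in> {..<ord}"
  then show "homogeneous ord (ell v k ^ i * lam ^ (ord - i))"
    using homogeneous_ell_lam[of i "ord - i" v k] by simp
qed

text \<open>The quotient of \<open>ell v k\<close> by \<open>lam\<close> is a local parameter of the
  line at \<open>[P]\<close>; its powers below \<open>ord\<close> stay independent.\<close>

lemma line_length_ge:
  assumes low: "\<And>f e. f \<in> X \<Longrightarrow> e < ord \<Longrightarrow> coeff (line_poly v f) e = 0"
  shows "enat ord \<le> scheme_length P (scheme_inter X (vanishing_ideal line))" (is "_ \<le> scheme_length P ?Z")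
proof -
  have "enat (card {..<ord}) \<le> quotient_dim (local_ring P) (stalk P ?Z)"
  proof (rule quotient_dim_ge)
    show "Fract (ell v k ^ i) (lam ^ i) \<in> local_ring P" for i
      by (rule stalkI[of _ _ i]) (use homogeneous_ell_lam[of i 0] in simp_all)
    have "Fract 0 1 \<in> stalk P ?Z"
      by (rule stalkI[of _ _ 0]) (auto simp: scheme_inter_def scheme_of_def saturation_def ideal.span_zero)
    then show "0 \<in> stalk P ?Z" by (simp add: fract_collapse)
    fix c assume "(\<Sum>i<ord. Fract (const (c i)) 1 * Fract (ell v k ^ i) (lam ^ i)) \<in> stalk P ?Z"
    then obtain f g where fg: "Fract (\<Sum>i<ord. const (c i) * ell v k ^ i * lam ^ (ord - i)) (lam ^ ord) = Fract f g"
      "f \<in> ?Z" "eval P g \<noteq> 0"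
      unfolding sum_ell_fract stalk_def by blast
    then have "(\<Sum>i<ord. const (c i) * ell v k ^ i * lam ^ (ord - i)) * g = f * lam ^ ord"
      using eval_nonzero[OF fg(3)] by (simp add: eq_fract)
    from arg_cong[OF this, of "line_poly v"]
    have eq: "(\<Sum>i<ord. monom (c i) i) * line_poly v g = line_poly v f"
      unfolding line_poly_mult[of _ _ g] line_poly_sum line_poly_ell_power[OF v]
      by (simp add: line_poly_mult line_poly_power line_poly_lam v)
    have inter: "coeff (line_poly v f) e = 0" if "e < ord" for e
      by (rule line_poly_inter[OF _ fg(2) that]) (rule low)
    have "coeff (\<Sum>i<ord. monom (c i) i) e = 0" if "e < ord" for e
    proof (rule coeff_mult_low[OF _ _ that])
      show "coeff ((\<Sum>i<ord. monom (c i) i) * line_poly v g) e = 0" if "e < ord" for e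
        unfolding eq by (rule inter[OF that])
      show "coeff (line_poly v g) 0 \<noteq> 0" using fg(3) by (simp add: line_poly_0)
    qed
    then show "\<forall>i\<in>{..<ord}. c i = 0" by (simp add: coeff_sum)
  qed simp
  then show ?thesis by (simp add: scheme_length_def)
qed

text \<open>An element of order exactly \<open>ord\<close> restricts to \<open>t ^ ord\<close> times
  a unit, so it generates everything of order at least \<open>ord\<close> on the line; the powers of
  the local parameter below \<open>ord\<close> span the rest.\<close>

lemma line_length_eq:
  assumes low: "\<And>f e. f \<in> X \<Longrightarrow> e < ord \<Longrightarrow> coeff (line_poly v f) e = 0"
    and ex: "\<exists>f\<in>X. coeff (line_poly v f) ord \<noteq> 0"
  shows "scheme_length P (scheme_inter X (vanishing_ideal line)) = enat ord" (is "scheme_length P ?Z = _")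
proof (rule antisym[OF _ line_length_ge[OF low]])
  obtain f1 where f1: "f1 \<in> X" "coeff (line_poly v f1) ord \<noteq> 0" using ex by blast
  have "\<exists>d. coeff (line_poly v (hom_part d f1)) ord \<noteq> 0"
  proof (rule ccontr)
    assume none: "\<nexists>d. coeff (line_poly v (hom_part d f1)) ord \<noteq> 0"
    obtain N where N: "\<And>M. N \<le> M \<Longrightarrow> f1 = (\<Sum>d\<le>M. hom_part d f1)"
      by (rule ex_sum_hom_parts[of f1]) blast
    have "coeff (line_poly v f1) ord = (\<Sum>d\<le>N. coeff (line_poly v (hom_part d f1)) ord)"
      by (subst N[OF order_refl]) (simp add: line_poly_sum coeff_sum)
    then show False using none f1(2) by simp
  qed
  then obtain d0 where "coeff (line_poly v (hom_part d0 f1)) ord \<noteq> 0" ..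
  then obtain f0 where f0: "f0 \<in> X" "homogeneous d0 f0" "coeff (line_poly v f0) ord \<noteq> 0"
    using homogeneous_idealD[OF X f1(1)] homogeneous_hom_part by blast
  obtain u where u: "line_poly v f0 = monom 1 ord * u"
    using low_coeffs_zero_factor[of ord "line_poly v f0"] low[OF f0(1)] by blast
  have u0: "coeff u 0 \<noteq> 0" using f0(3) by (simp add: u coeff_monom_mult)
  have Zsub: "ideal.subspace ?Z"
    by (simp add: scheme_inter_def scheme_of_def subspace_saturation)
  have "quotient_dim (local_ring P) (stalk P ?Z) \<le> enat (card {..<ord})"
  proof (rule quotient_dim_le[OF subspace_stalk[OF Zsub P_nonzero]])
    fix x assume "x \<in> local_ring P"
    then obtain f g d where x: "x = Fract f g" "homogeneous d f" "homogeneous d g" "eval P g \<noteq> 0"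
      unfolding stalk_def by blast
    obtain c where c: "\<And>e. e < ord \<Longrightarrow> coeff (line_poly v f - line_poly v g * (\<Sum>i<ord. monom (c i) i)) e = 0"
      using ex_division_low[of "line_poly v g" ord "line_poly v f"] x(4) by (auto simp: line_poly_0)
    define h where "h = (\<Sum>i<ord. const (c i) * ell v k ^ i * lam ^ (ord - i))"
    define q where "q = f * lam ^ ord - g * h"
    have g0: "g \<noteq> 0" by (rule eval_nonzero[OF x(4)])
    have h: "homogeneous ord h" unfolding h_def by (rule homogeneous_sum_ell)
    have q: "homogeneous (d + ord) q"
      unfolding q_def using x(2,3) h by (intro homogeneous_diff homogeneous_mult) simp_all
    have "line_poly v h = (\<Sum>i<ord. monom (c i) i)"
      unfolding h_def line_poly_sum by (simp only: line_poly_ell_power[OF v])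
    then have "line_poly v q = line_poly v f - line_poly v g * (\<Sum>i<ord. monom (c i) i)"
      by (simp add: q_def line_poly_diff line_poly_mult line_poly_power line_poly_lam v)
    then obtain w where w: "line_poly v q = monom 1 ord * w"
      using low_coeffs_zero_factor[of ord "line_poly v q"] c by metis
    \<comment> \<open>Large enough for both \<open>u\<close> and \<open>w\<close> to be homogenized
      in the degrees required below.\<close>
    define E where "E = degree u + degree w"
    define u' where "u' = lift_poly v k u (d0 + E)"
    define w' where "w' = lift_poly v k w (d + ord + E)"
    have u': "homogeneous (d0 + E) u'" "line_poly v u' = u"
      unfolding u'_def using line_poly_lift[OF v] by (auto intro!: homogeneous_lift simp: E_def)
    have w': "homogeneous (d + ord + E) w'" "line_poly v w' = w"
      unfolding w'_def using line_poly_lift[OF v] by (auto intro!: homogeneous_lift simp: E_def)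
    have "eval P u' \<noteq> 0" using u0 by (simp flip: line_poly_0[of v] add: u')
    \<comment> \<open>Both products restrict to \<open>monom 1 ord * u * w\<close>. So
      \<open>u' * q\<close> belongs to the intersection, and \<open>u'\<close> is a unit at
      \<open>[P]\<close>.\<close>
    have "line_poly v (u' * q - w' * f0) = 0"
      by (simp add: line_poly_diff line_poly_mult u' w' u w mult_ac)
    moreover have "homogeneous (d0 + E + (d + ord)) (u' * q - w' * f0)"
    proof (rule homogeneous_diff)
      show "homogeneous (d0 + E + (d + ord)) (u' * q)" by (rule homogeneous_mult[OF u'(1) q])
      show "homogeneous (d0 + E + (d + ord)) (w' * f0)"
        using homogeneous_mult[OF w'(1) f0(2)] by (simp add: add_ac)
    qed
    ultimately have "u' * q - w' * f0 \<in> vanishing_ideal line" by (intro vanishing_on_line)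
    then have "(u' * q - w' * f0) + w' * f0 \<in> ideal.span (X \<union> vanishing_ideal line)"
      by (intro ideal.span_add ideal.span_base[OF UnI2] ideal.span_scale ideal.span_base[OF UnI1] f0)
    then have uq: "u' * q \<in> ?Z"
      using ideal.span_scale by (auto simp: scheme_inter_def scheme_of_def saturation_def)
    have "x - (\<Sum>i<ord. Fract (const (c i)) 1 * Fract (ell v k ^ i) (lam ^ i)) = Fract f g - Fract h (lam ^ ord)"
      by (simp only: sum_ell_fract x(1) h_def)
    also have "\<dots> = Fract q (g * lam ^ ord)"
      using g0 by (simp add: q_def mult.commute)
    also have "\<dots> = Fract (u' * q) (u' * (g * lam ^ ord))"
      using eval_nonzero[OF \<open>eval P u' \<noteq> 0\<close>] g0 by (simp add: eq_fract)
    also have "\<dots> \<in> stalk P ?Z"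
      by (rule stalkI[OF uq, where d = "d0 + E + (d + ord)"])
        (use homogeneous_mult[OF u'(1) q] homogeneous_mult[OF u'(1) homogeneous_mult[OF x(3) homogeneous_lam_power]]
          x(4) \<open>eval P u' \<noteq> 0\<close> in simp_all)
    finally show "\<exists>a. x - (\<Sum>i<ord. Fract (const (a i)) 1 * Fract (ell v k ^ i) (lam ^ i)) \<in> stalk P ?Z" by blast
  qed simp
  then show "scheme_length P ?Z \<le> enat ord" by (simp add: scheme_length_def)
qed

text \<open>The length is the least order of a restriction. Such an order exists, as otherwise the
  length would be at least \<open>Suc m\<close>.\<close>

lemma line_length_imp:
  assumes len: "scheme_length P (scheme_inter X (vanishing_ideal line)) = enat m"
  shows "(\<forall>f\<in>X. \<forall>e<m. coeff (line_poly v f) e = 0) \<and> (\<exists>f\<in>X. coeff (line_poly v f) m \<noteq> 0)"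
proof -
  let ?S = "\<lambda>e. \<exists>f\<in>X. coeff (line_poly v f) e \<noteq> 0"
  have "\<exists>e. ?S e"
  proof (rule ccontr)
    assume "\<nexists>e. ?S e"
    then have "enat (Suc m) \<le> scheme_length P (scheme_inter X (vanishing_ideal line))"
      by (intro line_length_ge) auto
    then show False unfolding len by simp
  qed
  then have ex: "?S (LEAST e. ?S e)" by (rule LeastI_ex)
  have low: "coeff (line_poly v f) e = 0" if "f \<in> X" "e < (LEAST e. ?S e)" for f e
    using not_less_Least[OF that(2)] that(1) by blast
  have "scheme_length P (scheme_inter X (vanishing_ideal line)) = enat (LEAST e. ?S e)"
    using low ex by (rule line_length_eq)
  then have m: "m = (LEAST e. ?S e)" unfolding len by simp
  show ?thesis unfolding m using low ex by blast
qed

end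

end


subsection \<open>Intersections with regular leading forms\<close>

text \<open>Collects what is used about the hypersurfaces, independently of the scheme they were
  found from: \<open>M\<close> is their common degree, \<open>m\<close> their order at
  \<open>[P]\<close>.\<close>

locale regular_intersection = projective_chart P j
  for P :: "complex ^ 'v::{finite,linorder}" and j :: 'v +
  fixes m M :: nat and Ks :: "'v cpoly list"
  assumes m: "m > 0"
    and homogeneous_K: "K \<in> set Ks \<Longrightarrow> homogeneous M K"
    and vanishes_K: "K \<in> set Ks \<Longrightarrow> vanishes_to m (taylor P K)"
    and regular_leading: "regular {var j} (map (\<lambda>K. hom_part m (taylor P K)) Ks)"
    and large: "contains_large_degrees
      (ideal.span (insert (var j) ((\<lambda>K. hom_part m (taylor P K)) ` set Ks)))"
begin

definition lead :: "'v cpoly \<Rightarrow> 'v cpoly" where "lead K = hom_part m (taylor P K)"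

text \<open>Modulo \<open>var j\<close> this is an ideal in the polynomial ring of the affine
  coordinates, the graded ring of the local ring at \<open>[P]\<close>.\<close>

definition Phi :: "'v cpoly set" where "Phi = ideal.span (insert (var j) (lead ` set Ks))"

definition J :: "'v cpoly set" where "J = ideal.span (set Ks)"

text \<open>The component supported at \<open>[P]\<close> of the scheme defined by \<open>J\<close>.\<close>

definition Y :: "'v cpoly set"
  where "Y = {f. \<exists>d g. homogeneous d g \<and> eval P g \<noteq> 0 \<and> g * f \<in> J}"

lemma homogeneous_lead: "homogeneous m (lead K)"
  by (simp add: lead_def)

lemma sig_lead: "K \<in> set Ks \<Longrightarrow> sig (lead K) = lead K"
  unfolding lead_def by (rule sig_leading_form[OF homogeneous_K vanishes_K])

lemma homogeneous_ideal_J: "homogeneous_ideal J"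
  unfolding J_def using homogeneous_K by (intro homogeneous_ideal_span) blast

lemma J_vanishes: "f \<in> J \<Longrightarrow> vanishes_to m (taylor P f)"
  unfolding J_def
proof (induction rule: ideal.span_induct_alt)
  case (step c x z)
  have "vanishes_to (0 + m) (taylor P c * taylor P x)"
    by (intro vanishes_to_mult vanishes_K step) simp
  then show ?case using step by (simp add: taylor_add taylor_mult vanishes_to_add)
qed simp

lemma J_leading_form:
  assumes f: "f \<in> J" "vanishes_to d (taylor P f)"
  shows "hom_part d (taylor P f) \<in> Phi"
proof -
  let ?Ps = "map (\<lambda>K. (taylor P K, lead K)) Ks"
  have "taylor P f \<in> ideal.span ({var j} \<union> set (map fst ?Ps))"
    using f(1) unfolding J_def
  proof (induction rule: ideal.span_induct_alt)
    case (step c x z)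
    then have "taylor P c * taylor P x + taylor P z \<in> ideal.span ({var j} \<union> set (map fst ?Ps))"
      by (intro ideal.span_add[OF ideal.span_scale[OF ideal.span_base]]) auto
    then show ?case by (simp add: taylor_add taylor_mult)
  qed (simp add: ideal.span_zero)
  then have "hom_part d (taylor P f) \<in> ideal.span ({var j} \<union> set (map snd ?Ps))"
  proof (rule leading_form_of_regular[rotated 3])
    show "\<exists>d. homogeneous d g" if "g \<in> {var j}" for g using that homogeneous_var by blast
    show "vanishes_to m K \<and> hom_part m K = F" if "(K, F) \<in> set ?Ps" for K F
      using that vanishes_K by (auto simp: lead_def)
    show "regular {var j} (map snd ?Ps)"
      using regular_leading by (simp add: lead_def comp_def)
  qed (rule f)
  then show ?thesis by (simp add: Phi_def image_image)
qed

text \<open>The factor \<open>g\<close> is a unit at \<open>[P]\<close> and only scales the leading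
  form by \<open>eval P g\<close>.\<close>

lemma local_leading_form:
  assumes "g * f \<in> J" "eval P g \<noteq> 0" "vanishes_to d (taylor P f)"
  shows "hom_part d (taylor P f) \<in> Phi"
proof -
  note gf = vanishes_to_mult[OF vanishes_to_0(2)[of "taylor P g"] assms(3), unfolded add_0]
  have "hom_part d (taylor P (g * f)) \<in> Phi"
    by (rule J_leading_form[OF assms(1)]) (simp add: taylor_mult gf)
  then have "const (eval P g) * hom_part d (taylor P f) \<in> Phi"
    by (simp add: taylor_mult gf hom_part_0_taylor)
  then have "const (1 / eval P g) * (const (eval P g) * hom_part d (taylor P f)) \<in> Phi"
    unfolding Phi_def by (rule ideal.span_scale)
  moreover have "const (1 / eval P g) * (const (eval P g) * hom_part d (taylor P f)) = hom_part d (taylor P f)"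
    using assms(2) by (simp flip: mult.assoc const_mult)
  ultimately show ?thesis by (simp only:)
qed

lemma local_vanishes:
  assumes "g * f \<in> J" "eval P g \<noteq> 0"
  shows "vanishes_to m (taylor P f)"
proof -
  have "vanishes_to e (taylor P f)" if "e \<le> m" for e
    using that
  proof (induction e)
    case (Suc e)
    then have e: "vanishes_to e (taylor P f)" by simp
    have "hom_part e (taylor P (g * f)) = const (eval P g) * hom_part e (taylor P f)"
      using vanishes_to_mult(2)[OF vanishes_to_0(2)[of "taylor P g"] e]
      by (simp add: taylor_mult hom_part_0_taylor)
    moreover have "hom_part e (taylor P (g * f)) = 0"
      using J_vanishes[OF assms(1)] Suc.prems by (simp add: vanishes_to_def)
    ultimately have "hom_part e (taylor P f) = 0" using assms(2) by simp
    then show ?case using e by (simp add: vanishes_to_Suc)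
  qed simp
  then show ?thesis by blast
qed

text \<open>The lift is homogeneous because all generators of \<open>J\<close> have the same degree \<open>M\<close>.\<close>

lemma lift_leading_form:
  assumes "r \<in> Phi"
  shows "\<exists>h\<in>J. homogeneous (e + M) h \<and> vanishes_to e (taylor P h) \<and>
    hom_part e (taylor P h) = sig (hom_part e r)"
  using assms unfolding Phi_def
proof (induction rule: ideal.span_induct_alt)
  case base
  show ?case by (intro bexI[of _ 0]) (auto simp: J_def ideal.span_zero)
next
  case (step c x z)
  then obtain h where h: "h \<in> J" "homogeneous (e + M) h" "vanishes_to e (taylor P h)"
    "hom_part e (taylor P h) = sig (hom_part e z)" by blast
  have "\<exists>h'\<in>J. homogeneous (e + M) h' \<and> vanishes_to e (taylor P h') \<and>
    hom_part e (taylor P h') = sig (hom_part e (x * c))"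
    using step(1)
  proof
    assume x: "x = var j"
    have "sig (hom_part e (x * c)) = 0"
      by (simp add: x hom_part_homogeneous_mult[OF homogeneous_var] sig_mult)
    then show ?thesis by (intro bexI[of _ 0]) (auto simp: J_def ideal.span_zero)
  next
    assume "x \<in> lead ` set Ks"
    then obtain K where K: "K \<in> set Ks" "x = lead K" by blast
    show ?thesis
    proof (cases "m \<le> e")
      case False
      then have "sig (hom_part e (x * c)) = 0"
        by (simp add: K hom_part_homogeneous_mult[OF homogeneous_lead])
      then show ?thesis by (intro bexI[of _ 0]) (auto simp: J_def ideal.span_zero)
    next
      case True
      let ?c = "hom_part (e - m) c"
      \<comment> \<open>The power of \<open>lam\<close> makes up for passing from
        \<open>lead K\<close> of degree \<open>m\<close> to \<open>K\<close> of degree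
        \<open>M\<close>: the total is \<open>m + (e - m) + M = e + M\<close>.\<close>
      let ?h = "(lam ^ m * sig ?c) * K"
      note c = hom_part_taylor_lam_mult[OF homogeneous_hom_part[of "e - m" c], of m]
      note v = vanishes_to_mult[OF c(1) vanishes_K[OF K(1)], folded taylor_mult]
      have "homogeneous (m + (e - m) + M) ?h"
        by (intro homogeneous_mult homogeneous_sig homogeneous_K K(1)) simp_all
      moreover have "?h \<in> J" unfolding J_def using K(1) by (intro ideal.span_scale ideal.span_base)
      moreover have "hom_part e (taylor P ?h) = sig (hom_part e (x * c))"
      proof -
        have "hom_part e (x * c) = lead K * ?c"
          using True by (simp add: K(2) hom_part_homogeneous_mult[OF homogeneous_lead])
        then have "sig (hom_part e (x * c)) = sig ?c * lead K"
          by (simp add: sig_mult sig_lead[OF K(1)] mult.commute)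
        then show ?thesis using v(2) True c(2) by (simp add: lead_def)
      qed
      ultimately show ?thesis using v(1) True by (intro bexI[of _ ?h]) simp_all
    qed
  qed
  then obtain h' where h': "h' \<in> J" "homogeneous (e + M) h'" "vanishes_to e (taylor P h')"
    "hom_part e (taylor P h') = sig (hom_part e (x * c))" by blast
  show ?case
    using h h' by (intro bexI[of _ "h' + h"])
      (auto simp: taylor_add hom_part_add sig_add mult.commute[of c] J_def
        intro: ideal.span_add homogeneous_add vanishes_to_add)
qed

text \<open>Splitting one \<open>y i\<close> off each monomial yields coefficients in the maximal
  ideal, the shape required by \<open>nakayama\<close>.\<close>

lemma ypow_Suc_explicit:
  assumes "f \<in> ypow (Suc D)"
  shows "\<exists>n. (\<forall>u. eval P (n u) = 0) \<and> f = (\<Sum>u\<in>{u. mdeg u = D}. n u * ymon u)"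
  using assms unfolding ypow_def
proof (induction rule: ideal.span_induct_alt)
  case base
  show ?case by (intro exI[of _ "\<lambda>_. 0"]) simp
next
  case (step c x z)
  then obtain n where n: "\<And>u. eval P (n u) = 0" "z = (\<Sum>u\<in>{u. mdeg u = D}. n u * ymon u)" by blast
  obtain w where w: "mdeg w = Suc D" "x = ymon w" using step(1) by blast
  obtain i u where u: "mdeg u = D" and w': "w = single i 1 + u"
    using w(1) by (rule ex_var_factor)
  have "(\<Sum>t\<in>{u. mdeg u = D}. (if t = u then c * y i else 0) * ymon t) = c * x"
    using u finite_mdeg[of D, where 'v = 'v]
    by (simp add: w(2) w' ymon_single[unfolded One_nat_def] if_distrib[of "\<lambda>x. x * _"] mult.assoc cong: if_cong)
  then have "c * x + z = (\<Sum>t\<in>{u. mdeg u = D}. ((if t = u then c * y i else 0) + n t) * ymon t)"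
    by (simp add: n(2) distrib_right sum.distrib)
  moreover have "eval P ((if t = u then c * y i else 0) + n t) = 0" for t using n(1) by simp
  ultimately show ?case
    by (intro exI[of _ "\<lambda>t. (if t = u then c * y i else 0) + n t"]) blast
qed

text \<open>\<open>Phi\<close> contains all forms of degree \<open>D\<close>, so up to a power of
  \<open>lam\<close> each monomial of degree \<open>D\<close> in the \<open>y i\<close> agrees to
  leading order with an element of \<open>J\<close>. Modulo \<open>J\<close> it becomes a
  combination of such monomials with coefficients vanishing at \<open>P\<close>, and Nakayama's
  lemma applies. Thus \<open>[P]\<close> is an isolated point of the intersection.\<close>

lemma local_powers:
  obtains d g D where "homogeneous d g" "eval P g \<noteq> 0" "\<forall>u. mdeg u = D \<longrightarrow> g * ymon u \<in> J"
proof -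
  obtain D where D: "\<And>d f. D \<le> d \<Longrightarrow> homogeneous d f \<Longrightarrow> f \<in> Phi"
    using large unfolding contains_large_degrees_def Phi_def lead_def by blast
  have J: "ideal.subspace J" by (simp add: J_def)
  have "\<exists>u\<in>{g. eval P g \<noteq> 0}. \<forall>s\<in>{u. mdeg u = D}. u * ymon s \<in> J"
  proof (rule nakayama[OF J, where N = "{f. eval P f = 0}"])
    show "ideal.subspace {f. eval P f = 0}" by (simp add: ideal.subspace_def)
    show "finite {u :: 'v \<Rightarrow>\<^sub>0 nat. mdeg u = D}" by (rule finite_mdeg)
    fix s :: "'v \<Rightarrow>\<^sub>0 nat" assume "s \<in> {u. mdeg u = D}"
    then have s: "mdeg s = D" by simp
    then have hs: "homogeneous D (single s (1::complex))" using homogeneous_single by blast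
    then obtain h where h: "h \<in> J" "homogeneous (D + M) h" "vanishes_to D (taylor P h)"
      "hom_part D (taylor P h) = ymon s"
      using lift_leading_form[OF D[OF order_refl hs], of D]
      by (auto simp: hom_part_homogeneous[OF hs] ymon_def)
    note lm = hom_part_taylor_lam_mult[OF hs, folded ymon_def, of M]
    have "homogeneous (M + D) (lam ^ M * ymon s - h)"
      using h(2) homogeneous_ymon[OF s] by (intro homogeneous_diff homogeneous_mult) (simp_all add: add.commute)
    moreover have "vanishes_to (Suc D) (taylor P (lam ^ M * ymon s - h))"
      using h lm by (auto simp: vanishes_to_Suc taylor_diff hom_part_diff intro: vanishes_to_diff)
    ultimately have "lam ^ M * ymon s - h \<in> ypow (Suc D)" by (rule ypow_of_vanishes)
    then obtain n where n: "\<And>u. eval P (n u) = 0"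
      "lam ^ M * ymon s - h = (\<Sum>u\<in>{u. mdeg u = D}. n u * ymon u)"
      using ypow_Suc_explicit by blast
    have "lam ^ M * ymon s - (\<Sum>u\<in>{u. mdeg u = D}. n u * ymon u) = h"
      by (simp flip: n(2))
    then show "\<exists>u\<in>{g. eval P g \<noteq> 0}. \<exists>n. (\<forall>t. n t \<in> {f. eval P f = 0}) \<and>
        u * ymon s - (\<Sum>t\<in>{u. mdeg u = D}. n t * ymon t) \<in> J"
      using h(1) n(1) by (intro bexI[of _ "lam ^ M"] exI[of _ n]) simp_all
  qed simp_all
  then obtain g where g: "eval P g \<noteq> 0" "\<And>u. mdeg u = D \<Longrightarrow> g * ymon u \<in> J" by blast
  obtain N where N: "\<And>M. N \<le> M \<Longrightarrow> g = (\<Sum>d\<le>M. hom_part d g)"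
    by (rule ex_sum_hom_parts[of g]) blast
  \<comment> \<open>Nakayama's lemma provides a polynomial multiplier. Some homogeneous part of it
    is nonzero at \<open>P\<close>, and that part works as well because \<open>J\<close> is
    homogeneous.\<close>
  have "\<exists>d. eval P (hom_part d g) \<noteq> 0"
  proof (rule ccontr)
    assume none: "\<nexists>d. eval P (hom_part d g) \<noteq> 0"
    have "eval P g = (\<Sum>d\<le>N. eval P (hom_part d g))"
      by (subst N[OF order_refl]) (simp add: eval_sum)
    then show False using none g(1) by simp
  qed
  then obtain d where d: "eval P (hom_part d g) \<noteq> 0" ..
  have "hom_part d g * ymon u \<in> J" if u: "mdeg u = D" for u
  proof -
    have "hom_part (D + d) (ymon u * g) = ymon u * hom_part d g"
      by (simp add: hom_part_homogeneous_mult[OF homogeneous_ymon[OF u]])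
    then show ?thesis
      using homogeneous_idealD[OF homogeneous_ideal_J g(2)[OF u], of "D + d"] by (simp add: mult.commute)
  qed
  then show thesis using that[OF homogeneous_hom_part d] by blast
qed

section \<open>The scheme \<open>Y\<close> and its symmetry\<close>

lemma J_subset_Y: "J \<subseteq> Y"
proof
  fix f assume "f \<in> J"
  then show "f \<in> Y" unfolding Y_def by (intro CollectI exI[of _ "0::nat"] exI[of _ 1]) simp
qed

lemma closed_subscheme_Y: "closed_subscheme Y"
proof -
  have sub: "ideal.subspace Y"
  proof (rule ideal.subspaceI)
    show "0 \<in> Y" using J_subset_Y by (auto simp: J_def ideal.span_zero)
    fix f f' assume "f \<in> Y" "f' \<in> Y"
    then obtain d g d' g' where g: "homogeneous d g" "eval P g \<noteq> 0" "g * f \<in> J"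
      and g': "homogeneous d' g'" "eval P g' \<noteq> 0" "g' * f' \<in> J" unfolding Y_def by blast
    have "g' * (g * f) + g * (g' * f') \<in> J"
      using ideal.span_add[OF ideal.span_scale[OF g(3)[unfolded J_def]] ideal.span_scale[OF g'(3)[unfolded J_def]]]
      unfolding J_def .
    then have "(g * g') * (f + f') \<in> J" by (simp add: algebra_simps)
    then show "f + f' \<in> Y" unfolding Y_def using homogeneous_mult[OF g(1) g'(1)] g(2) g'(2)
      by (intro CollectI exI[of _ "d + d'"] exI[of _ "g * g'"]) simp
  next
    fix c f assume "f \<in> Y"
    then obtain d g where g: "homogeneous d g" "eval P g \<noteq> 0" "g * f \<in> J" unfolding Y_def by blast
    have "c * (g * f) \<in> J" using g(3) unfolding J_def by (rule ideal.span_scale)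
    then have "g * (c * f) \<in> J" by (simp add: mult_ac)
    then show "c * f \<in> Y" unfolding Y_def using g by blast
  qed
  moreover have "hom_part e f \<in> Y" if fY: "f \<in> Y" for f e
  proof -
    obtain d g where g: "homogeneous d g" "eval P g \<noteq> 0" "g * f \<in> J" using fY unfolding Y_def by blast
    have "g * hom_part e f \<in> J"
      using homogeneous_idealD[OF homogeneous_ideal_J g(3), of "d + e"]
      by (simp add: hom_part_homogeneous_mult[OF g(1)])
    then show ?thesis unfolding Y_def using g by blast
  qed
  ultimately have "homogeneous_ideal Y" by (simp add: homogeneous_ideal_def)
  moreover have "saturation Y = Y"
  proof
    show "Y \<subseteq> saturation Y"
      unfolding saturation_def using sub ideal.subspace_scale by blast
    show "saturation Y \<subseteq> Y"
    proof
      fix f assume "f \<in> saturation Y"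
      then obtain s where "\<And>g. homogeneous s g \<Longrightarrow> g * f \<in> Y" unfolding saturation_def by blast
      then have "lam ^ s * f \<in> Y" by simp
      then obtain d g where g: "homogeneous d g" "eval P g \<noteq> 0" "g * (lam ^ s * f) \<in> J" unfolding Y_def by blast
      then show "f \<in> Y" unfolding Y_def using homogeneous_mult[OF g(1) homogeneous_lam_power[of s]]
        by (intro CollectI exI[of _ "d + s"] exI[of _ "g * lam ^ s"]) (simp add: mult.assoc)
    qed
  qed
  ultimately show ?thesis by (simp add: closed_subscheme_def)
qed

lemma supported_at_Y: "supported_at P Y"
  unfolding supported_at_def
proof (intro equalityI subsetI)
  fix v assume "v \<in> {c *s P | c. c \<noteq> 0}"
  then obtain c where c: "v = c *s P" "c \<noteq> 0" by blast
  have K: "eval v K = 0" if "K \<in> set Ks" for K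
  proof -
    have "const (eval P K) = 0"
      using vanishes_toD[OF vanishes_K[OF that] m] by (simp add: hom_part_0_taylor)
    then show ?thesis using eval_scale[OF homogeneous_K[OF that], of c P] c by simp
  qed
  have "eval v f = 0" if "f \<in> Y" for f
  proof -
    obtain d g where g: "homogeneous d g" "eval P g \<noteq> 0" "g * f \<in> J" using \<open>f \<in> Y\<close> unfolding Y_def by blast
    have "eval v (g * f) = 0" by (rule eval_zero_span[OF K g(3)[unfolded J_def]])
    moreover have "eval v g \<noteq> 0" using eval_scale[OF g(1), of c P] c g(2) by simp
    ultimately show ?thesis by simp
  qed
  then show "v \<in> {v. v \<noteq> 0 \<and> (\<forall>f\<in>Y. eval v f = 0)}" using c P_nonzero by (simp add: vector_mul_eq_0)
next
  fix v assume v: "v \<in> {v. v \<noteq> 0 \<and> (\<forall>f\<in>Y. eval v f = 0)}"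
  obtain d g D where g: "homogeneous d g" "eval P g \<noteq> 0" "\<forall>u. mdeg u = D \<longrightarrow> g * ymon u \<in> J"
    by (rule local_powers)
  have "eval v (y i) = 0" for i
  proof -
    \<comment> \<open>By \<open>local_powers\<close> the \<open>D\<close>-th power of each
      \<open>y i\<close> lies in \<open>Y\<close>, so all \<open>y i\<close> vanish at
      \<open>v\<close>, which makes \<open>v\<close> a multiple of \<open>P\<close>.\<close>
    have "ymon (single i D) \<in> Y"
      unfolding Y_def using g by (intro CollectI exI[of _ d] exI[of _ g]) simp
    moreover have "ymon (single i D) = y i ^ D"
      by (simp add: ymon_def sig_def cs.subst_power flip: var_power)
    ultimately have "eval v (y i ^ D) = 0" using v by auto
    then show ?thesis by simp
  qed
  then have "v $ i = ((v $ j / P $ j) *s P) $ i" for i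
    unfolding eval_y vector_smult_component by (metis right_minus_eq mult.commute)
  then have eq: "v = (v $ j / P $ j) *s P" unfolding vec_eq_iff by blast
  moreover have "v $ j / P $ j \<noteq> 0"
  proof
    assume 0: "v $ j / P $ j = 0"
    have "v = 0" using eq unfolding 0 by simp
    then show False using v by simp
  qed
  ultimately show "v \<in> {c *s P | c. c \<noteq> 0}" by blast
qed

lemma common_zero:
  assumes "\<And>K. K \<in> set Ks \<Longrightarrow> eval v (lead K) = 0" "v $ j = 0"
  shows "v = 0"
proof -
  obtain D where D: "\<And>d f. D \<le> d \<Longrightarrow> homogeneous d f \<Longrightarrow> f \<in> Phi"
    using large unfolding contains_large_degrees_def Phi_def lead_def by blast
  have "v $ k = 0" for k
  proof -
    have "var k ^ D \<in> Phi" using homogeneous_power[OF homogeneous_var, of D] by (intro D) auto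
    then have "eval v (var k ^ D) = 0"
      unfolding Phi_def by (rule eval_zero_span[rotated]) (use assms in auto)
    then show ?thesis by simp
  qed
  then show ?thesis by (simp add: vec_eq_iff)
qed

text \<open>Elements of \<open>Y\<close> have order at least \<open>m\<close> at \<open>[P]\<close>,
  and for each line some \<open>lead K\<close> is nonzero at its direction; so the least order on
  the line is \<open>m\<close>.\<close>

lemma m_symmetric_Y: "m_symmetric m P Y"
  unfolding m_symmetric_def
proof (intro conjI allI impI)
  fix L assume "line_through P L"
  then obtain v where v: "v \<noteq> 0" "v $ j = 0" "L = {a *s P + b *s v | a b. True}"
    by (rule ex_line_direction)
  obtain k where k: "v $ k \<noteq> 0" using v(1) by (auto simp: vec_eq_iff)
  have hY: "homogeneous_ideal Y" using closed_subscheme_Y by (simp add: closed_subscheme_def)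
  show "scheme_length P (scheme_inter Y (vanishing_ideal L)) = enat m"
    unfolding v(3)
  proof (rule line_length_eq[OF v(2) k hY])
    fix f e assume "f \<in> Y" "e < m"
    then show "coeff (line_poly v f) e = 0"
      using local_vanishes by (auto simp: Y_def coeff_line_poly vanishes_to_def)
  next
    show "\<exists>f\<in>Y. coeff (line_poly v f) m \<noteq> 0"
    proof (rule ccontr)
      assume none: "\<not> (\<exists>f\<in>Y. coeff (line_poly v f) m \<noteq> 0)"
      have "eval v (lead K) = 0" if "K \<in> set Ks" for K
      proof -
        have "K \<in> Y" using J_subset_Y that ideal.span_base unfolding J_def by blast
        then show ?thesis using none by (simp add: coeff_line_poly lead_def)
      qed
      then have "v = 0" using v(2) by (intro common_zero) auto
      then show False using v(1) by simp
    qed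
  qed
qed (use P_nonzero closed_subscheme_Y supported_at_Y in auto)

lemma no_common_line: "\<not> (\<exists>L. line_through P L \<and> (\<forall>K\<in>set Ks. L \<subseteq> {v. eval v (lead K) = 0}))"
proof clarify
  fix L assume L: "line_through P L" "\<forall>K\<in>set Ks. L \<subseteq> {v. eval v (lead K) = 0}"
  obtain v where v: "v \<noteq> 0" "v $ j = 0" "L = {a *s P + b *s v | a b. True}"
    using ex_line_direction[OF L(1)] by blast
  have "v = 0 *s P + 1 *s v" by simp
  then have "v \<in> L" unfolding v(3) by blast
  then have "v = 0" using L(2) v(2) by (intro common_zero) auto
  then show False using v(1) by simp
qed

lemma stalk_Y: "stalk P Y = stalk P (scheme_of (set Ks))"
proof
  show "stalk P Y \<subseteq> stalk P (scheme_of (set Ks))"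
  proof
    fix x assume "x \<in> stalk P Y"
    then obtain f h d where x: "x = Fract f h" "f \<in> Y" "homogeneous d f" "homogeneous d h" "eval P h \<noteq> 0"
      unfolding stalk_def by blast
    then obtain e g where g: "homogeneous e g" "eval P g \<noteq> 0" "g * f \<in> J" unfolding Y_def by blast
    have "Fract (g * f) (g * h) \<in> stalk P (scheme_of (set Ks))"
    proof (rule stalkI)
      show "g * f \<in> scheme_of (set Ks)"
        using g(3) ideal.span_scale by (auto simp: scheme_of_def saturation_def J_def)
    qed (use homogeneous_mult[OF g(1)] x g in auto)
    then show "x \<in> stalk P (scheme_of (set Ks))" by (simp only: x(1) mult_fract_cancel[OF eval_nonzero[OF g(2)]])
  qed
  show "stalk P (scheme_of (set Ks)) \<subseteq> stalk P Y"
  proof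
    fix x assume "x \<in> stalk P (scheme_of (set Ks))"
    then obtain f h d where x: "x = Fract f h" "f \<in> scheme_of (set Ks)" "homogeneous d f" "homogeneous d h" "eval P h \<noteq> 0"
      unfolding stalk_def by blast
    then obtain s where "\<And>g. homogeneous s g \<Longrightarrow> g * f \<in> J"
      by (auto simp: scheme_of_def saturation_def J_def)
    then have "lam ^ s * f \<in> J" by simp
    then have "f \<in> Y" unfolding Y_def by (intro CollectI exI[of _ s] exI[of _ "lam ^ s"]) simp
    then show "x \<in> stalk P Y" unfolding x(1) using x by (intro stalkI)
  qed
qed

text \<open>
  The lifts of a homogeneous basis of the graded ring modulo \<open>Phi\<close> form a basis of the local ring of \<open>Y\<close>,
  because \<open>Phi\<close> consists of all leading forms of the ideal of \<open>Y\<close>.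
\<close>

lemma length_Y:
  assumes n: "CARD('v) = n + 1" "length Ks = n"
  shows "scheme_length P Y = enat (m ^ n)"
proof -
  have Phi_eq: "Phi = ideal.span (insert (var j) (set (map lead Ks)))" by (simp add: Phi_def)
  have "\<exists>B. finite B \<and> card B = m ^ n \<and> (\<forall>b\<in>B. \<exists>d. homogeneous d b) \<and>
    (\<forall>c. (\<Sum>b\<in>B. const (c b) * b) \<in> Phi \<longrightarrow> (\<forall>b\<in>B. c b = 0)) \<and>
    (\<forall>d f. homogeneous d f \<longrightarrow> (\<exists>a. f - (\<Sum>b\<in>{b\<in>B. homogeneous d b}. const (a b) * b) \<in> Phi))"
    (is "\<exists>B. ?basis B")
  proof (rule ex_basis_of_regular[of n "map lead Ks" m j, folded Phi_eq])
    show "CARD('v) = n + 1" "length (map lead Ks) = n" using n by simp_all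
    show "homogeneous m G" if "G \<in> set (map lead Ks)" for G using that homogeneous_lead by auto
    show "regular {var j} (map lead Ks)" using regular_leading by (simp add: lead_def[abs_def])
    show "contains_large_degrees Phi" using large by (simp add: Phi_def lead_def[abs_def])
    show "\<exists>B. ?basis B" if "finite B" "card B = m ^ n" "\<And>b. b \<in> B \<Longrightarrow> \<exists>d. homogeneous d b"
      "\<And>c. (\<Sum>b\<in>B. const (c b) * b) \<in> Phi \<Longrightarrow> \<forall>b\<in>B. c b = 0"
      "\<And>d f. homogeneous d f \<Longrightarrow> \<exists>a. f - (\<Sum>b\<in>{b\<in>B. homogeneous d b}. const (a b) * b) \<in> Phi" for B
      by (rule exI[of _ B], intro conjI ballI allI impI) (use that in blast)+
  qed
  then obtain B where B: "finite B" "card B = m ^ n" "\<And>b. b \<in> B \<Longrightarrow> \<exists>d. homogeneous d b"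
    and indep: "\<And>c. (\<Sum>b\<in>B. const (c b) * b) \<in> Phi \<Longrightarrow> \<forall>b\<in>B. c b = 0"
    and span: "\<And>d f. homogeneous d f \<Longrightarrow> \<exists>a. f - (\<Sum>b\<in>{b\<in>B. homogeneous d b}. const (a b) * b) \<in> Phi"
    by blast
  obtain dg where dg: "\<And>b. b \<in> B \<Longrightarrow> homogeneous (dg b) b" using B(3) by metis
  define E where "E = (\<Sum>b\<in>B. dg b)"
  have dgE: "dg b \<le> E" if "b \<in> B" for b unfolding E_def using B(1) that by (intro member_le_sum) auto
  define t where "t b = Fract (sig b) (lam ^ dg b)" for b
  have hY: "homogeneous_ideal Y" using closed_subscheme_Y by (simp add: closed_subscheme_def)
  have sY: "ideal.subspace Y" by (rule homogeneous_ideal_subspace[OF hY])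
  have sum_t: "(\<Sum>b\<in>C. Fract (const (c b)) 1 * t b) =
      Fract (\<Sum>b\<in>C. const (c b) * (lam ^ (e - dg b) * sig b)) (lam ^ e)"
    if "\<And>b. b \<in> C \<Longrightarrow> dg b \<le> e" for C c e
  proof -
    have "Fract (const (c b)) 1 * t b = Fract (const (c b) * (lam ^ (e - dg b) * sig b)) (lam ^ e)" if "b \<in> C" for b
    proof -
      have "lam ^ e = lam ^ (e - dg b) * lam ^ dg b" using \<open>\<And>b. b \<in> C \<Longrightarrow> dg b \<le> e\<close>[OF that] by (simp flip: power_add)
      then show ?thesis by (simp add: t_def eq_fract mult_ac)
    qed
    then have "(\<Sum>b\<in>C. Fract (const (c b)) 1 * t b) =
      (\<Sum>b\<in>C. Fract (const (c b) * (lam ^ (e - dg b) * sig b)) (lam ^ e))" by (intro sum.cong) auto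
    then show ?thesis by (simp add: sum_fract)
  qed
  have ge: "enat (card B) \<le> quotient_dim (local_ring P) (stalk P Y)"
  proof (rule quotient_dim_ge[OF B(1), where g = t])
    show "t b \<in> local_ring P" if "b \<in> B" for b
      unfolding t_def by (rule stalkI[of _ _ "dg b"]) (use dg[OF that] homogeneous_sig in simp_all)
    show "0 \<in> stalk P Y" by (rule fv.subspace_0[OF subspace_stalk[OF sY P_nonzero]])
    fix c assume c: "(\<Sum>b\<in>B. Fract (const (c b)) 1 * t b) \<in> stalk P Y"
    define h where "h = (\<Sum>b\<in>B. const (c b) * (lam ^ (E - dg b) * sig b))"
    have "(\<Sum>b\<in>B. Fract (const (c b)) 1 * t b) = Fract h (lam ^ E)"
      unfolding h_def by (rule sum_t) (rule dgE)
    then obtain f g where fg: "Fract h (lam ^ E) = Fract f g" "f \<in> Y" "eval P g \<noteq> 0"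
      using c unfolding stalk_def by auto
    then have "h * g = f * lam ^ E" using eval_nonzero[OF fg(3)] by (simp add: eq_fract)
    then have "g * h \<in> Y" using ideal.subspace_scale[OF sY fg(2), of "lam ^ E"] by (simp add: mult.commute)
    then obtain d' g' where g': "eval P g' \<noteq> 0" "g' * (g * h) \<in> J" unfolding Y_def by blast
    have gh: "(g' * g) * h \<in> J" "eval P (g' * g) \<noteq> 0" using g' fg(3) by (simp_all add: mult.assoc)
    have tm: "vanishes_to (dg b) (taylor P (lam ^ (E - dg b) * sig b))"
      "hom_part (dg b) (taylor P (lam ^ (E - dg b) * sig b)) = sig b" if "b \<in> B" for b
      using hom_part_taylor_lam_mult[OF dg[OF that]] by auto
    \<comment> \<open>By degree: once the coefficients below \<open>e\<close> vanish, the part of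
      degree \<open>e\<close> of \<open>h\<close> at \<open>P\<close> is the combination of the
      basis elements of degree \<open>e\<close>, and it lies in \<open>Phi\<close>.\<close>
    have zero: "\<forall>b\<in>B. dg b < e \<longrightarrow> c b = 0" for e
    proof (induction e)
      case (Suc e)
      have h_eq: "h = (\<Sum>b\<in>{b\<in>B. e \<le> dg b}. const (c b) * (lam ^ (E - dg b) * sig b))"
        unfolding h_def using Suc B(1) by (intro sum.mono_neutral_right) (auto simp: not_le)
      have "vanishes_to e (taylor P h)"
        unfolding h_eq taylor_sum
      proof (rule vanishes_to_sum)
        fix b assume "b \<in> {b\<in>B. e \<le> dg b}"
        then have "vanishes_to e (taylor P (lam ^ (E - dg b) * sig b))"
          using tm(1) vanishes_to_mono by blast
        from vanishes_to_mult(1)[OF vanishes_to_0(2)[of "const (c b)"] this]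
        show "vanishes_to e (taylor P (const (c b) * (lam ^ (E - dg b) * sig b)))"
          by (simp add: taylor_mult)
      qed
      then have lead: "hom_part e (taylor P h) \<in> Phi" by (rule local_leading_form[OF gh])
      have "hom_part e (taylor P h) = (\<Sum>b\<in>{b\<in>B. e \<le> dg b}. if dg b = e then const (c b) * sig b else 0)"
        unfolding h_eq taylor_sum hom_part_sum taylor_mult[of P "const _"] taylor_const hom_part_const_mult
      proof (rule sum.cong)
        fix b assume "b \<in> {b\<in>B. e \<le> dg b}"
        then have b: "b \<in> B" "e \<le> dg b" by auto
        show "const (c b) * hom_part e (taylor P (lam ^ (E - dg b) * sig b)) =
          (if dg b = e then const (c b) * sig b else 0)"
        proof (cases "dg b = e")
          case True
          then show ?thesis using tm(2)[OF b(1)] by simp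
        next
          case False
          then have "e < dg b" using b(2) by simp
          then show ?thesis using vanishes_toD[OF tm(1)[OF b(1)]] False by simp
        qed
      qed simp
      also have "\<dots> = (\<Sum>b\<in>B. if dg b = e then const (c b) * sig b else 0)"
        using B(1) by (intro sum.mono_neutral_left) auto
      finally have "(\<Sum>b\<in>B. if dg b = e then const (c b) * sig b else 0) \<in> Phi" using lead by simp
      \<comment> \<open>The basis is independent modulo \<open>Phi\<close> as given, not after
        \<open>sig\<close>; the two versions agree modulo \<open>var j\<close>.\<close>
      moreover have "(\<Sum>b\<in>B. if dg b = e then const (c b) * (b - sig b) else 0) \<in> Phi"
      proof -
        have "b - sig b \<in> Phi" for b
          using diff_sig_mem[of b] ideal.span_mono[of "{var j}" "insert (var j) (lead ` set Ks)"]
          unfolding Phi_def by blast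
        then show ?thesis unfolding Phi_def by (auto intro!: ideal.span_sum ideal.span_scale simp: ideal.span_zero)
      qed
      ultimately have "(\<Sum>b\<in>B. if dg b = e then const (c b) * sig b else 0) +
        (\<Sum>b\<in>B. if dg b = e then const (c b) * (b - sig b) else 0) \<in> Phi"
        unfolding Phi_def by (rule ideal.span_add)
      also have "(\<Sum>b\<in>B. if dg b = e then const (c b) * sig b else 0) +
        (\<Sum>b\<in>B. if dg b = e then const (c b) * (b - sig b) else 0) =
        (\<Sum>b\<in>B. const (if dg b = e then c b else 0) * b)"
        unfolding sum.distrib[symmetric] by (intro sum.cong) (auto simp: algebra_simps)
      finally have "\<forall>b\<in>B. (if dg b = e then c b else 0) = 0" by (rule indep)
      then show ?case using Suc by (auto simp: less_Suc_eq split: if_splits)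
    qed simp
    show "\<forall>b\<in>B. c b = 0"
    proof
      fix b assume "b \<in> B"
      then show "c b = 0" using zero[of "Suc (dg b)"] by blast
    qed
  qed
  have le: "quotient_dim (local_ring P) (stalk P Y) \<le> enat (card B)"
  proof (rule quotient_dim_le[OF subspace_stalk[OF sY P_nonzero] B(1), where h = t])
    let ?good = "\<lambda>x. \<exists>a. x - (\<Sum>b\<in>B. Fract (const (a b)) 1 * t b) \<in> stalk P Y"
    obtain d0 g0 D where g0: "homogeneous d0 g0" "eval P g0 \<noteq> 0" "\<forall>u. mdeg u = D \<longrightarrow> g0 * ymon u \<in> J"
      by (rule local_powers)
    \<comment> \<open>\<open>e\<close> bounds how far the order of \<open>f\<close> is from
      \<open>D\<close>. A form of order \<open>D\<close> is in \<open>Y\<close> because of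
      \<open>g0\<close>; below that, a step removes the leading form and raises the order by
      one.\<close>
    have main: "?good (Fract f g)"
      if "homogeneous d f" "homogeneous d g" "eval P g \<noteq> 0" "vanishes_to (D - e) (taylor P f)" for f g d e
      using that
    proof (induction e arbitrary: f g d)
      case 0
      then have "f \<in> ypow D" using ypow_of_vanishes by simp
      then obtain q where q: "f = (\<Sum>u\<in>{u. mdeg u = D}. q u * ymon u)"
        using span_image_explicit[OF finite_mdeg] unfolding ypow_def by blast
      have "(\<Sum>u\<in>{u. mdeg u = D}. q u * (g0 * ymon u)) \<in> J"
        unfolding J_def
      proof (rule ideal.span_sum, rule ideal.span_scale)
        fix u :: "'v \<Rightarrow>\<^sub>0 nat" assume "u \<in> {u. mdeg u = D}"
        then show "g0 * ymon u \<in> ideal.span (set Ks)" using g0(3) by (simp add: J_def)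
      qed
      then have "g0 * f \<in> J" unfolding q by (simp add: sum_distrib_left mult.left_commute)
      then have "f \<in> Y" unfolding Y_def using g0 by blast
      then have "Fract f g \<in> stalk P Y" using 0 by (intro stalkI)
      then show ?case by (intro exI[of _ "\<lambda>_. 0"]) (simp add: fract_collapse)
    next
      case (Suc e)
      show ?case
      proof (cases "D \<le> e")
        case True
        then show ?thesis using Suc.prems by (intro Suc.IH) simp_all
      next
        case False
        define k where "k = D - Suc e"
        have k: "D - e = Suc k" using False by (simp add: k_def)
        have fk: "vanishes_to k (taylor P f)" using Suc.prems(4) by (simp add: k_def)
        obtain a where a: "homogeneous k a" "hom_part k (taylor P f) = sig a"
          using vanishes_leading_form[OF Suc.prems(1) fk] by blast
        obtain c where c: "a - (\<Sum>b\<in>{b\<in>B. homogeneous k b}. const (c b) * b) \<in> Phi" using span[OF a(1)] by blast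
        let ?Bk = "{b\<in>B. homogeneous k b}"
        have dgk: "dg b = k" if "b \<in> ?Bk" "b \<noteq> 0" for b
          using hom_part_homogeneous[of k b k] hom_part_homogeneous[OF dg, of b k] that by (auto split: if_splits)
        have nz: "b \<noteq> 0" if "b \<in> B" for b
        proof
          assume "b = 0"
          have "(\<Sum>x\<in>B. const (if x = b then 1 else 0) * x) \<in> Phi"
            using that B(1) \<open>b = 0\<close> by (simp add: if_distrib[of const] if_distrib[of "\<lambda>x. x * _"]
                Phi_def ideal.span_zero cong: if_cong)
          then have "\<forall>x\<in>B. (if x = b then 1 else 0 :: complex) = 0" by (rule indep)
          then show False using that by auto
        qed
        define r where "r = a - (\<Sum>b\<in>?Bk. const (c b) * b)"
        have hr: "homogeneous k r" unfolding r_def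
          using a(1) by (intro homogeneous_diff homogeneous_sum homogeneous_const_mult) auto
        obtain h where h: "h \<in> J" "homogeneous (k + M) h" "vanishes_to k (taylor P h)"
          "hom_part k (taylor P h) = sig r"
          using lift_leading_form[OF c[folded r_def], of k] by (auto simp: hom_part_homogeneous[OF hr])
        define s where "s = (\<Sum>b\<in>?Bk. const (c b) * b)"
        have hs: "homogeneous k s" unfolding s_def by (intro homogeneous_sum homogeneous_const_mult) auto
        have sa: "sig a = sig s + sig r" unfolding r_def s_def[symmetric] by (simp add: sig_diff)
        text \<open>Subtract from \<open>f / g\<close> the combination of basis elements and the element of the ideal with the same leading form.\<close>
        define N where "N = lam ^ (k + M) * f - const (1 / eval P g) * (g * (lam ^ M * sig s)) - lam ^ d * h"
        have hN: "homogeneous (d + (k + M)) N"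
        proof -
          have "homogeneous (k + M + d) (lam ^ (k + M) * f)" using Suc.prems(1) by (intro homogeneous_mult) simp_all
          moreover have "homogeneous (d + (M + k)) (g * (lam ^ M * sig s))"
            using Suc.prems(2) hs by (intro homogeneous_mult homogeneous_sig) simp_all
          moreover have "homogeneous (d + (k + M)) (lam ^ d * h)" using h(2) by (intro homogeneous_mult) simp_all
          ultimately show ?thesis unfolding N_def
            by (intro homogeneous_diff homogeneous_const_mult) (simp_all add: add_ac)
        qed
        have lf: "vanishes_to k (taylor P (lam ^ l * q)) \<and> hom_part k (taylor P (lam ^ l * q)) = hom_part k (taylor P q)"
          if "vanishes_to k (taylor P q)" for l q
          using vanishes_to_mult[OF vanishes_to_0(2)[of "taylor P (lam ^ l)"] that] by (simp add: taylor_mult taylor_lam_power)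
        have gs: "vanishes_to k (taylor P (g * (lam ^ M * sig s)))"
          "hom_part k (taylor P (g * (lam ^ M * sig s))) = const (eval P g) * sig s"
          using vanishes_to_mult[OF vanishes_to_0(2)[of "taylor P g"] hom_part_taylor_lam_mult(1)[OF hs, of M]]
            hom_part_taylor_lam_mult(2)[OF hs, of M] by (simp_all add: taylor_mult[of P g] hom_part_0_taylor)
        have cg: "vanishes_to k (const b * q)" if "vanishes_to k q" for b q
          using vanishes_to_mult(1)[OF vanishes_to_0(2)[of "const b"] that] by simp
        have inv: "const (1 / eval P g) * (const (eval P g) * q) = q" for q
          using Suc.prems(3) by (simp flip: mult.assoc const_mult)
        have "vanishes_to (Suc k) (taylor P N)"
          unfolding vanishes_to_Suc
        proof
          show "vanishes_to k (taylor P N)"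
            unfolding N_def taylor_diff taylor_mult[of P "const _"] taylor_const
            using lf[OF fk] lf[OF h(3)] gs(1) by (intro vanishes_to_diff cg) auto
          show "hom_part k (taylor P N) = 0"
            unfolding N_def taylor_diff taylor_mult[of P "const _"] taylor_const hom_part_diff hom_part_const_mult
            using lf[OF fk, of "k + M"] lf[OF h(3), of d] Suc.prems(3) by (simp add: gs(2) inv a(2) h(4) sa)
        qed
        then have "?good (Fract N (g * lam ^ (k + M)))"
          using Suc.IH[OF hN, of "g * lam ^ (k + M)"] Suc.prems(2,3) homogeneous_mult[OF Suc.prems(2) homogeneous_lam_power]
          by (simp add: k)
        then obtain a1 where a1: "Fract N (g * lam ^ (k + M)) - (\<Sum>b\<in>B. Fract (const (a1 b)) 1 * t b) \<in> stalk P Y" by blast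
        have "lam ^ d * h \<in> Y" using J_subset_Y h(1) ideal.subspace_scale[OF sY] by blast
        then have hst: "Fract (lam ^ d * h) (g * lam ^ (k + M)) \<in> stalk P Y"
          by (rule stalkI[where d = "d + (k + M)"])
            (use homogeneous_mult[OF homogeneous_lam_power[of d] h(2)] Suc.prems(3)
              homogeneous_mult[OF Suc.prems(2) homogeneous_lam_power[of "k + M"]] in simp_all)
        \<comment> \<open>The leading form of the fraction \<open>f / g\<close> is that of
          \<open>f\<close> divided by the value of \<open>g\<close> at \<open>P\<close>.\<close>
        define c' where "c' b = (if homogeneous k b then c b / eval P g else 0)" for b
        have "(\<Sum>b\<in>B. Fract (const (c' b)) 1 * t b) = (\<Sum>b\<in>?Bk. Fract (const (c b / eval P g)) 1 * t b)"
          unfolding c'_def using B(1) by (intro sum.mono_neutral_cong_right) (auto simp: fract_collapse)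
        also have "\<dots> = Fract (\<Sum>b\<in>?Bk. const (c b / eval P g) * (lam ^ (k - dg b) * sig b)) (lam ^ k)"
          using dgk nz by (intro sum_t) auto
        also have "(\<Sum>b\<in>?Bk. const (c b / eval P g) * (lam ^ (k - dg b) * sig b)) = const (1 / eval P g) * sig s"
          unfolding s_def sig_sum sum_distrib_left
        proof (rule sum.cong)
          fix b assume b: "b \<in> ?Bk"
          then have "dg b = k" using dgk nz by blast
          then show "const (c b / eval P g) * (lam ^ (k - dg b) * sig b) = const (1 / eval P g) * sig (const (c b) * b)"
            by (simp add: sig_mult flip: mult.assoc const_mult)
        qed simp
        finally have ts: "(\<Sum>b\<in>B. Fract (const (c' b)) 1 * t b) = Fract (const (1 / eval P g) * sig s) (lam ^ k)" .
        have "Fract f g = Fract N (g * lam ^ (k + M)) + Fract (lam ^ d * h) (g * lam ^ (k + M)) +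
          Fract (const (1 / eval P g) * sig s) (lam ^ k)"
        proof -
          have g: "g \<noteq> 0" by (rule eval_nonzero[OF Suc.prems(3)])
          have e1: "Fract f g = Fract (lam ^ (k + M) * f) (g * lam ^ (k + M))"
            using g by (simp add: eq_fract mult_ac)
          have e2: "Fract (const (1 / eval P g) * sig s) (lam ^ k) =
            Fract (const (1 / eval P g) * (g * (lam ^ M * sig s))) (g * lam ^ (k + M))"
            using g by (simp add: eq_fract power_add mult_ac)
          have e3: "Fract p q + Fract p' q = Fract (p + p') q" if "q \<noteq> 0" for p p' q :: "'v cpoly"
            using that by (simp add: eq_fract algebra_simps)
          show ?thesis unfolding e1 e2 using g by (simp add: e3 N_def del: add_fract)
        qed
        then have "Fract f g - (\<Sum>b\<in>B. Fract (const (a1 b + c' b)) 1 * t b) =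
          (Fract N (g * lam ^ (k + M)) - (\<Sum>b\<in>B. Fract (const (a1 b)) 1 * t b)) + Fract (lam ^ d * h) (g * lam ^ (k + M))"
          unfolding fv.scale_left_distrib sum.distrib ts by simp
        also have "\<dots> \<in> stalk P Y"
          using a1 hst by (rule fv.subspace_add[OF subspace_stalk[OF sY P_nonzero]])
        finally show ?thesis by (intro exI[of _ "\<lambda>b. a1 b + c' b"])
      qed
    qed
    fix x assume "x \<in> local_ring P"
    then obtain f g d where x: "x = Fract f g" "homogeneous d f" "homogeneous d g" "eval P g \<noteq> 0"
      unfolding stalk_def by blast
    show "?good x" unfolding x(1) by (rule main[OF x(2-4), of D]) simp
  qed
  show ?thesis using ge le by (simp add: scheme_length_def B(2))
qed

end


subsection \<open>Superfat points\<close>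

text \<open>The elements that multiply a part of \<open>f\<close> into \<open>X\<close> form a
  homogeneous ideal containing \<open>X\<close> and \<open>g\<close>. Its zeros other than the
  origin would be multiples of \<open>P\<close>, where \<open>g\<close> is nonzero; so it contains
  all forms of large degree, and saturation applies.\<close>

lemma primary_at_point:
  assumes X: "closed_subscheme X" "supported_at P X"
    and f: "homogeneous d g" "eval P g \<noteq> 0" "g * f \<in> X"
  shows "f \<in> X"
proof -
  have hX: "homogeneous_ideal X" and sat: "saturation X = X"
    using X(1) by (simp_all add: closed_subscheme_def)
  have sX: "ideal.subspace X" by (rule homogeneous_ideal_subspace[OF hX])
  have "hom_part e f \<in> X" for e
  proof -
    let ?I = "{h. h * hom_part e f \<in> X}"
    have "ideal.subspace ?I"
    proof (rule ideal.subspaceI)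
      show "0 \<in> ?I" using ideal.subspace_0[OF sX] by simp
      show "h + h' \<in> ?I" if "h \<in> ?I" "h' \<in> ?I" for h h'
        using ideal.subspace_add[OF sX, of "h * hom_part e f" "h' * hom_part e f"] that
        by (simp add: distrib_right)
      show "c * h \<in> ?I" if "h \<in> ?I" for c h
        using ideal.subspace_scale[OF sX, of "h * hom_part e f" c] that by (simp add: mult.assoc)
    qed
    moreover have "hom_part k h \<in> ?I" if "h \<in> ?I" for h k
    proof -
      have "hom_part (k + e) (hom_part e f * h) \<in> X"
        using that by (intro homogeneous_idealD[OF hX]) (simp add: mult.commute)
      then show ?thesis
        by (simp add: hom_part_homogeneous_mult[OF homogeneous_hom_part] mult.commute[of "hom_part k h"])
    qed
    ultimately have hI: "homogeneous_ideal ?I" by (simp add: homogeneous_ideal_def)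
    have "g * hom_part e f \<in> X"
      using homogeneous_idealD[OF hX f(3), of "d + e"] by (simp add: hom_part_homogeneous_mult[OF f(1)])
    then have "g \<in> ?I" by simp
    have "\<exists>D. \<forall>k\<ge>D. \<forall>h. homogeneous k h \<longrightarrow> h \<in> ?I"
    proof (rule homogeneous_nullstellensatz[OF hI])
      fix v assume v: "\<And>h. h \<in> ?I \<Longrightarrow> eval v h = 0"
      show "v = 0"
      proof (rule ccontr)
        assume "v \<noteq> 0"
        moreover have "eval v h = 0" if "h \<in> X" for h
          using ideal.subspace_scale[OF sX that, of "hom_part e f"] by (intro v) (simp add: mult.commute)
        ultimately have "v \<in> {c *s P | c. c \<noteq> 0}"
          using X(2) unfolding supported_at_def by blast
        then obtain c where "v = c *s P" "c \<noteq> 0" by blast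
        then show False using v[OF \<open>g \<in> ?I\<close>] f(2) by (simp add: eval_scale[OF f(1)])
      qed
    qed
    then have "hom_part e f \<in> saturation X" unfolding saturation_def by blast
    then show ?thesis using sat by simp
  qed
  then show ?thesis by (rule homogeneous_idealI[OF sX])
qed

context projective_chart
begin

text \<open>The order is raised step by step because only a leading form is known to factor through
  the projection from \<open>P\<close>, which reduces its vanishing to directions of lines.\<close>

lemma symmetric_vanishes:
  assumes sym: "m_symmetric m P X" and m: "m > 0" and f: "f \<in> X" "homogeneous d f"
  shows "vanishes_to m (taylor P f)"
proof -
  have X: "closed_subscheme X" "supported_at P X"
    and len: "\<And>L. line_through P L \<Longrightarrow> scheme_length P (scheme_inter X (vanishing_ideal L)) = enat m"
    using sym by (auto simp: m_symmetric_def)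
  have hX: "homogeneous_ideal X" using X(1) by (simp add: closed_subscheme_def)
  have "P \<in> {c *s P | c. c \<noteq> 0}" by (intro CollectI exI[of _ 1]) simp
  then have fP: "eval P f = 0" using X(2) f(1) unfolding supported_at_def by blast
  have "vanishes_to e (taylor P f)" if "e \<le> m" for e
    using that
  proof (induction e)
    case (Suc e)
    then have e: "vanishes_to e (taylor P f)" by simp
    have "hom_part e (taylor P f) = 0"
    proof (cases "e = 0")
      case True
      then show ?thesis using fP by (simp add: hom_part_0_taylor)
    next
      case False
      have "eval v (hom_part e (taylor P f)) = 0" for v
      proof -
        \<comment> \<open>The projection of \<open>v\<close> from \<open>P\<close> to the hyperplane
          where the coordinate \<open>j\<close> is 0. It is zero when \<open>v\<close> is a multiple
          of \<open>P\<close>, and then positivity of \<open>e\<close> is what counts.\<close>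
        define w where "w = (\<chi> i. eval v (y i))"
        have "eval v (hom_part e (taylor P f)) = eval v (sig (hom_part e (taylor P f)))"
          by (simp add: sig_leading_form[OF f(2) e])
        also have "\<dots> = eval w (hom_part e (taylor P f))"
          unfolding sig_def eval_subst w_def ..
        also have "\<dots> = 0"
        proof (cases "w = 0")
          case True
          then show ?thesis
            using eval_scale[OF homogeneous_hom_part, of 0 0 e "taylor P f"] False by (simp add: power_0_left)
        next
          case w: False
          obtain k where k: "w $ k \<noteq> 0" using w by (auto simp: vec_eq_iff)
          have wj: "w $ j = 0" by (simp add: w_def)
          have "scheme_length P (scheme_inter X (vanishing_ideal {a *s P + b *s w | a b. True})) = enat m"
            by (rule len[OF ex_line_through[OF w wj]])
          from line_length_imp[OF wj k hX this] f(1) Suc.prems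
          show ?thesis by (simp add: coeff_line_poly)
        qed
        finally show ?thesis .
      qed
      then show ?thesis by (rule eval_zero_imp_zero)
    qed
    then show ?case using e by (simp add: vanishes_to_Suc)
  qed simp
  then show ?thesis by blast
qed

lemma symmetric_leading_form_nonzero:
  assumes sym: "m_symmetric m P X" and v: "v \<noteq> 0" "v $ j = 0"
  shows "\<exists>f\<in>X. eval v (hom_part m (taylor P f)) \<noteq> 0"
proof -
  have hX: "homogeneous_ideal X"
    and len: "\<And>L. line_through P L \<Longrightarrow> scheme_length P (scheme_inter X (vanishing_ideal L)) = enat m"
    using sym by (auto simp: m_symmetric_def closed_subscheme_def)
  obtain k where k: "v $ k \<noteq> 0" using v by (auto simp: vec_eq_iff)
  from line_length_imp[OF v(2) k hX len[OF ex_line_through[OF v]]]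
  show ?thesis by (simp add: coeff_line_poly)
qed

text \<open>
  Multiplying the homogeneous parts of \<open>f\<close> by powers of \<open>lam\<close> makes their degrees equal without changing
  their leading forms.
\<close>

lemma ex_form_with_leading:
  assumes sym: "m_symmetric m P X" and m: "m > 0" and "f \<in> X"
  shows "\<exists>N. \<forall>M\<ge>N. \<exists>K\<in>X. homogeneous M K \<and> vanishes_to m (taylor P K) \<and>
    hom_part m (taylor P K) = hom_part m (taylor P f)"
proof -
  have hX: "homogeneous_ideal X" using sym by (simp add: m_symmetric_def closed_subscheme_def)
  have sX: "ideal.subspace X" by (rule homogeneous_ideal_subspace[OF hX])
  obtain N where N: "\<And>M. N \<le> M \<Longrightarrow> f = (\<Sum>d\<le>M. hom_part d f)"
    by (rule ex_sum_hom_parts[of f]) blast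
  show ?thesis
  proof (intro exI[of _ N] allI impI)
    fix M assume M: "N \<le> M"
    let ?K = "\<Sum>d\<le>M. lam ^ (M - d) * hom_part d f"
    have part: "hom_part d f \<in> X" for d by (rule homogeneous_idealD[OF hX assms(3)])
    have v: "vanishes_to m (taylor P (hom_part d f))" for d
      by (rule symmetric_vanishes[OF sym m part homogeneous_hom_part])
    have l: "vanishes_to m (taylor P (lam ^ k * hom_part d f))"
      "hom_part m (taylor P (lam ^ k * hom_part d f)) = hom_part m (taylor P (hom_part d f))" for k d
      using vanishes_to_mult[OF vanishes_to_0(2)[of "taylor P (lam ^ k)"] v]
      by (simp_all add: taylor_mult taylor_lam_power)
    have "?K \<in> X" by (intro ideal.subspace_sum ideal.subspace_scale sX part)
    moreover have "homogeneous M ?K"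
    proof (rule homogeneous_sum)
      fix d assume "d \<in> {..M}"
      then show "homogeneous M (lam ^ (M - d) * hom_part d f)"
        using homogeneous_mult[OF homogeneous_lam_power homogeneous_hom_part, of "M - d" d f] by simp
    qed
    moreover have "vanishes_to m (taylor P ?K)"
      unfolding taylor_sum by (rule vanishes_to_sum) (rule l)
    moreover have "hom_part m (taylor P ?K) = hom_part m (taylor P f)"
      unfolding taylor_sum hom_part_sum l
      by (subst (2) N[OF M]) (simp add: taylor_sum hom_part_sum)
    ultimately show "\<exists>K\<in>X. homogeneous M K \<and> vanishes_to m (taylor P K) \<and>
      hom_part m (taylor P K) = hom_part m (taylor P f)" by blast
  qed
qed

lemma ex_regular_intersection:
  assumes sym: "m_symmetric m P X" and m: "m > 0" and n: "CARD('v) = n + 1"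
  obtains M Ks where "regular_intersection P j m M Ks" "length Ks = n" "set Ks \<subseteq> X" "M > 0"
proof -
  have hX: "homogeneous_ideal X" using sym by (simp add: m_symmetric_def closed_subscheme_def)
  have sX: "ideal.subspace X" by (rule homogeneous_ideal_subspace[OF hX])
  let ?l = "\<lambda>f. hom_part m (taylor P f)"
  have "cv.subspace (?l ` X)"
  proof (rule cv.subspaceI)
    show "0 \<in> ?l ` X" by (rule image_eqI[of _ _ 0]) (simp_all add: ideal.subspace_0[OF sX])
    show "F + G \<in> ?l ` X" if "F \<in> ?l ` X" "G \<in> ?l ` X" for F G
    proof -
      obtain f g where "f \<in> X" "g \<in> X" "F = ?l f" "G = ?l g" using \<open>F \<in> _\<close> \<open>G \<in> _\<close> by blast
      then show ?thesis
        by (intro image_eqI[of _ _ "f + g"]) (simp_all add: taylor_add hom_part_add ideal.subspace_add[OF sX])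
    qed
    show "const c * F \<in> ?l ` X" if "F \<in> ?l ` X" for c F
    proof -
      obtain f where "f \<in> X" "F = ?l f" using \<open>F \<in> _\<close> by blast
      then show ?thesis
        by (intro image_eqI[of _ _ "const c * f"])
          (simp_all add: taylor_mult hom_part_const_mult ideal.subspace_scale[OF sX])
    qed
  qed
  moreover have "\<exists>F\<in>?l ` X. eval v F \<noteq> 0" if "v \<noteq> 0" "v $ j = 0" for v
    using symmetric_leading_form_nonzero[OF sym that] by blast
  ultimately have "\<exists>Gs. length Gs = n \<and> set Gs \<subseteq> ?l ` X \<and> regular {var j} Gs \<and>
    contains_large_degrees (ideal.span (insert (var j) (set Gs)))"
    using m n by (intro ex_regular_forms[where m = m]) auto
  then obtain Gs where Gs: "length Gs = n" "set Gs \<subseteq> ?l ` X" "regular {var j} Gs"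
    "contains_large_degrees (ideal.span (insert (var j) (set Gs)))" by blast
  have "\<exists>N. \<forall>M\<ge>N. \<exists>K\<in>X. homogeneous M K \<and> vanishes_to m (taylor P K) \<and> ?l K = G" if "G \<in> set Gs" for G
    using ex_form_with_leading[OF sym m] Gs(2) that by blast
  then have "\<forall>G\<in>set Gs. \<exists>N. \<forall>M\<ge>N. \<exists>K\<in>X. homogeneous M K \<and> vanishes_to m (taylor P K) \<and> ?l K = G"
    by blast
  then obtain N where N: "\<And>G M. G \<in> set Gs \<Longrightarrow> N G \<le> M \<Longrightarrow>
    \<exists>K\<in>X. homogeneous M K \<and> vanishes_to m (taylor P K) \<and> ?l K = G"
    unfolding bchoice_iff by blast
  \<comment> \<open>One degree that is large enough for all leading forms; the successor makes it
    positive, as \<open>hypersurface\<close> demands.\<close>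
  define M where "M = Suc (\<Sum>G\<in>set Gs. N G)"
  have "N G \<le> M" if "G \<in> set Gs" for G
    unfolding M_def using that member_le_sum[of G "set Gs" N] by simp
  then have "\<forall>G\<in>set Gs. \<exists>K. K \<in> X \<and> homogeneous M K \<and> vanishes_to m (taylor P K) \<and> ?l K = G"
    using N by blast
  then obtain k where k: "\<And>G. G \<in> set Gs \<Longrightarrow> k G \<in> X \<and> homogeneous M (k G) \<and>
    vanishes_to m (taylor P (k G)) \<and> ?l (k G) = G"
    unfolding bchoice_iff by blast
  have lead: "map ?l (map k Gs) = Gs" using k by (simp add: map_idI)
  then have "?l ` set (map k Gs) = set Gs" by (metis list.set_map)
  then have "regular_intersection P j m M (map k Gs)"
    using k lead Gs(3,4) m by unfold_locales auto
  moreover have "set (map k Gs) \<subseteq> X" using k by auto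
  moreover have "length (map k Gs) = n" "M > 0" by (simp_all add: Gs(1) M_def)
  ultimately show thesis by (metis that)
qed

end

context regular_intersection
begin

text \<open>If 0 were a nonzerodivisor modulo the earlier members, their ideal would contain 1, but
  it is generated by forms of positive degree.\<close>

lemma lead_nonzero:
  assumes "K \<in> set Ks"
  shows "lead K \<noteq> 0"
proof
  assume 0: "lead K = 0"
  obtain xs ys where Ks: "Ks = xs @ K # ys" using assms by (metis split_list)
  let ?I = "ideal.span (insert (var j) (set (map lead xs)))"
  have "regular {var j} (map lead (xs @ K # ys))"
    using regular_leading unfolding Ks lead_def[abs_def] .
  then have "nzd ?I (lead K)" by (simp add: regular_append)
  then have "1 \<in> ?I" by (rule nzdD) (simp add: 0 ideal.span_zero)
  moreover have "hom_part 0 f = 0" if "f \<in> ?I" for f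
    using that
  proof (induction rule: ideal.span_induct_alt)
    case (step c x z)
    have "hom_part 0 (x * c) = 0"
      using step(1)
    proof
      assume "x = var j"
      then show ?thesis by (simp add: hom_part_homogeneous_mult[OF homogeneous_var])
    next
      assume "x \<in> set (map lead xs)"
      then show ?thesis using m by (auto simp: hom_part_homogeneous_mult[OF homogeneous_lead])
    qed
    then show ?case using step(2) by (simp add: hom_part_add mult.commute)
  qed simp
  ultimately have "hom_part 0 (1 :: 'v cpoly) = 0" by blast
  then show False by (simp add: hom_part_homogeneous[OF homogeneous_1])
qed

lemma multiplicity_K:
  assumes "K \<in> set Ks"
  shows "multiplicity_at P K = m"
  unfolding multiplicity_at_def
proof (rule Least_equality)
  show "hom_part m (taylor P K) \<noteq> 0" using lead_nonzero[OF assms] by (simp add: lead_def)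
  show "m \<le> e" if "hom_part e (taylor P K) \<noteq> 0" for e
    using vanishes_toD[OF vanishes_K[OF assms], of e] that by force
qed

end

theorem theorem2p8:
  fixes n m :: nat
    and P :: "complex ^ 'v::{finite,linorder}"
    and X :: "'v cpoly set"
  assumes "CARD('v) = n + 1" and "n \<ge> 1" and "m \<ge> 1"
    and "P \<noteq> 0"
    and "superfat_point m P X"
  shows "(\<exists>K :: nat \<Rightarrow> 'v cpoly.
            (\<forall>i<n. hypersurface (K i) \<and> multiplicity_at P (K i) = m) \<and>
            \<not> (\<exists>L. line_through P L \<and> (\<forall>i<n. L \<subseteq> tangent_cone P (K i))) \<and>
            stalk P X = stalk P (scheme_of (K ` {..<n})))
         \<and> scheme_length P X = enat (m ^ n)"
proof -
  have sym: "m_symmetric m P X" and max: "\<And>Y. m_symmetric m P Y \<Longrightarrow> subscheme_le X Y \<Longrightarrow> Y = X"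
    using assms(5) by (auto simp: superfat_point_def)
  obtain j where j: "P $ j \<noteq> 0" using assms(4) by (auto simp: vec_eq_iff)
  interpret projective_chart P j by unfold_locales (rule j)
  have m: "m > 0" using assms(3) by simp
  obtain M Ks where Ks: "regular_intersection P j m M Ks" "length Ks = n" "set Ks \<subseteq> X" "M > 0"
    by (rule ex_regular_intersection[OF sym m assms(1)])
  interpret R: regular_intersection P j m M Ks by (rule Ks(1))
  have X: "closed_subscheme X" "supported_at P X" using sym by (auto simp: m_symmetric_def)
  \<comment> \<open>Each element of \<open>R.Y\<close> is multiplied into \<open>R.J\<close>, hence
    into \<open>X\<close>, by a form that is nonzero at \<open>P\<close>. It can be cancelled
    because \<open>X\<close> is supported at \<open>[P]\<close>.\<close>
  have "R.Y \<subseteq> X"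
  proof
    fix f assume "f \<in> R.Y"
    then obtain d g where g: "homogeneous d g" "eval P g \<noteq> 0" "g * f \<in> R.J" unfolding R.Y_def by blast
    have "R.J \<subseteq> X"
      unfolding R.J_def using X(1) Ks(3)
      by (intro ideal.span_minimal) (auto simp: closed_subscheme_def homogeneous_ideal_def)
    then show "f \<in> X" using primary_at_point[OF X g(1,2)] g(3) by blast
  qed
  \<comment> \<open>An inclusion of ideals is the reverse inclusion of schemes: \<open>X\<close>
    lies in the \<open>m\<close>-symmetric scheme \<open>R.Y\<close>, so maximality gives
    equality.\<close>
  then have Y: "R.Y = X" by (intro max R.m_symmetric_Y) (simp add: subscheme_le_def)
  have nth: "(!) Ks ` {..<n} = set Ks" using Ks(2) by (auto simp: set_conv_nth)
  show ?thesis
  proof (intro conjI exI[of _ "(!) Ks"] allI impI)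
    fix i assume "i < n"
    then have K: "Ks ! i \<in> set Ks" using Ks(2) by simp
    have "Ks ! i \<noteq> 0" using R.lead_nonzero[OF K] by (auto simp: R.lead_def)
    then show "hypersurface (Ks ! i)"
      using R.homogeneous_K[OF K] Ks(4) by (auto simp: hypersurface_def)
    show "multiplicity_at P (Ks ! i) = m" by (rule R.multiplicity_K[OF K])
  next
    have cone: "tangent_cone P K = {v. eval v (R.lead K) = 0}" if "K \<in> set Ks" for K
      using R.multiplicity_K[OF that] by (simp add: tangent_cone_def R.lead_def)
    then have "tangent_cone P (Ks ! i) = {v. eval v (R.lead (Ks ! i)) = 0}" if "i < n" for i
      using that Ks(2) by simp
    then have "(\<forall>i<n. L \<subseteq> tangent_cone P (Ks ! i)) \<longleftrightarrow> (\<forall>K\<in>set Ks. L \<subseteq> {v. eval v (R.lead K) = 0})" for L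
      by (simp add: all_set_conv_all_nth Ks(2))
    then show "\<not> (\<exists>L. line_through P L \<and> (\<forall>i<n. L \<subseteq> tangent_cone P (Ks ! i)))"
      using R.no_common_line by simp
    show "stalk P X = stalk P (scheme_of ((!) Ks ` {..<n}))"
      using R.stalk_Y by (simp add: Y nth)
    show "scheme_length P X = enat (m ^ n)"
      using R.length_Y[OF assms(1) Ks(2)] by (simp add: Y)
  qed
qed

end
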